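(* Let $(\Sigma,g)$ be a $C^2$ Riemannian manifold with $C^2$ boundary, let $\gamma:[a,b]\to\Sigma$ be a $C^2$ curve, let $W$ be a $C^1$ vector field along $\gamma$, and let $u:\Sigma\to\mathbb R^m$ be an isometric immersion of class $C^{1,\alpha}$ for some $\alpha>\frac12$. Then, in any local coordinates $(x_1,\dots,x_n)$ (on any interval of parameters $t$ for which $\gamma(t)$ stays in the coordinate patch) and for every index $\ell$, the following identity holds in the sense of distributions in $t$: $$\left\langle \frac{d}{dt}\big(u_*W\big),\ \frac{\partial u}{\partial x_\ell}(\gamma)\right\rangle=\sum_i\left(\frac{dW^i}{dt}+\sum_{j,k}\Gamma^i_{jk}(\gamma)\,\dot\gamma^j\,W^k\right)g_{i\ell}(\gamma),$$ where $W=\sum_iW^i(t)\frac{\partial}{\partial x_i}$, $\dot\gamma=\sum_i\dot\gamma^i(t)\frac{\partial}{\partial x_i}$, $\Gamma^i_{jk}$ are the Christoffel symbols of $g$, and $u_*W=\sum_i W^i\,\frac{\partial u}{\partial x_i}(\gamma)$, which is a $C^\alpha$ function of $t$ with values in $\mathbb R^m$.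
   Context: Here the metric coefficients $g_{ij}$ are $C^2$ in local coordinates, so the $\Gamma^i_{jk}$ are $C^1$ functions; $u$ isometric means that the pull-back of the Euclidean metric under $u$ is $g$, i.e. $\langle\partial_iu,\partial_ju\rangle=g_{ij}$. Hölder exponents lie in $(0,1)$. Meaning of the left-hand side. Let $\alpha>\frac12$, let $I=[c,d]$ be a closed interval, and let $C^{1,\alpha}_0(I)$ be the closure in $C^{1,\alpha}(I)$ of the $C^{1,\alpha}$ functions compactly supported in $(c,d)$. For $f,p\in C^\alpha(I)$ the product $f\,p'$ is defined as the element of the dual space $(C^{1,\alpha}_0(I))^*$ given by $\varphi\mapsto\lim_{k\to\infty}\int_I f\,p_k'\,\varphi\,dt$, where $p_k\in C^1(I)$ is any sequence converging to $p$ in $C^\beta(I)$ for some $\beta\in(\frac12,\alpha)$; the limit exists and does not depend on the choice of the sequence. When $p\in C^1$ this is just integration of $fp'$ against $\varphi$. For $\mathbb R^m$-valued $C^\alpha$ functions $P,F$, $\langle \frac{d}{dt}P,F\rangle$ is the sum over components of the products $F^s\,(P^s)'$ so defined. A continuous function (such as the right-hand side) is identified with the functional given by integration against $\varphi$. *)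

theory Defs
  imports "HOL-Analysis.Analysis"
begin

section \<open>Functions of class C1 and C2 up to the boundary\<close>

text \<open>All derivatives are taken within the domain \<open>V\<close>. The definitions are used only for sets \<open>V\<close>
  that are open or of the form \<open>C2_domain\<close> below (respectively for relatively open subsets of
  nondegenerate closed intervals), where derivatives within \<open>V\<close> are unique.\<close>

definition partial_deriv ::
  "(real^'n) set \<Rightarrow> (real^'n \<Rightarrow> 'b::real_normed_vector) \<Rightarrow> 'n \<Rightarrow> real^'n \<Rightarrow> 'b" where
  "partial_deriv V f i x = frechet_derivative f (at x within V) (axis i 1)"

definition C1_on :: "(real^'n) set \<Rightarrow> (real^'n \<Rightarrow> 'b::real_normed_vector) \<Rightarrow> bool" where
  "C1_on V f \<longleftrightarrow> f differentiable_on V \<and> (\<forall>i. continuous_on V (partial_deriv V f i))"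

definition C2_on :: "(real^'n) set \<Rightarrow> (real^'n \<Rightarrow> 'b::real_normed_vector) \<Rightarrow> bool" where
  "C2_on V f \<longleftrightarrow> C1_on V f \<and> (\<forall>i. C1_on V (partial_deriv V f i))"

definition deriv_in :: "real set \<Rightarrow> (real \<Rightarrow> 'b::real_normed_vector) \<Rightarrow> real \<Rightarrow> 'b" where
  "deriv_in T f t = vector_derivative f (at t within T)"

definition C1_path_on :: "real set \<Rightarrow> (real \<Rightarrow> 'b::real_normed_vector) \<Rightarrow> bool" where
  "C1_path_on T f \<longleftrightarrow> f differentiable_on T \<and> continuous_on T (deriv_in T f)"

definition C2_path_on :: "real set \<Rightarrow> (real \<Rightarrow> 'b::real_normed_vector) \<Rightarrow> bool" where
  "C2_path_on T f \<longleftrightarrow> C1_path_on T f \<and> C1_path_on T (deriv_in T f)"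


section \<open>Manifolds with boundary\<close>

text \<open>Coordinate images are relatively open subsets of closed domains with C2 boundary. Relatively
  open subsets of a closed half-space are a special case (take \<open>\<rho>\<close> to be a coordinate function); the
  general form also allows coordinates that do not straighten the boundary.\<close>

definition C2_domain :: "(real^'n) set \<Rightarrow> bool" where
  "C2_domain V \<longleftrightarrow> (\<forall>p\<in>V. \<exists>N. open N \<and> p \<in> N \<and>
     (N \<subseteq> V \<or>
      (\<exists>\<rho>::real^'n \<Rightarrow> real. C2_on N \<rho> \<and> \<rho> p = 0 \<and> (\<exists>i. partial_deriv N \<rho> i p \<noteq> 0) \<and>
         V \<inter> N = {x \<in> N. 0 \<le> \<rho> x})))"

text \<open>A chart consists of its patch and its coordinate map.\<close>

type_synonym ('a, 'n) chart = "'a set \<times> ('a \<Rightarrow> real^'n)"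

definition chart_image :: "('a, 'n::finite) chart \<Rightarrow> (real^'n) set" where
  "chart_image \<kappa> = snd \<kappa> ` fst \<kappa>"

definition chart_inv :: "('a, 'n::finite) chart \<Rightarrow> real^'n \<Rightarrow> 'a" where
  "chart_inv \<kappa> = inv_into (fst \<kappa>) (snd \<kappa>)"

definition is_chart :: "'a topology \<Rightarrow> ('a, 'n::finite) chart \<Rightarrow> bool" where
  "is_chart X \<kappa> \<longleftrightarrow> openin X (fst \<kappa>) \<and> C2_domain (chart_image \<kappa>) \<and>
     homeomorphic_map (subtopology X (fst \<kappa>)) (top_of_set (chart_image \<kappa>)) (snd \<kappa>)"

definition manifold_with_boundary :: "'a topology \<Rightarrow> ('a, 'n::finite) chart set \<Rightarrow> bool" where
  "manifold_with_boundary X A \<longleftrightarrow>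
     Hausdorff_space X \<and> second_countable X \<and>
     (\<forall>\<kappa>\<in>A. is_chart X \<kappa>) \<and> topspace X = (\<Union>\<kappa>\<in>A. fst \<kappa>) \<and>
     (\<forall>\<kappa>\<in>A. \<forall>\<kappa>'\<in>A. C2_on (snd \<kappa> ` (fst \<kappa> \<inter> fst \<kappa>')) (snd \<kappa>' \<circ> chart_inv \<kappa>))"


section \<open>Tangent vectors and Riemannian metrics\<close>

definition transition_deriv :: "('a, 'n::finite) chart \<Rightarrow> ('a, 'n::finite) chart \<Rightarrow> 'a \<Rightarrow> real^'n \<Rightarrow> real^'n" where
  "transition_deriv \<kappa> \<kappa>' p =
     frechet_derivative (snd \<kappa>' \<circ> chart_inv \<kappa>) (at (snd \<kappa> p) within snd \<kappa> ` (fst \<kappa> \<inter> fst \<kappa>'))"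

text \<open>A tangent vector at \<open>p\<close> is given by its components in every chart of the atlas around \<open>p\<close>,
  subject to the transformation law; the value at all other charts is fixed to be 0, so that
  tangent vectors are determined by their components.\<close>

type_synonym ('a, 'n) tvec = "('a, 'n) chart \<Rightarrow> real^'n"

definition tangent_space :: "('a, 'n::finite) chart set \<Rightarrow> 'a \<Rightarrow> ('a, 'n::finite) tvec set" where
  "tangent_space A p = {v.
     (\<forall>\<kappa>\<in>A. \<forall>\<kappa>'\<in>A. p \<in> fst \<kappa> \<and> p \<in> fst \<kappa>' \<longrightarrow> v \<kappa>' = transition_deriv \<kappa> \<kappa>' p (v \<kappa>)) \<and>
     (\<forall>\<kappa>. \<not> (\<kappa> \<in> A \<and> p \<in> fst \<kappa>) \<longrightarrow> v \<kappa> = 0)}"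

definition coord_vector :: "('a, 'n::finite) chart set \<Rightarrow> ('a, 'n::finite) chart \<Rightarrow> 'n \<Rightarrow> 'a \<Rightarrow> ('a, 'n::finite) tvec" where
  "coord_vector A \<kappa> i p =
     (\<lambda>\<kappa>'. if \<kappa>' \<in> A \<and> p \<in> fst \<kappa>' then transition_deriv \<kappa> \<kappa>' p (axis i 1) else 0)"

type_synonym ('a, 'n) metric_tensor = "'a \<Rightarrow> ('a, 'n) tvec \<Rightarrow> ('a, 'n) tvec \<Rightarrow> real"

definition metric_coeff ::
  "('a, 'n::finite) chart set \<Rightarrow> ('a, 'n::finite) metric_tensor \<Rightarrow> ('a, 'n::finite) chart \<Rightarrow> 'n \<Rightarrow> 'n \<Rightarrow> real^'n \<Rightarrow> real" where
  "metric_coeff A g \<kappa> i j x =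
     g (chart_inv \<kappa> x) (coord_vector A \<kappa> i (chart_inv \<kappa> x)) (coord_vector A \<kappa> j (chart_inv \<kappa> x))"

definition inner_product_on :: "('a, 'n::finite) tvec set \<Rightarrow> (('a, 'n::finite) tvec \<Rightarrow> ('a, 'n::finite) tvec \<Rightarrow> real) \<Rightarrow> bool" where
  "inner_product_on T h \<longleftrightarrow>
     (\<forall>v\<in>T. \<forall>w\<in>T. h v w = h w v) \<and>
     (\<forall>v\<in>T. \<forall>v'\<in>T. \<forall>w\<in>T. \<forall>a b. h (\<lambda>\<kappa>. a *\<^sub>R v \<kappa> + b *\<^sub>R v' \<kappa>) w = a * h v w + b * h v' w) \<and>
     (\<forall>v\<in>T. v \<noteq> (\<lambda>_. 0) \<longrightarrow> 0 < h v v)"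

text \<open>The coefficients of the metric are C2 in the charts of \<open>A\<close>. The atlas is not required to be
  maximal, so ``any local coordinates'' means any chart of an arbitrary C2 atlas with this property.\<close>

definition riemannian_manifold ::
  "'a topology \<Rightarrow> ('a, 'n::finite) chart set \<Rightarrow> ('a, 'n::finite) metric_tensor \<Rightarrow> bool" where
  "riemannian_manifold X A g \<longleftrightarrow>
     manifold_with_boundary X A \<and>
     (\<forall>p\<in>topspace X. inner_product_on (tangent_space A p) (g p)) \<and>
     (\<forall>\<kappa>\<in>A. \<forall>i j. C2_on (chart_image \<kappa>) (metric_coeff A g \<kappa> i j))"

definition christoffel ::
  "('a, 'n::finite) chart set \<Rightarrow> ('a, 'n::finite) metric_tensor \<Rightarrow> ('a, 'n::finite) chart \<Rightarrow> 'n \<Rightarrow> 'n \<Rightarrow> 'n \<Rightarrow> real^'n \<Rightarrow> real" where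
  "christoffel A g \<kappa> i j k x =
     1 / 2 * (\<Sum>l\<in>UNIV. matrix_inv (\<chi> p q. metric_coeff A g \<kappa> p q x) $ i $ l *
        (partial_deriv (chart_image \<kappa>) (metric_coeff A g \<kappa> l k) j x
       + partial_deriv (chart_image \<kappa>) (metric_coeff A g \<kappa> j l) k x
       - partial_deriv (chart_image \<kappa>) (metric_coeff A g \<kappa> j k) l x))"


section \<open>Curves, vector fields along curves, isometric immersions\<close>

definition C2_curve :: "'a topology \<Rightarrow> ('a, 'n::finite) chart set \<Rightarrow> real \<Rightarrow> real \<Rightarrow> (real \<Rightarrow> 'a) \<Rightarrow> bool" where
  "C2_curve X A a b \<gamma> \<longleftrightarrow>
     continuous_map (top_of_set {a..b}) X \<gamma> \<and>
     (\<forall>\<kappa>\<in>A. C2_path_on {t\<in>{a..b}. \<gamma> t \<in> fst \<kappa>} (snd \<kappa> \<circ> \<gamma>))"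

definition C1_field_along ::
  "('a, 'n::finite) chart set \<Rightarrow> real \<Rightarrow> real \<Rightarrow> (real \<Rightarrow> 'a) \<Rightarrow> (real \<Rightarrow> ('a, 'n::finite) tvec) \<Rightarrow> bool" where
  "C1_field_along A a b \<gamma> W \<longleftrightarrow>
     (\<forall>t\<in>{a..b}. W t \<in> tangent_space A (\<gamma> t)) \<and>
     (\<forall>\<kappa>\<in>A. C1_path_on {t\<in>{a..b}. \<gamma> t \<in> fst \<kappa>} (\<lambda>t. W t \<kappa>))"

definition holder_on :: "real \<Rightarrow> 'c::metric_space set \<Rightarrow> ('c \<Rightarrow> 'b::real_normed_vector) \<Rightarrow> bool" where
  "holder_on \<alpha> S f \<longleftrightarrow> (\<exists>C. \<forall>x\<in>S. \<forall>y\<in>S. norm (f x - f y) \<le> C * dist x y powr \<alpha>)"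

text \<open>\<open>\<partial>u/\<partial>x\<^sub>i\<close> as a function of the coordinates.\<close>

definition coord_deriv ::
  "('a, 'n::finite) chart \<Rightarrow> ('a \<Rightarrow> 'b::real_normed_vector) \<Rightarrow> 'n \<Rightarrow> real^'n \<Rightarrow> 'b" where
  "coord_deriv \<kappa> u i = partial_deriv (chart_image \<kappa>) (u \<circ> chart_inv \<kappa>) i"

text \<open>Hoelder continuity of the first derivatives is required locally, as usual on a manifold that
  need not be compact.\<close>

definition C1_holder_map ::
  "('a, 'n::finite) chart set \<Rightarrow> real \<Rightarrow> ('a \<Rightarrow> 'b::real_normed_vector) \<Rightarrow> bool" where
  "C1_holder_map A \<alpha> u \<longleftrightarrow>
     (\<forall>\<kappa>\<in>A. C1_on (chart_image \<kappa>) (u \<circ> chart_inv \<kappa>) \<and>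
        (\<forall>i. \<forall>x\<in>chart_image \<kappa>. \<exists>N. open N \<and> x \<in> N \<and>
           holder_on \<alpha> (chart_image \<kappa> \<inter> N) (coord_deriv \<kappa> u i)))"

definition isometric_immersion ::
  "('a, 'n::finite) chart set \<Rightarrow> ('a, 'n::finite) metric_tensor \<Rightarrow> real \<Rightarrow> ('a \<Rightarrow> 'b::real_inner) \<Rightarrow> bool" where
  "isometric_immersion A g \<alpha> u \<longleftrightarrow>
     C1_holder_map A \<alpha> u \<and>
     (\<forall>\<kappa>\<in>A. \<forall>x\<in>chart_image \<kappa>.
        inj (frechet_derivative (u \<circ> chart_inv \<kappa>) (at x within chart_image \<kappa>)) \<and>
        (\<forall>i j. coord_deriv \<kappa> u i x \<bullet> coord_deriv \<kappa> u j x = metric_coeff A g \<kappa> i j x))"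

definition pushforward ::
  "('a, 'n::finite) chart \<Rightarrow> ('a \<Rightarrow> 'b::real_normed_vector) \<Rightarrow> 'a \<Rightarrow> ('a, 'n::finite) tvec \<Rightarrow> 'b" where
  "pushforward \<kappa> u p v = (\<Sum>i\<in>UNIV. (v \<kappa> $ i) *\<^sub>R coord_deriv \<kappa> u i (snd \<kappa> p))"


section \<open>The product of a Hoelder function with the derivative of a Hoelder function\<close>

text \<open>The suprema below are finite wherever the norms are used, namely on Hoelder functions on
  compact intervals.\<close>

definition holder_norm :: "real \<Rightarrow> real set \<Rightarrow> (real \<Rightarrow> real) \<Rightarrow> real" where
  "holder_norm \<beta> I f =
     (SUP t\<in>I. \<bar>f t\<bar>) +
     (SUP (s, t)\<in>{(s, t). s \<in> I \<and> t \<in> I \<and> s \<noteq> t}. \<bar>f s - f t\<bar> / \<bar>s - t\<bar> powr \<beta>)"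

definition holder_converges :: "real \<Rightarrow> real set \<Rightarrow> (nat \<Rightarrow> real \<Rightarrow> real) \<Rightarrow> (real \<Rightarrow> real) \<Rightarrow> bool" where
  "holder_converges \<beta> I q p \<longleftrightarrow>
     (\<forall>k. holder_on \<beta> I (\<lambda>t. q k t - p t)) \<and>
     (\<lambda>k. holder_norm \<beta> I (\<lambda>t. q k t - p t)) \<longlonglongrightarrow> 0"

definition C1_holder :: "real \<Rightarrow> real set \<Rightarrow> (real \<Rightarrow> real) set" where
  "C1_holder \<alpha> I = {\<phi>. C1_path_on I \<phi> \<and> holder_on \<alpha> I (deriv_in I \<phi>)}"

definition C1_holder_norm :: "real \<Rightarrow> real set \<Rightarrow> (real \<Rightarrow> real) \<Rightarrow> real" where
  "C1_holder_norm \<alpha> I \<phi> = (SUP t\<in>I. \<bar>\<phi> t\<bar>) + holder_norm \<alpha> I (deriv_in I \<phi>)"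

definition C1_holder0 :: "real \<Rightarrow> real set \<Rightarrow> (real \<Rightarrow> real) set" where
  "C1_holder0 \<alpha> I = {\<phi> \<in> C1_holder \<alpha> I.
     \<exists>\<psi>. (\<forall>k. \<psi> k \<in> C1_holder \<alpha> I \<and>
              (\<exists>K. compact K \<and> K \<subseteq> interior I \<and> (\<forall>t\<in>I - K. \<psi> k t = 0))) \<and>
         (\<lambda>k. C1_holder_norm \<alpha> I (\<lambda>t. \<psi> k t - \<phi> t)) \<longlonglongrightarrow> 0}"

text \<open>\<open>holder_product \<alpha> I f p\<close> is the functional \<open>f p'\<close>: the common limit along all
  approximating sequences.\<close>

definition holder_product ::
  "real \<Rightarrow> real set \<Rightarrow> (real \<Rightarrow> real) \<Rightarrow> (real \<Rightarrow> real) \<Rightarrow> (real \<Rightarrow> real) \<Rightarrow> real" where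
  "holder_product \<alpha> I f p \<phi> = (THE L. \<forall>\<beta> q.
     1 / 2 < \<beta> \<and> \<beta> < \<alpha> \<and> (\<forall>k. C1_path_on I (q k)) \<and> holder_converges \<beta> I q p \<longrightarrow>
     (\<lambda>k. integral I (\<lambda>t. f t * deriv_in I (q k) t * \<phi> t)) \<longlonglongrightarrow> L)"

text \<open>The pairing of the distributional derivative of \<open>P\<close> with \<open>F\<close>, for vector-valued functions.\<close>

definition inner_deriv_product ::
  "real \<Rightarrow> real set \<Rightarrow> (real \<Rightarrow> real^'m::finite) \<Rightarrow> (real \<Rightarrow> real^'m) \<Rightarrow> (real \<Rightarrow> real) \<Rightarrow> real" where
  "inner_deriv_product \<alpha> I P F \<phi> =
     (\<Sum>s\<in>UNIV. holder_product \<alpha> I (\<lambda>t. F t $ s) (\<lambda>t. P t $ s) \<phi>)"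

end

(* Mollification is avoided. Put A_i = \<partial>_i u in coordinates. Comparing u with its Taylor polynomial at a point q,
   the symmetrized derivative of the vector field \<open>y \<mapsto> (\<langle>u (q + y) - u q - du q y, A_l q\<rangle>)_l\<close> is prescribed by the
   metric up to an error of order |y|^(2\<alpha>), because u is isometric and du is \<alpha>-Hoelder. A discrete Korn inequality,
   summed over dyadic scales, recovers the field itself:
     \<langle>u (q + y) - u q - du q y, A_l q\<rangle> = 1/2 \<Gamma>_{jk,l}(q) y^j y^k + O(|y|^(2 + 2\<alpha>)).
   It is applied only to y in a cone pointing into the domain, so boundary points need no special treatment. Comparing the
   expansions at two points p, q at equal third points gives
     \<langle>A_i q - A_i p, A_l p\<rangle> = \<Gamma>_{ik,l}(p) (q - p)^k + o(|q - p|),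
   locally uniformly, since 2\<alpha> > 1. By Young's estimate the functional f p' is a limit of dyadic Riemann sums, and along
   the curve the last expansion turns these sums into Riemann sums of the right-hand side. *)
theory Submission
  imports Defs
begin

text \<open>The obstacle: an isometry prescribes only the squared lengths of du(b), a symmetric
  quantity, while the individual products of increments of du with du must be recovered although u
  has no second derivatives. For smooth u the Koszul formula does this by permuting three
  derivatives; \<open>rigidity_bound\<close> is its finite-difference substitute. Errors are
  recorded as \<eta> times powers of a scale s, with \<eta> as small as desired on small scales: a
  squared Hoelder increment s^(2\<alpha>) is at most \<eta> s there. In \<open>second_order\<close>
  the error is \<eta> s^3 because both tested vectors have size s as well; comparing two base points
  divides by s^2 and leaves \<eta> s, with s proportional to |q - p|. An error o(|q - p|) is exactly
  what Riemann sums tolerate: 2^n cells of length 2^(-n) add up to o(1). The factor \<partial>_l u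
  is evaluated at the base point p of the increment, which becomes the left end point of a cell, so
  no product rule for nondifferentiable functions is ever invoked.\<close>

section \<open>Cones and rigidity\<close>

text \<open>Shared by the two dyadic arguments: scales shrinking to a point in
  \<open>rigidity_bound\<close>, and refinements of a partition in \<open>young_dyadic_sum\<close>.
  Summing a telescoping series compares the limit with the very first term, and that is where the
  wanted bound is read off.\<close>

lemma geometric_steps:
  fixes a :: "nat \<Rightarrow> real"
  assumes step: "\<And>k. \<bar>a (Suc k) - a k\<bar> \<le> c * \<rho> ^ k" and \<rho>: "0 \<le> \<rho>" "\<rho> < 1"
  shows "convergent a" and "\<bar>lim a - a 0\<bar> \<le> c / (1 - \<rho>)"
proof -
  have g: "(\<lambda>k. c * \<rho> ^ k) sums (c * (1 / (1 - \<rho>)))"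
    using geometric_sums[of \<rho>] \<rho> by (intro sums_mult) auto
  have s: "summable (\<lambda>k. a (Suc k) - a k)"
    by (rule summable_comparison_test'[OF sums_summable[OF g], of 0]) (use step in simp)
  have "(\<lambda>n. \<Sum>k<n. a (Suc k) - a k) \<longlonglongrightarrow> (\<Sum>k. a (Suc k) - a k)"
    using s by (rule summable_LIMSEQ)
  then have "(\<lambda>n. a n - a 0) \<longlonglongrightarrow> (\<Sum>k. a (Suc k) - a k)"
    by (simp add: sum_lessThan_telescope)
  from tendsto_add[OF this tendsto_const[of "a 0"]]
  have l: "a \<longlonglongrightarrow> (\<Sum>k. a (Suc k) - a k) + a 0" by simp
  then show "convergent a" by (rule convergentI)
  have "lim a - a 0 = (\<Sum>k. a (Suc k) - a k)" using l by (simp add: limI)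
  moreover have "\<bar>\<Sum>k. a (Suc k) - a k\<bar> \<le> (\<Sum>k. c * \<rho> ^ k)"
    using norm_suminf_le[of "\<lambda>k. a (Suc k) - a k" "\<lambda>k. c * \<rho> ^ k"] step g sums_summable by force
  ultimately show "\<bar>lim a - a 0\<bar> \<le> c / (1 - \<rho>)" using sums_unique[OF g] by simp
qed

text \<open>\<open>Y\<close> will be a ball \<open>cball e r\<close>: for \<open>e\<close> = 0 the
  result is a ball around 0, and for \<open>e\<close> longer than \<open>r\<close> a solid cone with
  vertex 0. The parameter \<open>s\<close> is the scale, so dilations act on it alone.\<close>

definition truncated_cone :: "'a::real_vector set \<Rightarrow> real \<Rightarrow> 'a set" where
  "truncated_cone Y s = {\<tau> *\<^sub>R y |\<tau> y. 0 \<le> \<tau> \<and> \<tau> \<le> s \<and> y \<in> Y}"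

lemma truncated_coneI:
  "0 \<le> \<tau> \<Longrightarrow> \<tau> \<le> s \<Longrightarrow> y \<in> Y \<Longrightarrow> \<tau> *\<^sub>R y \<in> truncated_cone Y s"
  unfolding truncated_cone_def by blast

lemma truncated_cone_scale:
  assumes "w \<in> truncated_cone Y s" "0 \<le> c"
  shows "c *\<^sub>R w \<in> truncated_cone Y (c * s)"
proof -
  obtain \<tau> y where "w = \<tau> *\<^sub>R y" "0 \<le> \<tau>" "\<tau> \<le> s" "y \<in> Y"
    using assms unfolding truncated_cone_def by blast
  then show ?thesis
    using assms truncated_coneI[of "c * \<tau>" "c * s" y Y] by (simp add: mult_left_mono)
qed

lemma truncated_cone_mono: "s \<le> t \<Longrightarrow> truncated_cone Y s \<subseteq> truncated_cone Y t"
  unfolding truncated_cone_def by fastforce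

lemma zero_in_truncated_cone: "y \<in> Y \<Longrightarrow> 0 \<le> s \<Longrightarrow> 0 \<in> truncated_cone Y s"
  using truncated_coneI[of 0 s y Y] by simp

text \<open>The mean of \<sigma> a and \<tau> b is m times a weighted mean of a and b, where m is
  the same mean of the heights \<sigma> and \<tau>. If m vanishes the new weights are undefined, but
  then the point is the vertex.\<close>

lemma convex_truncated_cone:
  assumes "convex Y"
  shows "convex (truncated_cone Y s)"
proof (rule convexI)
  fix x y :: 'a and u v :: real
  assume x: "x \<in> truncated_cone Y s" and y: "y \<in> truncated_cone Y s"
    and uv: "0 \<le> u" "0 \<le> v" "u + v = 1"
  obtain \<sigma> a where a: "x = \<sigma> *\<^sub>R a" "0 \<le> \<sigma>" "\<sigma> \<le> s" "a \<in> Y"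
    using x unfolding truncated_cone_def by blast
  obtain \<tau> b where b: "y = \<tau> *\<^sub>R b" "0 \<le> \<tau>" "\<tau> \<le> s" "b \<in> Y"
    using y unfolding truncated_cone_def by blast
  define m where "m = u * \<sigma> + v * \<tau>"
  have m: "0 \<le> m" "m \<le> s"
    using uv a b convex_bound_le[of \<sigma> s \<tau> u v] unfolding m_def by auto
  show "u *\<^sub>R x + v *\<^sub>R y \<in> truncated_cone Y s"
  proof (cases "m = 0")
    case True
    then have "u * \<sigma> = 0" "v * \<tau> = 0"
      using a b uv unfolding m_def by (auto simp: add_nonneg_eq_0_iff)
    then have "u *\<^sub>R x + v *\<^sub>R y = 0" using a b by (metis add_0 scaleR_scaleR scaleR_zero_left)
    then show ?thesis using zero_in_truncated_cone[OF a(4), of s] m by simp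
  next
    case False
    then have "0 < m" using m by simp
    then have "(u * \<sigma> / m) *\<^sub>R a + (v * \<tau> / m) *\<^sub>R b \<in> Y"
      using a b uv by (intro convexD[OF assms]) (auto simp: m_def simp flip: add_divide_distrib)
    from truncated_coneI[OF m this] show ?thesis
      using \<open>0 < m\<close> a b by (simp add: scaleR_add_right)
  qed
qed

lemma norm_truncated_cone_le:
  fixes Y :: "'a::real_normed_vector set"
  assumes "\<And>y. y \<in> Y \<Longrightarrow> norm y \<le> M" "w \<in> truncated_cone Y s"
  shows "norm w \<le> s * M"
proof -
  obtain \<tau> y where w: "w = \<tau> *\<^sub>R y" "0 \<le> \<tau>" "\<tau> \<le> s" "y \<in> Y"
    using assms unfolding truncated_cone_def by blast
  then have "norm w = \<tau> * norm y" by simp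
  also have "\<dots> \<le> s * M" using w assms(1) by (intro mult_mono) (auto intro: order_trans)
  finally show ?thesis .
qed

text \<open>A discrete Korn inequality: the hypothesis says that the symmetrized difference quotients of
  the field \<open>R\<close> are small. The field is compared at \<open>w\<close>, \<open>w/2\<close> and an auxiliary third point \<open>w'\<close>,
  and the resulting estimates are summed over the dyadic scales.\<close>

lemma rigidity_bound:
  fixes R :: "'e::real_vector \<Rightarrow> 'e \<Rightarrow> real"
  assumes lin: "\<And>y. linear (R y)" and R0: "\<And>u. R 0 u = 0"
    and bnd: "\<And>s y z. 0 < s \<Longrightarrow> s \<le> \<epsilon> \<Longrightarrow> y \<in> truncated_cone Y s \<Longrightarrow> z \<in> truncated_cone Y s \<Longrightarrow>
       \<bar>R y (y - z) - R z (y - z)\<bar> \<le> B * s ^ 3"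
    and lim: "(\<lambda>k. 2 ^ k * R ((1 / 2 ^ k) *\<^sub>R w) w') \<longlonglongrightarrow> 0"
    and s: "0 < s" "s \<le> \<epsilon>" and w: "w \<in> truncated_cone Y s" and w': "w' \<in> truncated_cone Y s"
  shows "\<bar>R w w'\<bar> \<le> 18 * B * s ^ 3"
proof -
  obtain y0 where y0: "y0 \<in> Y" using w unfolding truncated_cone_def by blast
  have half: "\<bar>2 * R ((1 / 2) *\<^sub>R x) x' - R x x'\<bar> \<le> 9 * (B * t ^ 3)"
    if t: "0 < t" "t \<le> \<epsilon>" and x: "x \<in> truncated_cone Y t" and x': "x' \<in> truncated_cone Y t" for t x x'
  proof -
    have z: "0 \<in> truncated_cone Y t" using zero_in_truncated_cone[OF y0] t by simp
    have xh: "(1 / 2) *\<^sub>R x \<in> truncated_cone Y t"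
      using truncated_cone_scale[OF x, of "1/2"] truncated_cone_mono[of "1/2 * t" t Y] t by auto
    note sub = linear_diff[OF lin] linear_scale[OF lin]
    have 1: "\<bar>R x x\<bar> \<le> B * t ^ 3" using bnd[OF t x z] R0 by simp
    have 2: "\<bar>R x' x'\<bar> \<le> B * t ^ 3" using bnd[OF t x' z] R0 by simp
    have 3: "\<bar>R ((1 / 2) *\<^sub>R x) x / 2\<bar> \<le> B * t ^ 3" using bnd[OF t xh z] R0 by (simp add: sub)
    have 4: "\<bar>R x' x' - R x' x - (R x x' - R x x)\<bar> \<le> B * t ^ 3"
      using bnd[OF t x' x] by (simp add: sub)
    have 5: "\<bar>R x' x' - R x' x / 2 - (R ((1 / 2) *\<^sub>R x) x' - R ((1 / 2) *\<^sub>R x) x / 2)\<bar> \<le> B * t ^ 3"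
      using bnd[OF t x' xh] by (simp add: sub)
    \<comment> \<open>In twice 5 minus 4 the uncontrolled terms \<open>R x' x\<close> cancel. What
      remains, apart from the claimed difference, are diagonal terms bounded by 1, 2 and 3. The
      errors add up to 7 copies of \<open>B * t ^ 3\<close>, which is nonnegative by 1.\<close>
    from 1 2 3 4 5 show ?thesis by linarith
  qed
  define a where "a k = 2 ^ k * R ((1 / 2 ^ k) *\<^sub>R w) w'" for k :: nat
  \<comment> \<open>Shrinking both arguments by c = 2^(-k) gains c^3. One factor c is spent on
    undoing the scaling of \<open>w'\<close>, another on the weight 2^k in \<open>a\<close>; the
    third makes the steps geometric, with sum 18.\<close>
  have step: "\<bar>a (Suc k) - a k\<bar> \<le> (9 * (B * s ^ 3)) * (1 / 2) ^ k" for k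
  proof -
    let ?c = "1 / 2 ^ k :: real"
    have c: "?c * s \<le> \<epsilon>" using s mult_left_le_one_le[of s ?c] by (simp add: divide_le_eq_1 mult.commute)
    have "\<bar>2 * R ((1 / 2) *\<^sub>R (?c *\<^sub>R w)) (?c *\<^sub>R w') - R (?c *\<^sub>R w) (?c *\<^sub>R w')\<bar> \<le> 9 * (B * (?c * s) ^ 3)"
      using s c by (intro half truncated_cone_scale w w') auto
    then have "\<bar>2 * R ((1 / 2) *\<^sub>R (?c *\<^sub>R w)) w' - R (?c *\<^sub>R w) w'\<bar> * ?c \<le> 9 * (B * s ^ 3) * ?c ^ 3"
      by (simp add: linear_scale[OF lin] power_mult_distrib abs_mult field_simps flip: right_diff_distrib diff_divide_distrib)
    moreover have "a (Suc k) - a k = (2 * R ((1 / 2) *\<^sub>R (?c *\<^sub>R w)) w' - R (?c *\<^sub>R w) w') * 2 ^ k"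
      unfolding a_def by (simp add: algebra_simps)
    then have "\<bar>a (Suc k) - a k\<bar> = \<bar>2 * R ((1 / 2) *\<^sub>R (?c *\<^sub>R w)) w' - R (?c *\<^sub>R w) w'\<bar> * 2 ^ k"
      by (simp add: abs_mult)
    moreover have "?c ^ 3 * 2 ^ k * 2 ^ k = ?c" by (simp add: power3_eq_cube)
    ultimately have "\<bar>a (Suc k) - a k\<bar> \<le> 9 * (B * s ^ 3) * ?c ^ 3 * 2 ^ k * 2 ^ k"
      by (simp add: field_simps)
    also have "\<dots> = 9 * (B * s ^ 3) * ?c" using \<open>?c ^ 3 * 2 ^ k * 2 ^ k = ?c\<close> by (simp add: mult.assoc)
    finally show ?thesis by (simp add: power_divide)
  qed
  have "lim a = 0" using lim unfolding a_def by (rule limI)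
  then have "\<bar>a 0\<bar> \<le> 9 * (B * s ^ 3) / (1 - 1 / 2)" using geometric_steps(2)[OF step] by simp
  then show ?thesis unfolding a_def by simp
qed

section \<open>Second-order expansion of an isometric map\<close>

lemma has_vector_derivative_along_segment:
  assumes der: "(v has_derivative v') (at (p + \<tau> *\<^sub>R d) within V)"
    and seg: "\<And>\<sigma>. 0 \<le> \<sigma> \<Longrightarrow> \<sigma> \<le> 1 \<Longrightarrow> p + \<sigma> *\<^sub>R d \<in> V"
  shows "((\<lambda>\<tau>. v (p + \<tau> *\<^sub>R d)) has_vector_derivative v' d) (at \<tau> within {0..1})"
proof -
  have "((\<lambda>\<tau>. p + \<tau> *\<^sub>R d) has_derivative (\<lambda>h. h *\<^sub>R d)) (at \<tau> within {0..1})"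
    by (auto intro!: derivative_eq_intros)
  moreover have "(v has_derivative v') (at (p + \<tau> *\<^sub>R d) within (\<lambda>\<tau>. p + \<tau> *\<^sub>R d) ` {0..1})"
    by (rule has_derivative_subset[OF der]) (use seg in auto)
  ultimately have "((\<lambda>\<tau>. v (p + \<tau> *\<^sub>R d)) has_derivative (\<lambda>h. v' (h *\<^sub>R d))) (at \<tau> within {0..1})"
    by (rule has_derivative_in_compose)
  moreover have "v' (h *\<^sub>R d) = h *\<^sub>R v' d" for h
    using der has_derivative_linear linear_scale by blast
  ultimately show ?thesis unfolding has_vector_derivative_def by simp
qed

text \<open>Mean value inequality for \<tau> -> v(p + \<tau> d) - \<tau> l. Derivatives are taken
  within \<open>V\<close>, so the argument works on a segment that touches the boundary.\<close>

lemma linearization_bound: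
  fixes v :: "'e::real_normed_vector \<Rightarrow> 'f::real_normed_vector"
  assumes der: "\<And>\<tau>. 0 \<le> \<tau> \<Longrightarrow> \<tau> \<le> 1 \<Longrightarrow> (v has_derivative dv (p + \<tau> *\<^sub>R d)) (at (p + \<tau> *\<^sub>R d) within V)"
    and seg: "\<And>\<tau>. 0 \<le> \<tau> \<Longrightarrow> \<tau> \<le> 1 \<Longrightarrow> p + \<tau> *\<^sub>R d \<in> V"
    and bnd: "\<And>\<tau>. 0 \<le> \<tau> \<Longrightarrow> \<tau> \<le> 1 \<Longrightarrow> norm (dv (p + \<tau> *\<^sub>R d) d - l) \<le> B"
  shows "norm (v (p + d) - v p - l) \<le> B"
proof -
  have "((\<lambda>\<tau>. v (p + \<tau> *\<^sub>R d) - \<tau> *\<^sub>R l) has_derivative (\<lambda>h. h *\<^sub>R (dv (p + \<tau> *\<^sub>R d) d - l)))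
      (at \<tau> within {0..1})" if "\<tau> \<in> {0..1}" for \<tau>
    unfolding has_vector_derivative_def[symmetric]
    using that by (auto intro!: derivative_eq_intros has_vector_derivative_along_segment[OF der seg])
  moreover have "onorm (\<lambda>h. h *\<^sub>R (dv (p + \<tau> *\<^sub>R d) d - l)) \<le> B" if "\<tau> \<in> {0..1}" for \<tau>
    using bnd[of \<tau>] that by (intro onorm_le) (auto simp: mult.commute[of B] intro!: mult_left_mono)
  ultimately have "norm ((v (p + 1 *\<^sub>R d) - 1 *\<^sub>R l) - (v (p + 0 *\<^sub>R d) - 0 *\<^sub>R l)) \<le> B * norm (1 - 0 :: real)"
    by (intro differentiable_bound[where S = "{0..1}" and f = "\<lambda>\<tau>. v (p + \<tau> *\<^sub>R d) - \<tau> *\<^sub>R l"]) auto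
  then show ?thesis by (simp add: algebra_simps)
qed

text \<open>\<open>D a b c\<close> stands for the derivative of the metric in direction \<open>a\<close>, evaluated at \<open>(b, c)\<close>;
  then \<open>koszul D\<close> is the Christoffel symbol of the first kind.\<close>

definition koszul :: "('e \<Rightarrow> 'e \<Rightarrow> 'e \<Rightarrow> real) \<Rightarrow> 'e \<Rightarrow> 'e \<Rightarrow> 'e \<Rightarrow> real" where
  "koszul D a b c = (D a b c + D b a c - D c a b) / 2"

locale sym_trilinear =
  fixes D :: "'e::real_vector \<Rightarrow> 'e \<Rightarrow> 'e \<Rightarrow> real"
  assumes lin1: "linear (\<lambda>a. D a b c)" and lin2: "linear (\<lambda>b. D a b c)" and sym: "D a b c = D a c b"
begin

lemma lin3: "linear (\<lambda>c. D a b c)"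
  using lin2[of a b] sym[of a b] by (simp add: sym)

lemmas D_simps = linear_add[OF lin1] linear_add[OF lin2] linear_add[OF lin3]
  linear_diff[OF lin1] linear_diff[OF lin2] linear_diff[OF lin3]
  linear_scale[OF lin1] linear_scale[OF lin2] linear_scale[OF lin3]

text \<open>Why the Koszul combination is the right quadratic model: the symmetrized derivative of y
  -> \<open>koszul D y y\<close> / 2 at y is \<open>D y\<close> / 2, half the first-order change of
  the metric. This is the exact finite-difference form of that fact.\<close>

lemma koszul_diff: "koszul D y y (y - z) - koszul D z z (y - z) = D (y + z) (y - z) (y - z) / 2"
  unfolding koszul_def by (simp add: D_simps sym[of _ z y] field_simps)

text \<open>By the symmetry of \<open>D\<close> in its last two slots, \<open>koszul D\<close> is
  symmetric in its first two, so this is polarization of a quadratic form. It extracts the mixed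
  term when the expansions at two base points, \<open>h\<close> apart, are subtracted.\<close>

lemma koszul_polar:
  "koszul D (h + a) (h + a) c - koszul D (h + b) (h + b) c - (koszul D a a c - koszul D b b c) =
   2 * koszul D h (a - b) c"
  unfolding koszul_def by (simp add: D_simps sym[of c a h] sym[of c b h] field_simps)

lemma koszul_linear1: "linear (\<lambda>a. koszul D a b c)"
  unfolding koszul_def by (rule linearI) (simp_all add: D_simps field_simps)

lemma koszul_linear2: "linear (\<lambda>b. koszul D a b c)"
  unfolding koszul_def by (rule linearI) (simp_all add: D_simps field_simps)

lemma koszul_linear3: "linear (\<lambda>c. koszul D a b c)"
  unfolding koszul_def by (rule linearI) (simp_all add: D_simps field_simps)

end

text \<open>One base point \<open>q\<close> with the cone reachable from it inside \<open>V\<close>.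
  Both error hypotheses have the same size \<eta> s: \<open>dv_close\<close> is squared because it
  enters quadratically through |a - b|^2, and \<open>metric_close\<close> says that \<open>D\<close>
  is the derivative of the metric at \<open>q\<close>.\<close>

locale almost_isometric_expansion = sym_trilinear D
  for D :: "'e::real_normed_vector \<Rightarrow> 'e \<Rightarrow> 'e \<Rightarrow> real" +
  fixes v :: "'e \<Rightarrow> 'f::real_inner" and dv :: "'e \<Rightarrow> 'e \<Rightarrow> 'f" and V Y :: "'e set"
    and q :: 'e and M \<epsilon> \<eta> :: real
  assumes convexY: "convex Y" and normY: "\<And>y. y \<in> Y \<Longrightarrow> norm y \<le> M"
    and deriv: "\<And>x. x \<in> V \<Longrightarrow> (v has_derivative dv x) (at x within V)"
    and cone: "\<And>w. w \<in> truncated_cone Y \<epsilon> \<Longrightarrow> q + w \<in> V"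
    and eta: "0 \<le> \<eta>"
    and dv_close: "\<And>s w b. 0 < s \<Longrightarrow> s \<le> \<epsilon> \<Longrightarrow> w \<in> truncated_cone Y s \<Longrightarrow>
      (norm (dv (q + w) b - dv q b))\<^sup>2 \<le> \<eta> * s * (norm b)\<^sup>2"
    and metric_close: "\<And>s w b. 0 < s \<Longrightarrow> s \<le> \<epsilon> \<Longrightarrow> w \<in> truncated_cone Y s \<Longrightarrow>
      \<bar>dv (q + w) b \<bullet> dv (q + w) b - dv q b \<bullet> dv q b - D w b b\<bar> \<le> \<eta> * s * (norm b)\<^sup>2"
begin

lemma segment_in_cone:
  assumes "y \<in> truncated_cone Y s" "z \<in> truncated_cone Y s" "0 \<le> \<tau>" "\<tau> \<le> 1"
  shows "z + \<tau> *\<^sub>R (y - z) \<in> truncated_cone Y s"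
  using convexD_alt[OF convex_truncated_cone[OF convexY] assms(2,1,3,4)] by (simp add: algebra_simps)

lemma cone_in:
  assumes "s \<le> \<epsilon>" "w \<in> truncated_cone Y s"
  shows "q + w \<in> V"
  using cone truncated_cone_mono[OF assms(1)] assms(2) by blast

lemma remainder_norm:
  assumes s: "0 < s" "s \<le> \<epsilon>" and y: "y \<in> truncated_cone Y s"
  shows "(norm (v (q + y) - v q - dv q y))\<^sup>2 \<le> \<eta> * s * (norm y)\<^sup>2"
proof -
  have z: "0 \<in> truncated_cone Y s"
    using y s zero_in_truncated_cone unfolding truncated_cone_def by fastforce
  have seg: "\<tau> *\<^sub>R y \<in> truncated_cone Y s" if "0 \<le> \<tau>" "\<tau> \<le> 1" for \<tau>
    using segment_in_cone[OF y z that] by simp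
  have "norm (v (q + y) - v q - dv q y) \<le> sqrt (\<eta> * s * (norm y)\<^sup>2)"
    using seg s dv_close by (intro linearization_bound[where V = V and dv = dv] real_le_rsqrt deriv cone_in[OF s(2)]) auto
  then show ?thesis using eta s by (metis abs_norm_cancel real_sqrt_abs real_sqrt_le_iff)
qed

text \<open>The field to which \<open>rigidity_bound\<close> is applied: the first-order Taylor
  remainder of \<open>v\<close>, tested against \<open>dv q u\<close>, minus its expected quadratic
  part.\<close>

definition rem :: "'e \<Rightarrow> 'e \<Rightarrow> real" where
  "rem y u = (v (q + y) - v q - dv q y) \<bullet> dv q u - koszul D y y u / 2"

lemma q_in: "w \<in> truncated_cone Y s \<Longrightarrow> 0 < s \<Longrightarrow> s \<le> \<epsilon> \<Longrightarrow> q \<in> V"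
  using cone_in[of s 0] zero_in_truncated_cone[of _ Y s] unfolding truncated_cone_def by fastforce

text \<open>Move along the segment from z to y and write a, b for the differentials at the moving
  point and at q, applied to d = y - z. The derivative of the tested quantity involves <a - b, b>,
  which is half of |a|^2 - |b|^2 - |a - b|^2: the metric controls the first difference and Hoelder
  continuity the square. The factor 4 M^2 comes from |d| \<le> 2 s M.\<close>

lemma rem_symmetrized:
  assumes s: "0 < s" "s \<le> \<epsilon>" and y: "y \<in> truncated_cone Y s" and z: "z \<in> truncated_cone Y s"
  shows "\<bar>rem y (y - z) - rem z (y - z)\<bar> \<le> (4 * M\<^sup>2 * \<eta>) * s ^ 3"
proof -
  define d where "d = y - z"
  define \<psi> where "\<psi> \<tau> = v (q + z + \<tau> *\<^sub>R d) \<bullet> dv q d - \<tau> * (dv q d \<bullet> dv q d)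
      - (\<tau> * D z d d + \<tau>\<^sup>2 / 2 * D d d d) / 2" for \<tau>
  have seg: "z + \<tau> *\<^sub>R d \<in> truncated_cone Y s" if "0 \<le> \<tau>" "\<tau> \<le> 1" for \<tau>
    using segment_in_cone[OF y z that] unfolding d_def .
  have inV: "q + z + \<tau> *\<^sub>R d \<in> V" if "0 \<le> \<tau>" "\<tau> \<le> 1" for \<tau>
    using cone_in[OF s(2) seg[OF that]] by (simp add: add.assoc)
  have lq: "linear (dv q)" using deriv[OF q_in[OF y s]] has_derivative_linear by blast
  have der: "(\<psi> has_field_derivative (dv (q + z + \<tau> *\<^sub>R d) d \<bullet> dv q d - dv q d \<bullet> dv q d
      - D (z + \<tau> *\<^sub>R d) d d / 2)) (at \<tau> within {0..1})" if "\<tau> \<in> {0..1}" for \<tau>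
  proof -
    have "((\<lambda>\<tau>. v (q + z + \<tau> *\<^sub>R d)) has_derivative (\<lambda>h. h *\<^sub>R dv (q + z + \<tau> *\<^sub>R d) d)) (at \<tau> within {0..1})"
      using that unfolding has_vector_derivative_def[symmetric]
      by (intro has_vector_derivative_along_segment[where V = V] deriv inV) auto
    then have "((\<lambda>\<tau>. v (q + z + \<tau> *\<^sub>R d) \<bullet> dv q d) has_field_derivative dv (q + z + \<tau> *\<^sub>R d) d \<bullet> dv q d)
        (at \<tau> within {0..1})"
      unfolding has_field_derivative_def
      by (auto intro!: derivative_eq_intros simp: fun_eq_iff)
    then show ?thesis unfolding \<psi>_def
      by (auto intro!: derivative_eq_intros simp: D_simps field_simps)
  qed
  have bound: "\<bar>dv (q + z + \<tau> *\<^sub>R d) d \<bullet> dv q d - dv q d \<bullet> dv q d - D (z + \<tau> *\<^sub>R d) d d / 2\<bar>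
      \<le> \<eta> * s * (norm d)\<^sup>2" if "\<tau> \<in> {0..1}" for \<tau>
  proof -
    let ?a = "dv (q + (z + \<tau> *\<^sub>R d)) d" and ?b = "dv q d"
    have "?a \<bullet> ?b - ?b \<bullet> ?b = ((?a \<bullet> ?a - ?b \<bullet> ?b) - (norm (?a - ?b))\<^sup>2) / 2"
      by (simp add: power2_norm_eq_inner inner_commute algebra_simps)
    moreover have "(norm (?a - ?b))\<^sup>2 \<le> \<eta> * s * (norm d)\<^sup>2" "0 \<le> (norm (?a - ?b))\<^sup>2"
      using dv_close s seg that by auto
    moreover have "\<bar>?a \<bullet> ?a - ?b \<bullet> ?b - D (z + \<tau> *\<^sub>R d) d d\<bar> \<le> \<eta> * s * (norm d)\<^sup>2"
      using metric_close s seg that by auto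
    moreover have "\<bar>x - D' / 2\<bar> \<le> E" if "x = (A - n) / 2" "n \<le> E" "0 \<le> n" "\<bar>A - D'\<bar> \<le> E" for x A n D' E :: real
      using that unfolding abs_le_iff by (simp add: field_simps)
    ultimately show ?thesis unfolding add.assoc by blast
  qed
  have "\<bar>\<psi> 1 - \<psi> 0\<bar> \<le> \<eta> * s * (norm d)\<^sup>2"
    using field_differentiable_bound[OF convex_real_interval(5) der, of "\<eta> * s * (norm d)\<^sup>2" 1 0] bound by auto
  moreover have "rem y d - rem z d = \<psi> 1 - \<psi> 0"
  proof -
    have e: "dv q y = dv q z + dv q d" using linear_diff[OF lq, of y z] unfolding d_def by simp
    have k: "koszul D y y d = koszul D z z d + D (y + z) d d / 2" using koszul_diff[of y z] unfolding d_def by simp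
    have m: "D (y + z) d d = 2 * D z d d + D d d d" unfolding d_def by (simp add: D_simps field_simps)
    have "q + z + 1 *\<^sub>R d = q + y" "q + z + 0 *\<^sub>R d = q + z" unfolding d_def by simp_all
    then show ?thesis unfolding rem_def \<psi>_def e k m
      by (simp only:) (simp add: inner_diff_left inner_add_left field_simps)
  qed
  moreover have "\<eta> * s * (norm d)\<^sup>2 \<le> \<eta> * s * (2 * (s * M))\<^sup>2"
  proof -
    have "norm d \<le> 2 * (s * M)"
      using norm_triangle_ineq4[of y z] norm_truncated_cone_le[OF normY y] norm_truncated_cone_le[OF normY z]
      unfolding d_def by simp
    then show ?thesis using eta s by (intro mult_left_mono power_mono) auto
  qed
  ultimately show ?thesis unfolding d_def[symmetric] by (simp add: power2_eq_square power3_eq_cube mult_ac)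
qed

text \<open>Supplies the limit hypothesis of \<open>rigidity_bound\<close>. The squared Taylor
  remainder at scale 2^(-k) is of order 2^(-3k), so 2^k times the remainder is still of order
  2^(-k/2); the quadratic part is smaller.\<close>

lemma rem_tendsto:
  assumes s: "0 < s" "s \<le> \<epsilon>" and w: "w \<in> truncated_cone Y s"
  shows "(\<lambda>k. 2 ^ k * rem ((1 / 2 ^ k) *\<^sub>R w) u) \<longlonglongrightarrow> 0"
proof -
  let ?c = "\<lambda>k. (1 / 2) ^ k :: real"
  let ?T = "\<lambda>y. v (q + y) - v q - dv q y"
  have T: "norm (2 ^ k *\<^sub>R ?T (?c k *\<^sub>R w)) \<le> sqrt (?c k * (\<eta> * s * (norm w)\<^sup>2))" for k
  proof -
    have "?c k * s \<le> 1 * s" using s by (intro mult_right_mono) (auto simp: power_le_one)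
    then have cs: "?c k * s \<le> \<epsilon>" using s by linarith
    have "(norm (?T (?c k *\<^sub>R w)))\<^sup>2 \<le> \<eta> * (?c k * s) * (norm (?c k *\<^sub>R w))\<^sup>2"
      using s by (intro remainder_norm cs truncated_cone_scale w) auto
    then have "(2 ^ k)\<^sup>2 * (norm (?T (?c k *\<^sub>R w)))\<^sup>2 \<le> (2 ^ k)\<^sup>2 * (\<eta> * (?c k * s) * (norm (?c k *\<^sub>R w))\<^sup>2)"
      by (intro mult_left_mono) auto
    also have "\<dots> = ((2 ^ k)\<^sup>2 * (?c k)\<^sup>2) * (?c k * (\<eta> * s * (norm w)\<^sup>2))"
      by (simp add: power_mult_distrib mult_ac)
    also have "((2 ^ k)\<^sup>2 * (?c k)\<^sup>2) = 1" by (simp add: power_mult_distrib[symmetric] power_one_over)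
    finally show ?thesis by (intro real_le_rsqrt) (simp add: power_mult_distrib)
  qed
  have "(\<lambda>k. sqrt (?c k * (\<eta> * s * (norm w)\<^sup>2))) \<longlonglongrightarrow> sqrt (0 * (\<eta> * s * (norm w)\<^sup>2))"
    by (intro tendsto_intros LIMSEQ_realpow_zero) auto
  then have "(\<lambda>k. sqrt (?c k * (\<eta> * s * (norm w)\<^sup>2))) \<longlonglongrightarrow> 0" by simp
  then have lT: "(\<lambda>k. 2 ^ k *\<^sub>R ?T (?c k *\<^sub>R w)) \<longlonglongrightarrow> 0"
    by (rule Lim_null_comparison[rotated]) (intro always_eventually allI T)
  have "2 ^ k * rem ((1 / 2 ^ k) *\<^sub>R w) u =
      (2 ^ k *\<^sub>R ?T (?c k *\<^sub>R w)) \<bullet> dv q u - ?c k * (koszul D w w u / 2)" for k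
    unfolding rem_def
    by (simp add: linear_scale[OF koszul_linear1] linear_scale[OF koszul_linear2] power_one_over right_diff_distrib)
  moreover have "(\<lambda>k. (2 ^ k *\<^sub>R ?T (?c k *\<^sub>R w)) \<bullet> dv q u - ?c k * (koszul D w w u / 2))
      \<longlonglongrightarrow> 0 \<bullet> dv q u - 0 * (koszul D w w u / 2)"
    by (intro tendsto_intros lT LIMSEQ_realpow_zero) auto
  ultimately show ?thesis by simp
qed

lemma second_order:
  assumes s: "0 < s" "s \<le> \<epsilon>" and w: "w \<in> truncated_cone Y s" and w': "w' \<in> truncated_cone Y s"
  shows "\<bar>(v (q + w) - v q - dv q w) \<bullet> dv q w' - koszul D w w w' / 2\<bar> \<le> 72 * M\<^sup>2 * \<eta> * s ^ 3"
proof -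
  have lq: "linear (dv q)" using deriv[OF q_in[OF w s]] has_derivative_linear by blast
  have "linear (rem y)" for y
    unfolding rem_def
    by (rule linearI) (simp_all add: linear_add[OF lq] linear_scale[OF lq] linear_add[OF koszul_linear3]
        linear_scale[OF koszul_linear3] inner_add_right field_simps)
  moreover have "rem 0 u = 0" for u
    unfolding rem_def by (simp add: linear_0[OF lq] linear_0[OF koszul_linear1])
  ultimately have "\<bar>rem w w'\<bar> \<le> 18 * (4 * M\<^sup>2 * \<eta>) * s ^ 3"
    by (intro rigidity_bound[where \<epsilon> = \<epsilon> and Y = Y] rem_symmetrized rem_tendsto[OF s w] s w w') auto
  then show ?thesis unfolding rem_def by simp
qed

end

text \<open>The expansions around \<open>p\<close> and \<open>q\<close> are compared at the two points \<open>q + w1\<close> and \<open>q + w2\<close>, which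
  are reached from both base points inside the cone; the values of \<open>v\<close> cancel.\<close>

lemma derivative_increment:
  fixes v :: "'e::real_normed_vector \<Rightarrow> 'f::real_inner"
  assumes r: "0 < r" "r \<le> 2"
    and P: "almost_isometric_expansion Dp v dv V (cball e r) p (norm e + r) \<epsilon> \<eta>"
    and Q: "almost_isometric_expansion Dq v dv V (cball e r) q (norm e + r) \<epsilon> \<eta>"
    and pq: "p \<noteq> q" "2 * norm (q - p) / r \<le> \<epsilon>"
    and dv: "\<And>b. (norm (dv q b - dv p b))\<^sup>2 \<le> \<eta> * norm (q - p) * (norm b)\<^sup>2"
    and D: "\<And>a c. \<bar>koszul Dq a a c - koszul Dp a a c\<bar> \<le> \<eta> * (norm a)\<^sup>2 * norm c"
    and a: "norm a \<le> 1" and c: "norm c \<le> 1"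
  shows "\<bar>(dv q a - dv p a) \<bullet> dv p c - koszul Dp (q - p) a c\<bar>
    \<le> 16 * (290 * (norm e + r)\<^sup>2 + (norm e + r) ^ 3) / r ^ 3 * \<eta> * norm (q - p)"
proof -
  interpret P: almost_isometric_expansion Dp v dv V "cball e r" p "norm e + r" \<epsilon> \<eta> by fact
  interpret Q: almost_isometric_expansion Dq v dv V "cball e r" q "norm e + r" \<epsilon> \<eta> by fact
  define M where "M = norm e + r"
  define h where "h = norm (q - p)"
  \<comment> \<open>With this scale the displacement q - p has length s r / 2, half of the slack in
    the cone. Hence q + s (e + y) with |y| \<le> r/2 is reached inside the cone from p as well as
    from q.\<close>
  define s where "s = 2 * h / r"
  have h0: "0 < h" using pq unfolding h_def by simp
  have s: "0 < s" "s \<le> \<epsilon>" using h0 r pq unfolding s_def h_def by auto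
  have hs: "h \<le> s" "h = s * (r / 2)" using h0 r unfolding s_def by (auto simp: field_simps)
  have M0: "0 < M" using r norm_ge_zero[of e] unfolding M_def by linarith
  have \<eta>: "0 \<le> \<eta>" by (rule P.eta)
  define C where "C = 290 * M\<^sup>2 + M ^ 3"
  let ?K = "truncated_cone (cball e r) s"
  define Tp where "Tp y = v (p + y) - v p - dv p y" for y
  define Tq where "Tq y = v (q + y) - v q - dv q y" for y
  have normK: "norm w \<le> s * M" if "w \<in> ?K" for w
    using norm_truncated_cone_le[OF P.normY that] unfolding M_def by simp
  have base: "s *\<^sub>R (e + y) \<in> ?K" if "norm y \<le> r" for y
    using that s by (intro truncated_coneI) (auto simp: dist_norm norm_minus_commute)
  have shift: "q - p + s *\<^sub>R (e + y) \<in> ?K" if "norm y \<le> r / 2" for y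
  proof -
    have "norm (y + (1 / s) *\<^sub>R (q - p)) \<le> r / 2 + r / 2"
      using that hs s unfolding h_def by (intro norm_triangle_mono) auto
    from base[of "y + (1 / s) *\<^sub>R (q - p)"] this s show ?thesis
      by (simp add: scaleR_add_right add_ac)
  qed
  \<comment> \<open>\<open>w1\<close> and \<open>w2\<close> are chosen so that their difference is a
    multiple of \<open>a\<close>, as large as the remaining slack allows.\<close>
  define w1 where "w1 = s *\<^sub>R (e + (r / 2) *\<^sub>R a)"
  define w2 where "w2 = s *\<^sub>R (e + 0)"
  have w: "w1 \<in> ?K" "w2 \<in> ?K" "q - p + w1 \<in> ?K" "q - p + w2 \<in> ?K"
    unfolding w1_def w2_def
    by ((intro base shift; use r a mult_left_le[of "norm a" "r / 2"] in simp),
        (intro base shift; use r a mult_left_le[of "norm a" "r / 2"] in simp),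
        (intro base shift; use r a mult_left_le[of "norm a" "r / 2"] in simp),
        (intro base shift; use r a mult_left_le[of "norm a" "r / 2"] in simp))
  have lp: "linear (dv p)" using P.deriv[OF P.q_in[OF w(1) s]] has_derivative_linear by blast
  have lq: "linear (dv q)" using Q.deriv[OF Q.q_in[OF w(1) s]] has_derivative_linear by blast
  have main: "\<bar>(dv q (w1 - w2) - dv p (w1 - w2)) \<bullet> dv p u - koszul Dp (q - p) (w1 - w2) u\<bar>
      \<le> C * \<eta> * s ^ 3" if u: "u \<in> ?K" for u
  proof -
    have E1: "\<bar>Tp (q - p + w) \<bullet> dv p u - koszul Dp (q - p + w) (q - p + w) u / 2\<bar> \<le> 72 * M\<^sup>2 * \<eta> * s ^ 3"
      if "q - p + w \<in> ?K" for w
      using P.second_order[OF s that u] unfolding Tp_def M_def .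
    have E2: "\<bar>Tq w \<bullet> dv q u - koszul Dq w w u / 2\<bar> \<le> 72 * M\<^sup>2 * \<eta> * s ^ 3" if "w \<in> ?K" for w
      using Q.second_order[OF s that u] unfolding Tq_def M_def .
    have E3: "\<bar>Tq w \<bullet> dv q u - Tq w \<bullet> dv p u\<bar> \<le> M\<^sup>2 * \<eta> * s ^ 3" if w: "w \<in> ?K" for w
    proof -
      have "(norm (Tq w))\<^sup>2 \<le> \<eta> * s * (norm w)\<^sup>2"
        using Q.remainder_norm[OF s w] unfolding Tq_def .
      also have "\<dots> \<le> \<eta> * s * (s * M)\<^sup>2" using normK[OF w] \<eta> s by (intro mult_left_mono power_mono) auto
      finally have 1: "norm (Tq w) \<le> sqrt (\<eta> * s * (s * M)\<^sup>2)" by (rule real_le_rsqrt)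
      have "(norm (dv q u - dv p u))\<^sup>2 \<le> \<eta> * h * (norm u)\<^sup>2" using dv unfolding h_def .
      also have "\<dots> \<le> \<eta> * s * (s * M)\<^sup>2"
        using normK[OF u] \<eta> s hs h0 by (intro mult_mono power_mono) auto
      finally have 2: "norm (dv q u - dv p u) \<le> sqrt (\<eta> * s * (s * M)\<^sup>2)" by (rule real_le_rsqrt)
      have "\<bar>Tq w \<bullet> (dv q u - dv p u)\<bar> \<le> norm (Tq w) * norm (dv q u - dv p u)" by (rule Cauchy_Schwarz_ineq2)
      also have "\<dots> \<le> sqrt (\<eta> * s * (s * M)\<^sup>2) * sqrt (\<eta> * s * (s * M)\<^sup>2)"
        using 1 2 \<eta> s by (intro mult_mono) auto
      also have "\<dots> = M\<^sup>2 * \<eta> * s ^ 3"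
        using \<eta> s M0 by (simp add: power2_eq_square power3_eq_cube mult_ac)
      finally show ?thesis by (simp add: inner_diff_right)
    qed
    have E4: "\<bar>koszul Dq w w u - koszul Dp w w u\<bar> \<le> M ^ 3 * \<eta> * s ^ 3" if w: "w \<in> ?K" for w
    proof -
      have "\<bar>koszul Dq w w u - koszul Dp w w u\<bar> \<le> \<eta> * (norm w)\<^sup>2 * norm u" by (rule D)
      also have "\<dots> \<le> \<eta> * (s * M)\<^sup>2 * (s * M)"
        using normK[OF w] normK[OF u] \<eta> s M0 by (intro mult_mono power_mono) auto
      finally show ?thesis by (simp add: power2_eq_square power3_eq_cube mult_ac)
    qed
    \<comment> \<open>p + (q - p + w) and q + w are the same point, so all values of
      \<open>v\<close> drop out and only the two differentials survive.\<close>
    have T: "Tp (q - p + w1) - Tp (q - p + w2) - (Tq w1 - Tq w2) = dv q (w1 - w2) - dv p (w1 - w2)"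
      unfolding Tp_def Tq_def by (simp add: linear_add[OF lp] linear_diff[OF lp] linear_diff[OF lq] algebra_simps)
    have K: "(koszul Dp (q - p + w1) (q - p + w1) u - koszul Dp (q - p + w2) (q - p + w2) u
        - (koszul Dp w1 w1 u - koszul Dp w2 w2 u)) = 2 * koszul Dp (q - p) (w1 - w2) u"
      by (rule P.koszul_polar)
    have T': "Tp (q - p + w1) \<bullet> dv p u - Tp (q - p + w2) \<bullet> dv p u - (Tq w1 \<bullet> dv p u - Tq w2 \<bullet> dv p u)
       = (dv q (w1 - w2) - dv p (w1 - w2)) \<bullet> dv p u"
      unfolding T[symmetric] by (simp add: inner_diff_left)
    \<comment> \<open>The constant is 290 = 4 * 72 + 2: four expansions and two replacements of
      \<open>dv q u\<close> by \<open>dv p u\<close>. Exchanging \<open>Dq\<close> for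
      \<open>Dp\<close> costs two halves of M^3.\<close>
    have C: "C * \<eta> * s ^ 3 = 290 * (M\<^sup>2 * \<eta> * s ^ 3) + M ^ 3 * \<eta> * s ^ 3"
      unfolding C_def by (simp add: algebra_simps)
    from E1[OF w(3)] E1[OF w(4)] E2[OF w(1)] E2[OF w(2)] E3[OF w(1)] E3[OF w(2)] E4[OF w(1)] E4[OF w(2)] K T'
    show ?thesis unfolding C by (simp only: mult.assoc abs_le_iff) linarith
  qed
  define z where "z = (s * (r / 2)) *\<^sub>R a"
  have z: "w1 - w2 = z" unfolding w1_def w2_def z_def by (simp add: algebra_simps)
  \<comment> \<open>So far \<open>u\<close> is restricted to the cone. As \<open>?F\<close> is
    linear, subtracting its values at two cone points differing by a multiple of \<open>c\<close>
    reaches the arbitrary direction \<open>c\<close>, at the price of a factor 2.\<close>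
  let ?F = "\<lambda>u. (dv q z - dv p z) \<bullet> dv p u - koszul Dp (q - p) z u"
  have lF: "linear ?F"
    by (rule linearI) (simp_all add: linear_add[OF lp] linear_scale[OF lp] linear_add[OF P.koszul_linear3]
        linear_scale[OF P.koszul_linear3] inner_add_right algebra_simps)
  have "\<bar>?F (s *\<^sub>R (e + (r / 2) *\<^sub>R c))\<bar> \<le> C * \<eta> * s ^ 3"
    using main[OF base] r c mult_left_le[of "norm c" "r / 2"] unfolding z by simp
  moreover have "\<bar>?F (s *\<^sub>R (e + 0))\<bar> \<le> C * \<eta> * s ^ 3"
    using main[OF base[of 0]] r unfolding z by simp
  moreover have "?F (s *\<^sub>R (e + (r / 2) *\<^sub>R c)) - ?F (s *\<^sub>R (e + 0)) = ?F ((s * (r / 2)) *\<^sub>R c)"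
    unfolding linear_diff[OF lF, symmetric] by (simp add: algebra_simps)
  ultimately have "\<bar>?F ((s * (r / 2)) *\<^sub>R c)\<bar> \<le> 2 * (C * \<eta> * s ^ 3)" by linarith
  moreover have "?F ((s * (r / 2)) *\<^sub>R c) =
      (s * (r / 2))\<^sup>2 * ((dv q a - dv p a) \<bullet> dv p c - koszul Dp (q - p) a c)"
    unfolding z_def
    by (simp add: linear_scale[OF lp] linear_scale[OF lq] linear_scale[OF P.koszul_linear2]
        linear_scale[OF P.koszul_linear3] power2_eq_square inner_diff_left right_diff_distrib)
  ultimately have "(s * (r / 2))\<^sup>2 * \<bar>(dv q a - dv p a) \<bullet> dv p c - koszul Dp (q - p) a c\<bar> \<le> 2 * (C * \<eta> * s ^ 3)"
    by (simp add: abs_mult)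
  \<comment> \<open>Dividing by the squared length s r / 2 leaves 8 s / r^2, which is 16 h / r^3 for
    s = 2 h / r.\<close>
  also have "2 * (C * \<eta> * s ^ 3) = (s * (r / 2))\<^sup>2 * (16 * C / r ^ 3 * \<eta> * h)"
    using r s by (simp add: hs(2) power2_eq_square power3_eq_cube)
  finally have "\<bar>(dv q a - dv p a) \<bullet> dv p c - koszul Dp (q - p) a c\<bar> \<le> 16 * C / r ^ 3 * \<eta> * h"
    by (rule mult_left_le_imp_le) (use r s in simp)
  then show ?thesis unfolding C_def M_def h_def .
qed

section \<open>Local increments of the coordinate derivatives\<close>

lemma C1_on_has_frechet_derivative:
  assumes "C1_on V f" "x \<in> V"
  shows "(f has_derivative frechet_derivative f (at x within V)) (at x within V)"
  using assms unfolding C1_on_def differentiable_on_def by (simp flip: frechet_derivative_works)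

lemma frechet_derivative_eq_sum:
  fixes f :: "real^'n \<Rightarrow> 'b::real_normed_vector"
  assumes "C1_on V f" "x \<in> V"
  shows "frechet_derivative f (at x within V) = (\<lambda>h. \<Sum>i\<in>UNIV. (h $ i) *\<^sub>R partial_deriv V f i x)"
proof
  fix h :: "real^'n"
  let ?D = "frechet_derivative f (at x within V)"
  have l: "linear ?D" using C1_on_has_frechet_derivative[OF assms] by (rule has_derivative_linear)
  have "h = (\<Sum>i\<in>UNIV. (h $ i) *\<^sub>R axis i 1)"
    using basis_expansion[of h] by (simp add: scalar_mult_eq_scaleR)
  then have "?D h = ?D (\<Sum>i\<in>UNIV. (h $ i) *\<^sub>R axis i 1)" by (rule arg_cong)
  then show "?D h = (\<Sum>i\<in>UNIV. (h $ i) *\<^sub>R partial_deriv V f i x)"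
    unfolding partial_deriv_def by (simp add: linear_sum[OF l] linear_scale[OF l])
qed

lemma C1_on_has_derivative:
  fixes f :: "real^'n \<Rightarrow> 'b::real_normed_vector"
  assumes "C1_on V f" "x \<in> V"
  shows "(f has_derivative (\<lambda>h. \<Sum>i\<in>UNIV. (h $ i) *\<^sub>R partial_deriv V f i x)) (at x within V)"
  using C1_on_has_frechet_derivative[OF assms] unfolding frechet_derivative_eq_sum[OF assms] .

text \<open>\<open>frechet_derivative\<close> is a choice from the set of derivatives. Functions
  that agree on \<open>V\<close> have the same set there, hence the same chosen element.\<close>

lemma partial_deriv_cong:
  assumes "\<And>y. y \<in> V \<Longrightarrow> f y = g y" "x \<in> V"
  shows "partial_deriv V f i x = partial_deriv V g i x"
proof -
  have "(f has_derivative f') (at x within V) \<longleftrightarrow> (g has_derivative f') (at x within V)" for f'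
    using has_derivative_transform[OF assms(2), of f g f'] has_derivative_transform[OF assms(2), of g f f'] assms(1)
    by auto
  then show ?thesis unfolding partial_deriv_def frechet_derivative_def by simp
qed

lemma norm_sum_scaleR_le:
  fixes b :: "real^'n" and X :: "'n \<Rightarrow> 'b::real_normed_vector"
  assumes "\<And>i. norm (X i) \<le> B"
  shows "norm (\<Sum>i\<in>UNIV. (b $ i) *\<^sub>R X i) \<le> real CARD('n) * (norm b * B)"
proof -
  have "norm (\<Sum>i\<in>UNIV. (b $ i) *\<^sub>R X i) \<le> (\<Sum>i\<in>(UNIV::'n set). norm b * B)"
  proof (rule sum_norm_le)
    fix i
    have "norm ((b $ i) *\<^sub>R X i) = \<bar>b $ i\<bar> * norm (X i)" by simp
    also have "\<dots> \<le> norm b * B" by (intro mult_mono assms component_le_norm_cart) auto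
    finally show "norm ((b $ i) *\<^sub>R X i) \<le> norm b * B" .
  qed
  then show ?thesis by simp
qed

text \<open>Turns the array of metric derivatives, with the direction of differentiation as first
  index, into the abstract form \<open>D\<close> of the previous section.\<close>

definition contract3 :: "('n \<Rightarrow> 'n \<Rightarrow> 'n \<Rightarrow> real) \<Rightarrow> real^'n \<Rightarrow> real^'n \<Rightarrow> real^'n \<Rightarrow> real" where
  "contract3 T a b c = (\<Sum>k\<in>UNIV. a $ k * (\<Sum>i\<in>UNIV. b $ i * (\<Sum>j\<in>UNIV. c $ j * T k i j)))"

lemma contract3_swap:
  "contract3 T a b c = (\<Sum>i\<in>UNIV. b $ i * (\<Sum>j\<in>UNIV. c $ j * (\<Sum>k\<in>UNIV. a $ k * T k i j)))"
proof -
  have "contract3 T a b c = (\<Sum>i\<in>UNIV. \<Sum>k\<in>UNIV. a $ k * (b $ i * (\<Sum>j\<in>UNIV. c $ j * T k i j)))"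
    unfolding contract3_def sum_distrib_left[of "a $ _"] by (rule sum.swap)
  also have "\<dots> = (\<Sum>i\<in>UNIV. b $ i * (\<Sum>k\<in>UNIV. \<Sum>j\<in>UNIV. c $ j * (a $ k * T k i j)))"
    by (simp add: sum_distrib_left mult.left_commute)
  also have "\<dots> = (\<Sum>i\<in>UNIV. b $ i * (\<Sum>j\<in>UNIV. \<Sum>k\<in>UNIV. c $ j * (a $ k * T k i j)))"
    by (rule sum.cong[OF refl]) (rule arg_cong[OF sum.swap])
  also have "\<dots> = (\<Sum>i\<in>UNIV. b $ i * (\<Sum>j\<in>UNIV. c $ j * (\<Sum>k\<in>UNIV. a $ k * T k i j)))"
    by (simp add: sum_distrib_left)
  finally show ?thesis .
qed

lemma contract3_diff: "contract3 T a b c - contract3 S a b c = contract3 (\<lambda>k i j. T k i j - S k i j) a b c"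
  unfolding contract3_def by (simp add: sum_subtractf right_diff_distrib)

lemma contract3_bound:
  fixes a b c :: "real^'n"
  assumes "\<And>k i j. \<bar>T k i j\<bar> \<le> B"
  shows "\<bar>contract3 T a b c\<bar> \<le> real CARD('n) ^ 3 * (norm a * norm b * norm c * B)"
proof -
  let ?N = "real CARD('n)"
  have 1: "norm (\<Sum>j\<in>UNIV. (c $ j) *\<^sub>R T k i j) \<le> ?N * (norm c * B)" for k i
    by (rule norm_sum_scaleR_le) (use assms in auto)
  have 2: "norm (\<Sum>i\<in>UNIV. (b $ i) *\<^sub>R (\<Sum>j\<in>UNIV. (c $ j) *\<^sub>R T k i j)) \<le> ?N * (norm b * (?N * (norm c * B)))" for k
    by (rule norm_sum_scaleR_le) (rule 1)
  have "norm (\<Sum>k\<in>UNIV. (a $ k) *\<^sub>R (\<Sum>i\<in>UNIV. (b $ i) *\<^sub>R (\<Sum>j\<in>UNIV. (c $ j) *\<^sub>R T k i j)))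
      \<le> ?N * (norm a * (?N * (norm b * (?N * (norm c * B)))))"
    by (rule norm_sum_scaleR_le) (rule 2)
  then show ?thesis unfolding contract3_def by (simp add: power3_eq_cube mult_ac)
qed

lemma sym_trilinear_contract3:
  fixes T :: "'n::finite \<Rightarrow> 'n \<Rightarrow> 'n \<Rightarrow> real"
  assumes "\<And>k i j. T k i j = T k j i"
  shows "sym_trilinear (contract3 T)"
proof (rule sym_trilinear.intro)
  have lin: "linear (\<lambda>x::real^'n. \<Sum>i\<in>UNIV. x $ i * f i)" for f
    by (rule linearI) (simp_all add: sum.distrib distrib_right sum_distrib_left mult.assoc)
  show "linear (\<lambda>a. contract3 T a b c)" for b c
    unfolding contract3_def by (rule lin)
  show "linear (\<lambda>b. contract3 T a b c)" for a c
    unfolding contract3_def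
  proof (rule linearI, goal_cases)
    case (1 b b')
    show ?case by (simp only: linear_add[OF lin] distrib_left sum.distrib)
  next
    case (2 r b)
    show ?case
      by (simp only: linear_scale[OF lin] real_scaleR_def) (simp only: sum_distrib_left[of r] mult.left_commute[of r])
  qed
  show "contract3 T a b c = contract3 T a c b" for a b c
  proof -
    have "(\<Sum>i\<in>UNIV. b $ i * (\<Sum>j\<in>UNIV. c $ j * T k i j)) = (\<Sum>i\<in>UNIV. c $ i * (\<Sum>j\<in>UNIV. b $ j * T k i j))" for k
      unfolding sum_distrib_left
      by (subst sum.swap) (intro sum.cong refl, subst assms, simp)
    then show ?thesis unfolding contract3_def by simp
  qed
qed

lemma sum_axis_mult: "(\<Sum>i\<in>UNIV. axis l 1 $ i * f i) = (f l :: real)"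
  by (simp add: axis_def if_distrib[of "\<lambda>z. z * _"] cong: if_cong)

lemma koszul_contract3_axis:
  "koszul (contract3 T) a (axis i 1) (axis l 1) = (\<Sum>k\<in>UNIV. a $ k * ((T k i l + T i k l - T l k i) / 2))"
proof -
  have "contract3 T a (axis i 1) (axis l 1) = (\<Sum>k\<in>UNIV. a $ k * T k i l)"
    "contract3 T (axis i 1) a (axis l 1) = (\<Sum>k\<in>UNIV. a $ k * T i k l)"
    "contract3 T (axis l 1) a (axis i 1) = (\<Sum>k\<in>UNIV. a $ k * T l k i)"
    unfolding contract3_def sum_axis_mult by simp_all
  moreover have "(\<Sum>k\<in>UNIV. a $ k * ((T k i l + T i k l - T l k i) / 2)) =
    (\<Sum>k\<in>UNIV. (a $ k * T k i l + a $ k * T i k l - a $ k * T l k i) / 2)"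
    by (rule sum.cong) (auto simp: algebra_simps)
  ultimately show ?thesis
    unfolding koszul_def by (simp only: sum_divide_distrib[symmetric] sum.distrib sum_subtractf)
qed

text \<open>The interior case is covered by \<open>e = 0\<close>; at the boundary \<open>e\<close> points inward.\<close>

lemma C2_domain_cone:
  fixes V :: "(real^'n) set"
  assumes V: "C2_domain V" and p: "p \<in> V"
  obtains e r \<delta> where "0 < r" "r \<le> 2" "0 < \<delta>"
    "\<And>x \<tau> y. x \<in> V \<Longrightarrow> dist x p < \<delta> \<Longrightarrow> 0 \<le> \<tau> \<Longrightarrow> \<tau> \<le> \<delta> \<Longrightarrow> y \<in> cball e r \<Longrightarrow> x + \<tau> *\<^sub>R y \<in> V"
proof -
  define Q where "Q N \<rho> \<longleftrightarrow> C2_on N \<rho> \<and> \<rho> p = 0 \<and> (\<exists>i. partial_deriv N \<rho> i p \<noteq> 0) \<and>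
         V \<inter> N = {x \<in> N. 0 \<le> \<rho> x}" for N and \<rho> :: "real^'n \<Rightarrow> real"
  obtain N where N: "open N" "p \<in> N" and alt: "N \<subseteq> V \<or> (\<exists>\<rho>. Q N \<rho>)"
    using V p unfolding C2_domain_def Q_def by meson
  obtain d where d: "0 < d" "ball p d \<subseteq> N" using N open_contains_ball by blast
  \<comment> \<open>The factor 4 is 1 + 3: distance of \<open>x\<close> from \<open>p\<close>, plus
    a step of size \<delta> times |y| \<le> 3.\<close>
  have stay: "x + \<tau> *\<^sub>R y \<in> ball p d'"
    if "dist x p < \<delta>" "0 \<le> \<tau>" "\<tau> \<le> \<delta>" "norm y \<le> 3" "4 * \<delta> \<le> d'" for x \<tau> y \<delta> d'
  proof -
    have "norm (x - p + \<tau> *\<^sub>R y) \<le> norm (x - p) + \<tau> * norm y"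
      using that norm_triangle_ineq[of "x - p" "\<tau> *\<^sub>R y"] by simp
    also have "\<tau> * norm y \<le> \<delta> * 3" using that by (intro mult_mono) auto
    finally have "norm (x + \<tau> *\<^sub>R y - p) < d'" using that by (simp add: dist_norm algebra_simps)
    then show ?thesis by (simp add: dist_norm norm_minus_commute)
  qed
  show ?thesis
  proof (cases "N \<subseteq> V")
    case True
    show ?thesis
    proof (rule that[of 1 "d / 4" 0])
      fix x y :: "real^'n" and \<tau> :: real
      assume *: "dist x p < d / 4" "0 \<le> \<tau>" "\<tau> \<le> d / 4" "y \<in> cball 0 1"
      have "x + \<tau> *\<^sub>R y \<in> ball p d" by (rule stay[of _ "d / 4"]) (use * in auto)
      then show "x + \<tau> *\<^sub>R y \<in> V" using d True by blast
    qed (use d in auto)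
  next
    case False
    then obtain \<rho> where "Q N \<rho>" using alt by blast
    then have \<rho>': "C2_on N \<rho> \<and> \<rho> p = 0 \<and> (\<exists>i. partial_deriv N \<rho> i p \<noteq> 0) \<and>
        V \<inter> N = {x \<in> N. 0 \<le> \<rho> x}" unfolding Q_def .
    then obtain i where "partial_deriv N \<rho> i p \<noteq> 0" by (elim conjE exE)
    with \<rho>' have \<rho>: "C2_on N \<rho>" "partial_deriv N \<rho> i p \<noteq> 0" "V \<inter> N = {x \<in> N. 0 \<le> \<rho> x}"
      by simp_all
    define A where "A k = partial_deriv N \<rho> k" for k
    have C1: "C1_on N \<rho>" using \<rho> unfolding C2_on_def by blast
    define c where "c = \<bar>A i p\<bar>"
    have c: "0 < c" using \<rho> unfolding c_def A_def by simp
    define \<kappa> where "\<kappa> = c / (4 * real CARD('n))"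
    have \<kappa>: "0 < \<kappa>" using c unfolding \<kappa>_def by simp
    have "\<exists>d>0. \<forall>x\<in>N. dist x p < d \<longrightarrow> \<bar>A k x - A k p\<bar> < \<kappa>" for k
      using C1 N \<kappa> unfolding C1_on_def A_def continuous_on_iff dist_real_def by blast
    then obtain dk where dk: "\<And>k. 0 < dk k" "\<And>k x. x \<in> N \<Longrightarrow> dist x p < dk k \<Longrightarrow> \<bar>A k x - A k p\<bar> < \<kappa>" by metis
    define m where "m = min d (Min (range dk))"
    have m: "0 < m" "m \<le> d" "\<And>k. m \<le> dk k" unfolding m_def using d dk by (auto simp: min_le_iff_disj)
    define S where "S = (\<Sum>k\<in>UNIV. \<bar>A k p\<bar>) + 1"
    have S: "1 \<le> S" "c \<le> S" "0 < S"
    proof -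
      show "1 \<le> S" unfolding S_def by (simp add: sum_nonneg)
      then show "0 < S" by simp
      show "c \<le> S" unfolding S_def c_def using member_le_sum[of i UNIV "\<lambda>k. \<bar>A k p\<bar>"] by simp
    qed
    define r where "r = c / (4 * S)"
    have r: "0 < r" "r \<le> 1" "r * S = c / 4" using c S unfolding r_def by (auto simp: field_simps)
    \<comment> \<open>A coordinate direction with the sign that makes \<rho> increase at
      \<open>p\<close>, at speed c.\<close>
    define e :: "real^'n" where "e = sgn (A i p) *\<^sub>R axis i 1"
    have ne: "norm e \<le> 1" unfolding e_def by (simp add: sgn_if)
    \<comment> \<open>The speed c along \<open>e\<close> at \<open>p\<close> pays for both
      perturbations: replacing \<open>e\<close> by \<open>y\<close> costs at most r S = c/4, and
      replacing \<open>p\<close> by \<open>x\<close> at most 2 CARD \<kappa> = c/2. So \<rho> does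
      not decrease along these directions near \<open>p\<close>.\<close>
    have pos: "0 \<le> (\<Sum>k\<in>UNIV. (y $ k) *\<^sub>R A k x)" if x: "x \<in> N" "dist x p < m" and y: "y \<in> cball e r" for x y
    proof -
      have ny: "norm y \<le> 2" using norm_triangle_sub[of y e] ne r y by (simp add: dist_norm norm_minus_commute)
      have "(\<Sum>k\<in>UNIV. y $ k * A k x) = (\<Sum>k\<in>UNIV. e $ k * A k p) + (\<Sum>k\<in>UNIV. (y $ k - e $ k) * A k p)
          + (\<Sum>k\<in>UNIV. y $ k * (A k x - A k p))"
        by (simp add: sum.distrib[symmetric] algebra_simps)
      moreover have "(\<Sum>k\<in>UNIV. e $ k * A k p) = c"
      proof -
        have "(\<Sum>k\<in>UNIV. e $ k * A k p) = (\<Sum>k\<in>UNIV. if k = i then sgn (A i p) * A i p else 0)"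
          unfolding e_def axis_def by (intro sum.cong) auto
        then show ?thesis unfolding c_def by (simp add: abs_sgn mult.commute)
      qed
      moreover have "\<bar>\<Sum>k\<in>UNIV. (y $ k - e $ k) * A k p\<bar> \<le> c / 4"
      proof -
        have "\<bar>\<Sum>k\<in>UNIV. (y $ k - e $ k) * A k p\<bar> \<le> (\<Sum>k\<in>UNIV. \<bar>(y $ k - e $ k) * A k p\<bar>)" by (rule sum_abs)
        also have "\<dots> \<le> (\<Sum>k\<in>UNIV. r * \<bar>A k p\<bar>)"
        proof (rule sum_mono)
          fix k
          have "\<bar>y $ k - e $ k\<bar> \<le> r"
            using component_le_norm_cart[of "y - e" k] y by (simp add: dist_norm norm_minus_commute)
          then show "\<bar>(y $ k - e $ k) * A k p\<bar> \<le> r * \<bar>A k p\<bar>" by (simp add: abs_mult mult_right_mono)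
        qed
        also have "\<dots> \<le> r * S" unfolding S_def sum_distrib_left[symmetric] using r by (intro mult_left_mono) auto
        finally show ?thesis using r by simp
      qed
      moreover have "\<bar>\<Sum>k\<in>UNIV. y $ k * (A k x - A k p)\<bar> \<le> c / 2"
      proof -
        have "norm (\<Sum>k\<in>UNIV. (y $ k) *\<^sub>R (A k x - A k p)) \<le> real CARD('n) * (norm y * \<kappa>)"
          using dk(2)[OF x(1)] x(2) m(3) by (intro norm_sum_scaleR_le) (force intro: less_imp_le order_less_le_trans)
        also have "\<dots> \<le> real CARD('n) * (2 * \<kappa>)" using ny \<kappa> by (intro mult_left_mono mult_right_mono) auto
        also have "\<dots> = c / 2" unfolding \<kappa>_def by simp
        finally show ?thesis by simp
      qed
      ultimately show ?thesis using c by (simp add: abs_le_iff)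
    qed
    show ?thesis
    proof (rule that[of r "m / 4" e])
      fix x y :: "real^'n" and \<tau> :: real
      assume x: "x \<in> V" "dist x p < m / 4" and \<tau>: "0 \<le> \<tau>" "\<tau> \<le> m / 4" and y: "y \<in> cball e r"
      have ny: "norm y \<le> 3" using norm_triangle_sub[of y e] ne r y by (simp add: dist_norm norm_minus_commute)
      have st: "x + \<sigma> *\<^sub>R y \<in> ball p m" if "0 \<le> \<sigma>" "\<sigma> \<le> \<tau>" for \<sigma>
        by (rule stay[of _ "m / 4"]) (use x \<tau> ny that in auto)
      then have sN: "x + \<sigma> *\<^sub>R y \<in> N" if "0 \<le> \<sigma>" "\<sigma> \<le> \<tau>" for \<sigma>
        using that m(2) d(2) by (force simp: subset_iff)
      have seg: "x + \<sigma> *\<^sub>R (\<tau> *\<^sub>R y) \<in> N \<and> dist (x + \<sigma> *\<^sub>R (\<tau> *\<^sub>R y)) p < m" if "0 \<le> \<sigma>" "\<sigma> \<le> 1" for \<sigma>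
      proof -
        have "0 \<le> \<sigma> * \<tau>" "\<sigma> * \<tau> \<le> \<tau>" using that \<tau> by (auto simp: mult_left_le_one_le)
        from st[OF this] sN[OF this] show ?thesis by (simp add: dist_commute)
      qed
      define \<psi> where "\<psi> \<sigma> = \<rho> (x + \<sigma> *\<^sub>R (\<tau> *\<^sub>R y))" for \<sigma>
      have der: "(\<psi> has_real_derivative (\<Sum>k\<in>UNIV. ((\<tau> *\<^sub>R y) $ k) *\<^sub>R A k (x + \<sigma> *\<^sub>R (\<tau> *\<^sub>R y)))) (at \<sigma> within {0..1})"
        if "\<sigma> \<in> {0..1}" for \<sigma>
        unfolding has_real_derivative_iff_has_vector_derivative \<psi>_def A_def using that seg
        by (intro has_vector_derivative_along_segment[OF C1_on_has_derivative[OF C1]]) auto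
      have "0 \<le> (\<Sum>k\<in>UNIV. ((\<tau> *\<^sub>R y) $ k) *\<^sub>R A k (x + \<sigma> *\<^sub>R (\<tau> *\<^sub>R y)))" if "\<sigma> \<in> {0..1}" for \<sigma>
      proof -
        have "(\<Sum>k\<in>UNIV. ((\<tau> *\<^sub>R y) $ k) *\<^sub>R A k z) = \<tau> * (\<Sum>k\<in>UNIV. (y $ k) *\<^sub>R A k z)" for z
          by (simp add: sum_distrib_left mult.assoc)
        then show ?thesis using pos[OF _ _ y] seg \<tau> that by simp
      qed
      \<comment> \<open>A segment that starts where \<rho> is nonnegative ends where \<rho> is
        nonnegative, hence in \<open>V\<close>.\<close>
      then have "\<psi> 0 \<le> \<psi> 1"
        using mvt_very_simple[of 0 1 \<psi> "\<lambda>\<sigma> h. (\<Sum>k\<in>UNIV. ((\<tau> *\<^sub>R y) $ k) *\<^sub>R A k (x + \<sigma> *\<^sub>R (\<tau> *\<^sub>R y))) * h"] der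
        unfolding has_field_derivative_def by fastforce
      moreover have "x \<in> {x \<in> N. 0 \<le> \<rho> x}" unfolding \<rho>(3)[symmetric] using x seg[of 0] by simp
      then have "0 \<le> \<psi> 0" unfolding \<psi>_def by simp
      ultimately have "x + \<tau> *\<^sub>R y \<in> {x \<in> N. 0 \<le> \<rho> x}" using seg[of 1] unfolding \<psi>_def by simp
      then show "x + \<tau> *\<^sub>R y \<in> V" unfolding \<rho>(3)[symmetric] by simp
    qed (use r m in auto)
  qed
qed

text \<open>The Christoffel symbol of the first kind: for a smooth isometric v it is <\<partial>_k
  \<partial>_i v, \<partial>_l v>.\<close>

definition christoffel_lowered ::
  "(real^'n) set \<Rightarrow> ('n \<Rightarrow> 'n \<Rightarrow> real^'n \<Rightarrow> real) \<Rightarrow> 'n \<Rightarrow> 'n \<Rightarrow> 'n \<Rightarrow> real^'n \<Rightarrow> real" where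
  "christoffel_lowered V G k i l x =
     (partial_deriv V (G i l) k x + partial_deriv V (G k l) i x - partial_deriv V (G k i) l x) / 2"

lemma power_small:
  fixes \<theta> :: real
  assumes "0 < \<theta>" "0 < B"
  obtains \<epsilon> where "0 < \<epsilon>" "\<epsilon> powr \<theta> \<le> B"
proof -
  have "(B powr (1 / \<theta>)) powr \<theta> = B" using assms by (simp add: powr_powr)
  then show ?thesis using assms that[of "B powr (1 / \<theta>)"] by simp
qed

text \<open>Neighbourhood and constant in the hypothesis depend on the index. As there are finitely
  many indices, one radius and the sum of the constants serve all of them.\<close>

lemma uniform_local_holder:
  fixes A :: "'n::finite \<Rightarrow> real^'n \<Rightarrow> 'b::real_normed_vector"
  assumes "\<forall>i. \<exists>N. open N \<and> p \<in> N \<and> holder_on \<alpha> (V \<inter> N) (A i)"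
  obtains d K where "0 < d" "0 \<le> K"
    "\<And>i x y. x \<in> V \<Longrightarrow> y \<in> V \<Longrightarrow> dist x p < d \<Longrightarrow> dist y p < d \<Longrightarrow> norm (A i x - A i y) \<le> K * dist x y powr \<alpha>"
proof -
  obtain N where N: "\<And>i. open (N i)" "\<And>i. p \<in> N i" "\<And>i. holder_on \<alpha> (V \<inter> N i) (A i)" using assms by metis
  define C where "C i = (SOME C. \<forall>x\<in>V \<inter> N i. \<forall>y\<in>V \<inter> N i. norm (A i x - A i y) \<le> C * dist x y powr \<alpha>)" for i
  have ex: "\<forall>x\<in>V \<inter> N i. \<forall>y\<in>V \<inter> N i. norm (A i x - A i y) \<le> C i * dist x y powr \<alpha>" for i
    unfolding C_def by (rule someI_ex) (rule N(3)[unfolded holder_on_def])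
  have C: "norm (A i x - A i y) \<le> C i * dist x y powr \<alpha>" if "x \<in> V \<inter> N i" "y \<in> V \<inter> N i" for i x y
    using ex[rule_format, OF that] .
  have "open (\<Inter>i. N i)" "p \<in> (\<Inter>i. N i)" using N by auto
  then obtain d where d: "0 < d" "ball p d \<subseteq> (\<Inter>i. N i)" by (rule openE)
  define K where "K = (\<Sum>i\<in>UNIV. \<bar>C i\<bar>)"
  have K: "C i \<le> K" for i
    unfolding K_def using member_le_sum[of i UNIV "\<lambda>i. \<bar>C i\<bar>"] by simp
  show ?thesis
  proof (rule that[OF d(1)])
    show "0 \<le> K" unfolding K_def by (simp add: sum_nonneg)
    fix i x y assume "x \<in> V" "y \<in> V" "dist x p < d" "dist y p < d"
    then have "norm (A i x - A i y) \<le> C i * dist x y powr \<alpha>"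
      using d by (intro C) (auto simp: subset_iff dist_commute)
    also have "\<dots> \<le> K * dist x y powr \<alpha>" by (intro mult_right_mono K) simp
    finally show "norm (A i x - A i y) \<le> K * dist x y powr \<alpha>" .
  qed
qed

lemma uniform_local_continuity:
  fixes T :: "'i::finite \<Rightarrow> 'a::metric_space \<Rightarrow> real"
  assumes "\<And>i. continuous_on V (T i)" "p \<in> V" "0 < \<eta>"
  obtains d where "0 < d"
    "\<And>i x y. x \<in> V \<Longrightarrow> y \<in> V \<Longrightarrow> dist x p < d \<Longrightarrow> dist y p < d \<Longrightarrow> \<bar>T i x - T i y\<bar> \<le> \<eta>"
proof -
  have "\<exists>d>0. \<forall>x\<in>V. dist x p < d \<longrightarrow> \<bar>T i x - T i p\<bar> < \<eta> / 2" for i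
    using assms(1)[of i] assms(2,3) half_gt_zero[OF assms(3)] unfolding continuous_on_iff dist_real_def by blast
  then obtain dk where dk: "\<And>i. 0 < dk i" "\<And>i x. x \<in> V \<Longrightarrow> dist x p < dk i \<Longrightarrow> \<bar>T i x - T i p\<bar> < \<eta> / 2" by metis
  show ?thesis
  proof (rule that[of "Min (range dk)"])
    show "0 < Min (range dk)" using dk by simp
    fix i x y assume "x \<in> V" "y \<in> V" "dist x p < Min (range dk)" "dist y p < Min (range dk)"
    then have "\<bar>T i x - T i p\<bar> < \<eta> / 2" "\<bar>T i y - T i p\<bar> < \<eta> / 2"
      using dk(2)[of x i] dk(2)[of y i] by auto
    then show "\<bar>T i x - T i y\<bar> \<le> \<eta>" by linarith
  qed
qed

text \<open>The pointwise form of the identity: \<open>\<partial>\<^sub>i v\<close> need not be differentiable, but its component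
  along \<open>\<partial>\<^sub>l v\<close> has a first-order expansion, with coefficients the Christoffel symbols of the first kind.\<close>

lemma partial_deriv_increment:
  fixes v :: "real^'n \<Rightarrow> 'b::real_inner" and G :: "'n \<Rightarrow> 'n \<Rightarrow> real^'n \<Rightarrow> real"
  assumes V: "C2_domain V" and v: "C1_on V v" and \<alpha>: "1 / 2 < \<alpha>"
    and holder: "\<forall>i. \<exists>N. open N \<and> p0 \<in> N \<and> holder_on \<alpha> (V \<inter> N) (partial_deriv V v i)"
    and G: "\<And>i j. C1_on V (G i j)"
    and iso: "\<And>i j x. x \<in> V \<Longrightarrow> partial_deriv V v i x \<bullet> partial_deriv V v j x = G i j x"
    and p0: "p0 \<in> V" and \<eta>': "0 < \<eta>'"
  obtains \<delta> where "0 < \<delta>"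
    "\<And>p q i l. p \<in> V \<Longrightarrow> q \<in> V \<Longrightarrow> dist p p0 < \<delta> \<Longrightarrow> dist q p0 < \<delta> \<Longrightarrow>
      \<bar>(partial_deriv V v i q - partial_deriv V v i p) \<bullet> partial_deriv V v l p
        - (\<Sum>k\<in>UNIV. (q - p) $ k * christoffel_lowered V G k i l p)\<bar> \<le> \<eta>' * norm (q - p)"
proof -
  define A where "A i = partial_deriv V v i" for i
  define n where "n = real CARD('n)"
  have n: "1 \<le> n" unfolding n_def by (simp add: Suc_leI)
  define dv where "dv x b = (\<Sum>i\<in>UNIV. (b $ i) *\<^sub>R A i x)" for x b
  define T where "T x k i j = partial_deriv V (G i j) k x" for x k i j
  define D where "D x = contract3 (T x)" for x
  have symT: "T x k i j = T x k j i" if "x \<in> V" for x k i j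
    unfolding T_def by (rule partial_deriv_cong[OF _ that]) (metis iso inner_commute)
  have symD: "sym_trilinear (D x)" if "x \<in> V" for x
    unfolding D_def by (rule sym_trilinear_contract3) (rule symT[OF that])
  have dv_inner: "dv x b \<bullet> dv x b = (\<Sum>i\<in>UNIV. b $ i * (\<Sum>j\<in>UNIV. b $ j * G i j x))" if "x \<in> V" for x b
    unfolding dv_def A_def inner_sum_left inner_sum_right
    by (subst sum.swap) (simp add: iso[OF that] sum_distrib_left mult_ac)

  obtain e :: "real^'n" and r \<delta>c where r: "0 < r" "r \<le> 2" and \<delta>c: "0 < \<delta>c"
    and cone: "\<And>x \<tau> y. x \<in> V \<Longrightarrow> dist x p0 < \<delta>c \<Longrightarrow> 0 \<le> \<tau> \<Longrightarrow> \<tau> \<le> \<delta>c \<Longrightarrow> y \<in> cball e r \<Longrightarrow> x + \<tau> *\<^sub>R y \<in> V"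
    using C2_domain_cone[OF V p0] by metis
  define M where "M = norm e + r"
  have M: "0 < M" using r norm_ge_zero[of e] unfolding M_def by linarith
  \<comment> \<open>The constant of \<open>derivative_increment\<close>. It depends only on the cone
    at \<open>p0\<close>, so the target accuracy can be divided by it in advance.\<close>
  define C where "C = 16 * (290 * M\<^sup>2 + M ^ 3) / r ^ 3"
  have C: "0 < C" unfolding C_def using M r by (intro divide_pos_pos mult_pos_pos add_pos_pos) auto
  define \<eta> where "\<eta> = \<eta>' / C"
  have \<eta>: "0 < \<eta>" using \<eta>' C unfolding \<eta>_def by simp
  obtain dh K where dh: "0 < dh" "0 \<le> K"
    and hold: "\<And>i x y. x \<in> V \<Longrightarrow> y \<in> V \<Longrightarrow> dist x p0 < dh \<Longrightarrow> dist y p0 < dh \<Longrightarrow> norm (A i x - A i y) \<le> K * dist x y powr \<alpha>"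
    using uniform_local_holder[OF holder] unfolding A_def by metis
  \<comment> \<open>Oscillation allowed for the metric derivatives. It serves two purposes:
    linearizing the metric costs n^3 M and comparing the forms \<open>koszul\<close> at two points
    costs 3 n^3.\<close>
  define \<eta>2 where "\<eta>2 = \<eta> / (3 * n ^ 3 * (1 + M))"
  have \<eta>2: "0 < \<eta>2" using \<eta> n M unfolding \<eta>2_def by simp
  have \<eta>2': "3 * n ^ 3 * (1 + M) * \<eta>2 = \<eta>" using n M unfolding \<eta>2_def by simp
  have cont: "continuous_on V (\<lambda>x. T x k i j)" for k i j
    using G unfolding C1_on_def T_def by blast
  define T' where "T' = (\<lambda>(k, i, j) x. T x k i j)"
  have "continuous_on V (T' kij)" for kij
    unfolding T'_def by (cases kij) (simp add: cont)
  from uniform_local_continuity[of V T', OF this p0 \<eta>2] obtain d2 where d2: "0 < d2"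
    and T'_close: "\<And>kij x y. x \<in> V \<Longrightarrow> y \<in> V \<Longrightarrow> dist x p0 < d2 \<Longrightarrow> dist y p0 < d2 \<Longrightarrow>
      \<bar>T' kij x - T' kij y\<bar> \<le> \<eta>2" by blast
  have T_close: "\<bar>T x k i j - T y k i j\<bar> \<le> \<eta>2"
    if "x \<in> V" "y \<in> V" "dist x p0 < d2" "dist y p0 < d2" for k i j x y
    using T'_close[OF that, of "(k, i, j)"] unfolding T'_def by simp
  define m where "m = min dh d2"
  have m: "0 < m" "m \<le> dh" "m \<le> d2" using dh d2 unfolding m_def by auto
  \<comment> \<open>The squared Hoelder bound contains t^(2\<alpha>) = t * t^(2\<alpha> - 1). Once
    the second factor is below \<open>B\<close>, the bound takes the form \<eta> t; such scales
    exist because \<alpha> > 1/2.\<close>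
  define B where "B = \<eta> / (n\<^sup>2 * (1 + K)\<^sup>2 * (1 + M) powr (2 * \<alpha>))"
  have B: "0 < B" using \<eta> n dh M unfolding B_def by (intro divide_pos_pos mult_pos_pos) auto
  obtain \<epsilon>1 where \<epsilon>1: "0 < \<epsilon>1" "\<epsilon>1 powr (2 * \<alpha> - 1) \<le> B" using power_small[of "2 * \<alpha> - 1" B] B \<alpha> by auto
  define \<epsilon> where "\<epsilon> = min \<epsilon>1 (min \<delta>c (m / (2 * M)))"
  have \<epsilon>: "0 < \<epsilon>" "\<epsilon> \<le> \<epsilon>1" "\<epsilon> \<le> \<delta>c" "\<epsilon> * M \<le> m / 2"
  proof -
    show "0 < \<epsilon>" "\<epsilon> \<le> \<epsilon>1" "\<epsilon> \<le> \<delta>c" using \<epsilon>1 \<delta>c m M unfolding \<epsilon>_def by auto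
    have "\<epsilon> \<le> m / (2 * M)" unfolding \<epsilon>_def by simp
    then show "\<epsilon> * M \<le> m / 2" using M by (simp add: field_simps)
  qed
  \<comment> \<open>Two points this close to \<open>p0\<close> are at distance at most r \<epsilon>
    / 2, which makes the scale 2 |q - p| / r of \<open>derivative_increment\<close> at most
    \<epsilon>. The bound m/2 keeps cones of size \<epsilon> in the ball where the estimates
    hold.\<close>
  define \<delta> where "\<delta> = min \<delta>c (min (m / 2) (r * \<epsilon> / 4))"
  have \<delta>: "0 < \<delta>" "\<delta> \<le> \<delta>c" "\<delta> \<le> m / 2" "\<delta> \<le> r * \<epsilon> / 4" using \<delta>c m r \<epsilon> unfolding \<delta>_def by auto

  have dv_close: "(norm (dv x b - dv y b))\<^sup>2 \<le> \<eta> * t * (norm b)\<^sup>2"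
    if x: "x \<in> V" "dist x p0 < m" and y: "y \<in> V" "dist y p0 < m" and t: "0 < t" "t \<le> \<epsilon>" "dist x y \<le> (1 + M) * t"
    for x y b t
  proof -
    have "norm (A i x - A i y) \<le> (1 + K) * ((1 + M) * t) powr \<alpha>" for i
    proof -
      have "norm (A i x - A i y) \<le> K * dist x y powr \<alpha>" using x y m by (intro hold) auto
      also have "\<dots> \<le> (1 + K) * ((1 + M) * t) powr \<alpha>"
        using dh t \<alpha> by (intro mult_mono powr_mono2) auto
      finally show ?thesis .
    qed
    then have "norm (\<Sum>i\<in>UNIV. (b $ i) *\<^sub>R (A i x - A i y)) \<le> n * (norm b * ((1 + K) * ((1 + M) * t) powr \<alpha>))"
      unfolding n_def by (rule norm_sum_scaleR_le)
    then have "norm (dv x b - dv y b) \<le> n * (norm b * ((1 + K) * ((1 + M) * t) powr \<alpha>))"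
      unfolding dv_def by (simp add: scaleR_diff_right sum_subtractf)
    then have "(norm (dv x b - dv y b))\<^sup>2 \<le> (n * (norm b * ((1 + K) * ((1 + M) * t) powr \<alpha>)))\<^sup>2"
      by (intro power_mono) auto
    also have "\<dots> = n\<^sup>2 * (1 + K)\<^sup>2 * (((1 + M) * t) powr \<alpha>)\<^sup>2 * (norm b)\<^sup>2"
      by (simp add: power_mult_distrib)
    also have "(((1 + M) * t) powr \<alpha>)\<^sup>2 = (1 + M) powr (2 * \<alpha>) * (t * t powr (2 * \<alpha> - 1))"
    proof -
      have "(((1 + M) * t) powr \<alpha>)\<^sup>2 = ((1 + M) * t) powr (2 * \<alpha>)"
        using M t by (simp add: powr_power mult.commute)
      also have "\<dots> = (1 + M) powr (2 * \<alpha>) * t powr (1 + (2 * \<alpha> - 1))"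
        using M t by (simp add: powr_mult)
      also have "t powr (1 + (2 * \<alpha> - 1)) = t * t powr (2 * \<alpha> - 1)"
        using t by (subst powr_add) simp
      finally show ?thesis .
    qed
    also have "n\<^sup>2 * (1 + K)\<^sup>2 * ((1 + M) powr (2 * \<alpha>) * (t * t powr (2 * \<alpha> - 1))) * (norm b)\<^sup>2
        \<le> n\<^sup>2 * (1 + K)\<^sup>2 * ((1 + M) powr (2 * \<alpha>) * (t * B)) * (norm b)\<^sup>2"
    proof -
      have "t powr (2 * \<alpha> - 1) \<le> \<epsilon>1 powr (2 * \<alpha> - 1)" using t \<epsilon> \<alpha> by (intro powr_mono2) auto
      then have "t powr (2 * \<alpha> - 1) \<le> B" using \<epsilon>1 by simp
      then show ?thesis using t by (intro mult_right_mono mult_left_mono) auto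
    qed
    also have "\<dots> = \<eta> * t * (norm b)\<^sup>2"
    proof -
      have "n\<^sup>2 * (1 + K)\<^sup>2 * (1 + M) powr (2 * \<alpha>) * B = \<eta>"
        unfolding B_def using n dh M by simp
      then show ?thesis by (metis (no_types) mult.assoc mult.commute)
    qed
    finally show ?thesis .
  qed

  have expansion: "almost_isometric_expansion (D q) v dv V (cball e r) q M \<epsilon> \<eta>"
    if q: "q \<in> V" "dist q p0 < \<delta>" for q
  proof -
    have inV: "q + w \<in> V" if w: "w \<in> truncated_cone (cball e r) \<epsilon>" for w
      using w q \<delta> \<epsilon> unfolding truncated_cone_def by (auto intro!: cone)
    have normY: "norm y \<le> M" if "y \<in> cball e r" for y
      using that norm_triangle_sub[of y e] unfolding M_def by (simp add: dist_norm norm_minus_commute)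
    have near: "q + w \<in> V \<and> dist (q + w) p0 < m \<and> norm w \<le> s * M"
      if s: "0 < s" "s \<le> \<epsilon>" and w: "w \<in> truncated_cone (cball e r) s" for s w
    proof -
      have nw: "norm w \<le> s * M" using norm_truncated_cone_le[OF normY w] .
      also have "\<dots> \<le> m / 2" using s M \<epsilon> mult_right_mono[of s \<epsilon> M] by linarith
      finally have "dist (q + w) q \<le> m / 2" by (simp add: dist_norm)
      then have "dist (q + w) p0 < m" using q \<delta> dist_triangle[of "q + w" p0 q] by linarith
      then show ?thesis using nw inV truncated_cone_mono[OF s(2)] w by blast
    qed
    have qm: "dist q p0 < m" using q \<delta> m by linarith
    show ?thesis
    proof (intro almost_isometric_expansion.intro almost_isometric_expansion_axioms.intro symD q)
      show "(v has_derivative dv x) (at x within V)" if "x \<in> V" for x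
        using C1_on_has_derivative[OF v that] unfolding dv_def A_def .
      show "(norm (dv (q + w) b - dv q b))\<^sup>2 \<le> \<eta> * s * (norm b)\<^sup>2"
        if s: "0 < s" "s \<le> \<epsilon>" and w: "w \<in> truncated_cone (cball e r) s" for s w b
        using near[OF s w] qm q s by (intro dv_close) (auto simp: dist_norm algebra_simps)
      show "\<bar>dv (q + w) b \<bullet> dv (q + w) b - dv q b \<bullet> dv q b - D q w b b\<bar> \<le> \<eta> * s * (norm b)\<^sup>2"
        if s: "0 < s" "s \<le> \<epsilon>" and w: "w \<in> truncated_cone (cball e r) s" for s w b
      proof -
        have seg: "q + \<tau> *\<^sub>R w \<in> V \<and> dist (q + \<tau> *\<^sub>R w) p0 < m" if \<tau>: "0 \<le> \<tau>" "\<tau> \<le> 1" for \<tau>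
        proof -
          have "\<tau> *\<^sub>R w \<in> truncated_cone (cball e r) s"
            using truncated_cone_scale[OF w \<tau>(1)] truncated_cone_mono[of "\<tau> * s" s] s \<tau> mult_left_le_one_le[of s \<tau>] by auto
          from near[OF s this] show ?thesis by simp
        qed
        \<comment> \<open>Since \<open>v\<close> is isometric, the squared length of
          \<open>dv x b\<close> is the metric at \<open>x\<close> applied to \<open>b\<close> twice.
          Linearizing each coefficient therefore yields \<open>metric_close\<close>.\<close>
        have lin: "\<bar>G i j (q + w) - G i j q - (\<Sum>k\<in>UNIV. w $ k * T q k i j)\<bar> \<le> n * (norm w * \<eta>2)" for i j
        proof -
          have "norm (G i j (q + w) - G i j q - (\<Sum>k\<in>UNIV. w $ k * T q k i j)) \<le> n * (norm w * \<eta>2)"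
          proof (rule linearization_bound[where V = V and dv = "\<lambda>x h. \<Sum>k\<in>UNIV. (h $ k) *\<^sub>R T x k i j"])
            fix \<tau> :: real assume \<tau>: "0 \<le> \<tau>" "\<tau> \<le> 1"
            show "(G i j has_derivative (\<lambda>h. \<Sum>k\<in>UNIV. (h $ k) *\<^sub>R T (q + \<tau> *\<^sub>R w) k i j)) (at (q + \<tau> *\<^sub>R w) within V)"
              unfolding T_def using C1_on_has_derivative[OF G] seg[OF \<tau>] by blast
            have "norm (\<Sum>k\<in>UNIV. (w $ k) *\<^sub>R (T (q + \<tau> *\<^sub>R w) k i j - T q k i j)) \<le> n * (norm w * \<eta>2)"
              unfolding n_def using seg[OF \<tau>] q qm m
              by (intro norm_sum_scaleR_le) (auto intro!: T_close)
            then show "norm ((\<Sum>k\<in>UNIV. (w $ k) *\<^sub>R T (q + \<tau> *\<^sub>R w) k i j) - (\<Sum>k\<in>UNIV. w $ k * T q k i j)) \<le> n * (norm w * \<eta>2)"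
              by (simp add: right_diff_distrib sum_subtractf)
          qed (use seg in auto)
          then show ?thesis by simp
        qed
        let ?E = "\<lambda>i j. G i j (q + w) - G i j q - (\<Sum>k\<in>UNIV. w $ k * T q k i j)"
        have Dq: "D q w b b = (\<Sum>i\<in>UNIV. b $ i * (\<Sum>j\<in>UNIV. b $ j * (\<Sum>k\<in>UNIV. w $ k * T q k i j)))"
          unfolding D_def by (rule contract3_swap)
        have "dv (q + w) b \<bullet> dv (q + w) b - dv q b \<bullet> dv q b - D q w b b = (\<Sum>i\<in>UNIV. (b $ i) *\<^sub>R (\<Sum>j\<in>UNIV. (b $ j) *\<^sub>R ?E i j))"
          using seg[of 1] q unfolding Dq by (simp add: dv_inner right_diff_distrib sum_subtractf)
        also have "norm \<dots> \<le> n * (norm b * (n * (norm b * (n * (norm w * \<eta>2)))))"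
          unfolding n_def using lin unfolding n_def by (intro norm_sum_scaleR_le) auto
        also have "\<dots> = (n ^ 3 * \<eta>2) * norm w * (norm b)\<^sup>2" by (simp add: power3_eq_cube power2_eq_square)
        also have "\<dots> \<le> (n ^ 3 * \<eta>2) * (s * M) * (norm b)\<^sup>2"
          using near[OF s w] n \<eta>2 by (intro mult_right_mono mult_left_mono) auto
        also have "\<dots> = (n ^ 3 * M * \<eta>2) * s * (norm b)\<^sup>2" by simp
        also have "\<dots> \<le> (3 * n ^ 3 * (1 + M) * \<eta>2) * s * (norm b)\<^sup>2"
          using n \<eta>2 s M by (intro mult_right_mono) auto
        finally show ?thesis unfolding \<eta>2' by simp
      qed
    qed (use \<eta> inV normY in auto)
  qed

  show ?thesis
  proof (rule that[OF \<delta>(1)])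
    fix p q :: "real^'n" and i l
    assume p: "p \<in> V" "dist p p0 < \<delta>" and q: "q \<in> V" "dist q p0 < \<delta>"
    have dv_axis: "dv x (axis i 1) = A i x" for x i
      unfolding dv_def axis_def by (simp add: if_distrib[of "\<lambda>z. z *\<^sub>R _"] cong: if_cong)
    show "\<bar>(partial_deriv V v i q - partial_deriv V v i p) \<bullet> partial_deriv V v l p
        - (\<Sum>k\<in>UNIV. (q - p) $ k * christoffel_lowered V G k i l p)\<bar> \<le> \<eta>' * norm (q - p)"
    proof (cases "p = q")
      case False
      have h: "norm (q - p) \<le> r * \<epsilon> / 2"
        using dist_triangle[of q p p0] p q \<delta> by (simp add: dist_norm norm_minus_commute)
      have "\<bar>(dv q (axis i 1) - dv p (axis i 1)) \<bullet> dv p (axis l 1) - koszul (D p) (q - p) (axis i 1) (axis l 1)\<bar>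
          \<le> 16 * (290 * (norm e + r)\<^sup>2 + (norm e + r) ^ 3) / r ^ 3 * \<eta> * norm (q - p)"
      proof (rule derivative_increment[OF r expansion[OF p, unfolded M_def] expansion[OF q, unfolded M_def] False])
        show "2 * norm (q - p) / r \<le> \<epsilon>" using h r by (simp add: field_simps)
        show "(norm (dv q b - dv p b))\<^sup>2 \<le> \<eta> * norm (q - p) * (norm b)\<^sup>2" for b
        proof (rule dv_close)
          show "norm (q - p) \<le> \<epsilon>" using h r \<epsilon> mult_right_mono[of r 2 \<epsilon>] by linarith
          show "dist q p \<le> (1 + M) * norm (q - p)" using M by (simp add: dist_norm algebra_simps)
        qed (use p q \<delta> m False in auto)
        show "\<bar>koszul (D q) a a c - koszul (D p) a a c\<bar> \<le> \<eta> * (norm a)\<^sup>2 * norm c" for a c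
        proof -
          have *: "\<bar>D q a b c - D p a b c\<bar> \<le> n ^ 3 * (norm a * norm b * norm c * \<eta>2)" for a b c
            unfolding D_def contract3_diff n_def using p q \<delta> m by (intro contract3_bound T_close) auto
          have "\<bar>koszul (D q) a a c - koszul (D p) a a c\<bar> \<le> 3 * (n ^ 3 * (norm a * norm a * norm c * \<eta>2))"
          proof -
            define E where "E = n ^ 3 * (norm a * norm a * norm c * \<eta>2)"
            have "\<bar>D q a a c - D p a a c\<bar> \<le> E" using *[of a a c] unfolding E_def .
            moreover have "\<bar>D q c a a - D p c a a\<bar> \<le> E" using *[of c a a] unfolding E_def by (simp add: mult_ac)
            moreover have "koszul (D q) a a c - koszul (D p) a a c
                = (D q a a c - D p a a c) - 1 / 2 * D q c a a + 1 / 2 * D p c a a"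
              unfolding koszul_def by (simp add: field_simps)
            ultimately have "\<bar>koszul (D q) a a c - koszul (D p) a a c\<bar> \<le> 3 * E" by linarith
            then show ?thesis unfolding E_def .
          qed
          also have "\<dots> = (3 * n ^ 3 * 1 * \<eta>2) * ((norm a)\<^sup>2 * norm c)" by (simp add: power2_eq_square)
          also have "\<dots> \<le> (3 * n ^ 3 * (1 + M) * \<eta>2) * ((norm a)\<^sup>2 * norm c)"
            using n \<eta>2 M by (intro mult_right_mono mult_left_mono) auto
          finally show ?thesis unfolding \<eta>2' by simp
        qed
      qed auto
      also have "\<dots> = \<eta>' * norm (q - p)"
        unfolding M_def[symmetric] C_def[symmetric] \<eta>_def using C by simp
      finally show ?thesis
        unfolding dv_axis D_def koszul_contract3_axis T_def A_def christoffel_lowered_def .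
    qed simp
  qed
qed

section \<open>Riemann sums and Young integration\<close>

text \<open>Uniformly, \<Psi> s t = \<rho> s (t - s) + o(|t - s|). Here \<Psi> may be any function
  of a cell, not only an increment F t - F s; this admits products of an increment with a value at
  the left end point, which may be regular although their factors are not.\<close>

definition first_order :: "real set \<Rightarrow> (real \<Rightarrow> real \<Rightarrow> real) \<Rightarrow> (real \<Rightarrow> real) \<Rightarrow> bool" where
  "first_order I \<Psi> \<rho> \<longleftrightarrow> (\<forall>\<eta>>0. \<exists>\<delta>>0. \<forall>s\<in>I. \<forall>t\<in>I. \<bar>t - s\<bar> < \<delta> \<longrightarrow> \<bar>\<Psi> s t - \<rho> s * (t - s)\<bar> \<le> \<eta> * \<bar>t - s\<bar>)"

lemma first_orderD:
  assumes "first_order I \<Psi> \<rho>" "0 < \<eta>"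
  obtains \<delta> where "0 < \<delta>" "\<And>s t. s \<in> I \<Longrightarrow> t \<in> I \<Longrightarrow> \<bar>t - s\<bar> < \<delta> \<Longrightarrow> \<bar>\<Psi> s t - \<rho> s * (t - s)\<bar> \<le> \<eta> * \<bar>t - s\<bar>"
  using assms unfolding first_order_def by meson

lemma first_order_add:
  assumes "first_order I \<Psi> \<rho>" "first_order I \<Psi>' \<rho>'"
  shows "first_order I (\<lambda>s t. \<Psi> s t + \<Psi>' s t) (\<lambda>s. \<rho> s + \<rho>' s)"
  unfolding first_order_def
proof (intro allI impI)
  fix \<eta> :: real assume "0 < \<eta>"
  then have h: "0 < \<eta> / 2" by simp
  obtain \<delta> where \<delta>: "0 < \<delta>" "\<And>s t. s \<in> I \<Longrightarrow> t \<in> I \<Longrightarrow> \<bar>t - s\<bar> < \<delta> \<Longrightarrow> \<bar>\<Psi> s t - \<rho> s * (t - s)\<bar> \<le> \<eta> / 2 * \<bar>t - s\<bar>"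
    using first_orderD[OF assms(1) h] by blast
  obtain \<delta>' where \<delta>': "0 < \<delta>'" "\<And>s t. s \<in> I \<Longrightarrow> t \<in> I \<Longrightarrow> \<bar>t - s\<bar> < \<delta>' \<Longrightarrow> \<bar>\<Psi>' s t - \<rho>' s * (t - s)\<bar> \<le> \<eta> / 2 * \<bar>t - s\<bar>"
    using first_orderD[OF assms(2) h] by blast
  show "\<exists>\<delta>>0. \<forall>s\<in>I. \<forall>t\<in>I. \<bar>t - s\<bar> < \<delta> \<longrightarrow> \<bar>\<Psi> s t + \<Psi>' s t - (\<rho> s + \<rho>' s) * (t - s)\<bar> \<le> \<eta> * \<bar>t - s\<bar>"
  proof (intro exI[of _ "min \<delta> \<delta>'"] conjI ballI impI)
    fix s t assume "s \<in> I" "t \<in> I" "\<bar>t - s\<bar> < min \<delta> \<delta>'"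
    then have "\<bar>\<Psi> s t - \<rho> s * (t - s)\<bar> \<le> \<eta> / 2 * \<bar>t - s\<bar>" "\<bar>\<Psi>' s t - \<rho>' s * (t - s)\<bar> \<le> \<eta> / 2 * \<bar>t - s\<bar>"
      using \<delta> \<delta>' by auto
    then show "\<bar>\<Psi> s t + \<Psi>' s t - (\<rho> s + \<rho>' s) * (t - s)\<bar> \<le> \<eta> * \<bar>t - s\<bar>"
      unfolding distrib_right by linarith
  qed (use \<delta> \<delta>' in auto)
qed

lemma first_order_sum:
  assumes "finite F" "\<And>i. i \<in> F \<Longrightarrow> first_order I (\<Psi> i) (\<rho> i)"
  shows "first_order I (\<lambda>s t. \<Sum>i\<in>F. \<Psi> i s t) (\<lambda>s. \<Sum>i\<in>F. \<rho> i s)"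
  using assms
proof (induction F rule: finite_induct)
  case empty
  show ?case unfolding first_order_def by (auto intro: exI[of _ 1])
next
  case (insert x F)
  then show ?case by (simp add: first_order_add)
qed

text \<open>The factor may depend on both ends of the cell, as the inner product of
  \<open>du l s\<close> with \<open>du i t\<close> does later. Only its limit on the diagonal enters
  the density.\<close>

lemma first_order_mult:
  assumes \<Psi>: "first_order I \<Psi> \<rho>" and \<rho>: "\<And>s. s \<in> I \<Longrightarrow> \<bar>\<rho> s\<bar> \<le> R"
    and k: "\<And>s t. s \<in> I \<Longrightarrow> t \<in> I \<Longrightarrow> \<bar>k s t\<bar> \<le> B"
    and cont: "\<And>\<eta>. 0 < \<eta> \<Longrightarrow> \<exists>\<delta>>0. \<forall>s\<in>I. \<forall>t\<in>I. \<bar>t - s\<bar> < \<delta> \<longrightarrow> \<bar>k s t - \<kappa> s\<bar> \<le> \<eta>"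
  shows "first_order I (\<lambda>s t. \<Psi> s t * k s t) (\<lambda>s. \<rho> s * \<kappa> s)"
  unfolding first_order_def
proof (intro allI impI)
  fix \<eta> :: real assume \<eta>: "0 < \<eta>"
  define e1 where "e1 = \<eta> / (2 * (\<bar>B\<bar> + 1))"
  define e2 where "e2 = \<eta> / (2 * (\<bar>R\<bar> + 1))"
  have e: "0 < e1" "0 < e2" "e1 * (\<bar>B\<bar> + 1) = \<eta> / 2" "(\<bar>R\<bar> + 1) * e2 = \<eta> / 2"
    using \<eta> unfolding e1_def e2_def by (auto simp: field_simps intro!: divide_pos_pos)
  obtain \<delta> where \<delta>: "0 < \<delta>" "\<And>s t. s \<in> I \<Longrightarrow> t \<in> I \<Longrightarrow> \<bar>t - s\<bar> < \<delta> \<Longrightarrow> \<bar>\<Psi> s t - \<rho> s * (t - s)\<bar> \<le> e1 * \<bar>t - s\<bar>"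
    using first_orderD[OF \<Psi> e(1)] by blast
  obtain \<delta>' where \<delta>': "0 < \<delta>'" "\<And>s t. s \<in> I \<Longrightarrow> t \<in> I \<Longrightarrow> \<bar>t - s\<bar> < \<delta>' \<Longrightarrow> \<bar>k s t - \<kappa> s\<bar> \<le> e2"
    using cont[OF e(2)] by blast
  show "\<exists>\<delta>>0. \<forall>s\<in>I. \<forall>t\<in>I. \<bar>t - s\<bar> < \<delta> \<longrightarrow> \<bar>\<Psi> s t * k s t - \<rho> s * \<kappa> s * (t - s)\<bar> \<le> \<eta> * \<bar>t - s\<bar>"
  proof (intro exI[of _ "min \<delta> \<delta>'"] conjI ballI impI)
    fix s t assume st: "s \<in> I" "t \<in> I" "\<bar>t - s\<bar> < min \<delta> \<delta>'"
    have "\<bar>(\<Psi> s t - \<rho> s * (t - s)) * k s t\<bar> \<le> (e1 * \<bar>t - s\<bar>) * (\<bar>B\<bar> + 1)"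
      unfolding abs_mult using st \<delta> k[OF st(1,2)] e by (intro mult_mono) auto
    moreover have "\<bar>\<rho> s * (t - s) * (k s t - \<kappa> s)\<bar> \<le> (\<bar>R\<bar> + 1) * \<bar>t - s\<bar> * e2"
      unfolding abs_mult using st \<delta>' \<rho>[OF st(1)] e by (intro mult_mono) auto
    moreover have "(e1 * \<bar>t - s\<bar>) * (\<bar>B\<bar> + 1) = \<eta> / 2 * \<bar>t - s\<bar>" "(\<bar>R\<bar> + 1) * \<bar>t - s\<bar> * e2 = \<eta> / 2 * \<bar>t - s\<bar>"
      using e(3,4) by (metis mult.assoc mult.commute)+
    moreover have "\<Psi> s t * k s t - \<rho> s * \<kappa> s * (t - s) =
        (\<Psi> s t - \<rho> s * (t - s)) * k s t + \<rho> s * (t - s) * (k s t - \<kappa> s)" by (simp add: algebra_simps)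
    ultimately show "\<bar>\<Psi> s t * k s t - \<rho> s * \<kappa> s * (t - s)\<bar> \<le> \<eta> * \<bar>t - s\<bar>" by linarith
  qed (use \<delta> \<delta>' in auto)
qed

lemma first_order_scale:
  assumes "first_order I \<Psi> \<rho>" "\<And>s. s \<in> I \<Longrightarrow> \<bar>h s\<bar> \<le> B"
  shows "first_order I (\<lambda>s t. h s * \<Psi> s t) (\<lambda>s. h s * \<rho> s)"
  unfolding first_order_def
proof (intro allI impI)
  fix \<eta> :: real assume \<eta>: "0 < \<eta>"
  define e where "e = \<eta> / (\<bar>B\<bar> + 1)"
  have e: "0 < e" "(\<bar>B\<bar> + 1) * e = \<eta>" using \<eta> unfolding e_def by (auto simp: field_simps intro!: divide_pos_pos)
  obtain \<delta> where \<delta>: "0 < \<delta>" "\<And>s t. s \<in> I \<Longrightarrow> t \<in> I \<Longrightarrow> \<bar>t - s\<bar> < \<delta> \<Longrightarrow> \<bar>\<Psi> s t - \<rho> s * (t - s)\<bar> \<le> e * \<bar>t - s\<bar>"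
    using first_orderD[OF assms(1) e(1)] by blast
  show "\<exists>\<delta>>0. \<forall>s\<in>I. \<forall>t\<in>I. \<bar>t - s\<bar> < \<delta> \<longrightarrow> \<bar>h s * \<Psi> s t - h s * \<rho> s * (t - s)\<bar> \<le> \<eta> * \<bar>t - s\<bar>"
  proof (intro exI[of _ \<delta>] conjI ballI impI \<delta>(1))
    fix s t assume st: "s \<in> I" "t \<in> I" "\<bar>t - s\<bar> < \<delta>"
    have "\<bar>h s * (\<Psi> s t - \<rho> s * (t - s))\<bar> \<le> (\<bar>B\<bar> + 1) * (e * \<bar>t - s\<bar>)"
      unfolding abs_mult using assms(2)[OF st(1)] \<delta>(2)[OF st] e by (intro mult_mono) auto
    then show "\<bar>h s * \<Psi> s t - h s * \<rho> s * (t - s)\<bar> \<le> \<eta> * \<bar>t - s\<bar>"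
      using e(2) by (simp add: right_diff_distrib mult.assoc[symmetric])
  qed
qed

lemma first_order_derivative:
  assumes der: "\<And>t. t \<in> {c..d} \<Longrightarrow> (f has_real_derivative f' t) (at t within {c..d})"
    and cont: "continuous_on {c..d} f'"
  shows "first_order {c..d} (\<lambda>s t. f t - f s) f'"
  unfolding first_order_def
proof (intro allI impI)
  fix \<eta> :: real assume \<eta>: "0 < \<eta>"
  have "uniformly_continuous_on {c..d} f'" using cont by (simp add: compact_uniformly_continuous)
  then obtain \<delta> where \<delta>: "0 < \<delta>" "\<And>s t. s \<in> {c..d} \<Longrightarrow> t \<in> {c..d} \<Longrightarrow> dist t s < \<delta> \<Longrightarrow> dist (f' t) (f' s) < \<eta>"
    using \<eta> unfolding uniformly_continuous_on_def by meson
  show "\<exists>\<delta>>0. \<forall>s\<in>{c..d}. \<forall>t\<in>{c..d}. \<bar>t - s\<bar> < \<delta> \<longrightarrow> \<bar>f t - f s - f' s * (t - s)\<bar> \<le> \<eta> * \<bar>t - s\<bar>"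
  proof (intro exI[of _ \<delta>] conjI ballI impI \<delta>(1))
    fix s t assume s: "s \<in> {c..d}" and t: "t \<in> {c..d}" and st: "\<bar>t - s\<bar> < \<delta>"
    have sub: "closed_segment s t \<subseteq> {c..d}"
      using s t closed_segment_subset convex_real_interval(5) by metis
    have "norm ((f t - f' s * t) - (f s - f' s * s)) \<le> \<eta> * norm (t - s)"
    proof (rule field_differentiable_bound[where S = "closed_segment s t" and f = "\<lambda>x. f x - f' s * x"])
      fix z assume z: "z \<in> closed_segment s t"
      show "((\<lambda>x. f x - f' s * x) has_field_derivative f' z - f' s) (at z within closed_segment s t)"
        using z sub by (auto intro!: derivative_eq_intros DERIV_subset[OF der])
      have "dist z s \<le> dist t s"
        using dist_in_closed_segment[OF z] by (simp add: dist_commute)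
      then have "dist (f' z) (f' s) < \<eta>"
        by (intro \<delta>(2) s subsetD[OF sub z]) (use st in \<open>simp add: dist_norm\<close>)
      then show "norm (f' z - f' s) \<le> \<eta>" by (simp add: dist_norm)
    qed auto
    then show "\<bar>f t - f s - f' s * (t - s)\<bar> \<le> \<eta> * \<bar>t - s\<bar>" by (simp add: algebra_simps)
  qed
qed

definition dyadic_point :: "real \<Rightarrow> real \<Rightarrow> nat \<Rightarrow> nat \<Rightarrow> real" where
  "dyadic_point c d n i = c + (d - c) * (real i / 2 ^ n)"

definition dyadic_sum :: "real \<Rightarrow> real \<Rightarrow> (real \<Rightarrow> real \<Rightarrow> real) \<Rightarrow> nat \<Rightarrow> real" where
  "dyadic_sum c d \<Psi> n = (\<Sum>i<2 ^ n. \<Psi> (dyadic_point c d n i) (dyadic_point c d n (Suc i)))"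

lemma dyadic_point_in:
  assumes "c < d" "i \<le> 2 ^ n"
  shows "dyadic_point c d n i \<in> {c..d}"
proof -
  have "real i \<le> 2 ^ n" using of_nat_mono[OF assms(2), where ?'a = real] by simp
  then have "real i / 2 ^ n \<le> 1" by simp
  then have "(d - c) * (real i / 2 ^ n) \<le> (d - c) * 1" using assms by (intro mult_left_mono) auto
  then show ?thesis using assms unfolding dyadic_point_def by auto
qed

lemma dyadic_point_step: "dyadic_point c d n (Suc i) - dyadic_point c d n i = (d - c) / 2 ^ n"
  unfolding dyadic_point_def by (simp add: field_simps)

lemma dyadic_point_ends [simp]: "dyadic_point c d n 0 = c" "dyadic_point c d n (2 ^ n) = d"
  unfolding dyadic_point_def by simp_all

text \<open>On a cell of length h, the sum and the integral both differ from \<rho> s h by at most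
  \<eta> h: the sum by the expansion, the integral by uniform continuity of \<rho>. Adding over all
  cells gives 2 \<eta> (d - c).\<close>

lemma dyadic_sum_tendsto_integral:
  assumes cd: "c < d" and \<Psi>: "first_order {c..d} \<Psi> \<rho>" and cont: "continuous_on {c..d} \<rho>"
  shows "dyadic_sum c d \<Psi> \<longlonglongrightarrow> integral {c..d} \<rho>"
proof (rule LIMSEQ_I)
  fix e :: real assume e: "0 < e"
  define \<eta> where "\<eta> = e / (3 * (d - c))"
  have \<eta>: "0 < \<eta>" using e cd unfolding \<eta>_def by simp
  obtain \<delta>1 where \<delta>1: "0 < \<delta>1" "\<And>s t. s \<in> {c..d} \<Longrightarrow> t \<in> {c..d} \<Longrightarrow> \<bar>t - s\<bar> < \<delta>1 \<Longrightarrow> \<bar>\<Psi> s t - \<rho> s * (t - s)\<bar> \<le> \<eta> * \<bar>t - s\<bar>"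
    using first_orderD[OF \<Psi> \<eta>] by blast
  have "uniformly_continuous_on {c..d} \<rho>" using cont by (simp add: compact_uniformly_continuous)
  then obtain \<delta>2 where \<delta>2: "0 < \<delta>2" "\<And>s t. s \<in> {c..d} \<Longrightarrow> t \<in> {c..d} \<Longrightarrow> dist t s < \<delta>2 \<Longrightarrow> dist (\<rho> t) (\<rho> s) < \<eta>"
    using \<eta> unfolding uniformly_continuous_on_def by meson
  have "(\<lambda>n. (d - c) * (1 / 2) ^ n) \<longlonglongrightarrow> (d - c) * 0" by (intro tendsto_intros LIMSEQ_realpow_zero) auto
  then have "\<forall>\<^sub>F n in sequentially. (d - c) * (1 / 2) ^ n < min \<delta>1 \<delta>2"
    by (rule order_tendstoD(2)) (use \<delta>1 \<delta>2 in auto)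
  then obtain N where N: "\<And>n. n \<ge> N \<Longrightarrow> (d - c) / 2 ^ n < min \<delta>1 \<delta>2"
    unfolding eventually_sequentially by (auto simp: power_divide)
  show "\<exists>N. \<forall>n\<ge>N. norm (dyadic_sum c d \<Psi> n - integral {c..d} \<rho>) < e"
  proof (intro exI[of _ N] allI impI)
    fix n assume n: "N \<le> n"
    define t where "t = dyadic_point c d n"
    define h where "h = (d - c) / 2 ^ n"
    have h: "0 < h" "h < \<delta>1" "h < \<delta>2" using N[OF n] cd unfolding h_def by auto
    have step: "t (Suc i) = t i + h" for i using dyadic_point_step[of c d n i] unfolding t_def h_def by linarith
    have tin: "t i \<in> {c..d}" if "i \<le> 2 ^ n" for i using dyadic_point_in[OF cd that] unfolding t_def .
    have piece: "\<bar>\<Psi> (t i) (t (Suc i)) - integral {t i..t (Suc i)} \<rho>\<bar> \<le> 2 * \<eta> * h" if i: "i < 2 ^ n" for i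
    proof -
      have sub: "{t i..t (Suc i)} \<subseteq> {c..d}" using tin[of i] tin[of "Suc i"] i by auto
      have ci: "continuous_on {t i..t (Suc i)} \<rho>" using cont sub continuous_on_subset by blast
      have 1: "\<bar>\<Psi> (t i) (t (Suc i)) - \<rho> (t i) * h\<bar> \<le> \<eta> * h"
        using \<delta>1(2)[of "t i" "t (Suc i)"] tin[of i] tin[of "Suc i"] i h by (simp add: step)
      have "norm (integral {t i..t (Suc i)} (\<lambda>x. \<rho> x - \<rho> (t i))) \<le> \<eta> * (t (Suc i) - t i)"
      proof (rule integral_bound)
        fix x assume x: "x \<in> {t i..t (Suc i)}"
        then have "dist x (t i) < \<delta>2" using h by (simp add: step dist_real_def)
        then show "norm (\<rho> x - \<rho> (t i)) \<le> \<eta>" using \<delta>2(2)[of "t i" x] x sub tin[of i] i by (force simp: dist_norm)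
      qed (use h ci in \<open>auto simp: step intro!: continuous_intros\<close>)
      moreover have "integral {t i..t (Suc i)} (\<lambda>x. \<rho> x - \<rho> (t i)) = integral {t i..t (Suc i)} \<rho> - \<rho> (t i) * h"
        using h integrable_continuous_interval[OF ci] by (subst integral_diff) (auto simp: step)
      ultimately have "\<bar>integral {t i..t (Suc i)} \<rho> - \<rho> (t i) * h\<bar> \<le> \<eta> * h" by (simp add: step)
      with 1 show ?thesis by linarith
    qed
    have comb: "(\<Sum>i<m. integral {t i..t (Suc i)} \<rho>) = integral {c..t m} \<rho>" if "m \<le> 2 ^ n" for m
      using that
    proof (induction m)
      case 0
      show ?case unfolding t_def by simp
    next
      case (Suc m)
      have "\<rho> integrable_on {c..t (Suc m)}"
        using tin[OF Suc.prems] by (intro integrable_continuous_interval continuous_on_subset[OF cont]) auto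
      then have "integral {c..t m} \<rho> + integral {t m..t (Suc m)} \<rho> = integral {c..t (Suc m)} \<rho>"
        using tin[of m] Suc.prems h by (intro Henstock_Kurzweil_Integration.integral_combine) (auto simp: step)
      then show ?case using Suc by simp
    qed
    have "dyadic_sum c d \<Psi> n - integral {c..d} \<rho> = (\<Sum>i<2 ^ n. \<Psi> (t i) (t (Suc i)) - integral {t i..t (Suc i)} \<rho>)"
      unfolding sum_subtractf comb[OF order_refl] unfolding dyadic_sum_def t_def by simp
    also have "norm \<dots> \<le> (\<Sum>i<(2::nat) ^ n. 2 * \<eta> * h)" using piece by (intro sum_norm_le) auto
    also have "\<dots> = 2 * \<eta> * (d - c)" unfolding h_def by simp
    also have "\<dots> < e"
    proof -
      have "2 * \<eta> * (d - c) = 2 / 3 * e" unfolding \<eta>_def using cd by (simp add: divide_simps)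
      then show ?thesis using e by linarith
    qed
    finally show "norm (dyadic_sum c d \<Psi> n - integral {c..d} \<rho>) < e" .
  qed
qed

lemma dyadic_sum_Suc:
  "dyadic_sum c d \<Psi> (Suc n) = (\<Sum>i<2 ^ n. \<Psi> (dyadic_point c d n i) (dyadic_point c d (Suc n) (2 * i + 1))
     + \<Psi> (dyadic_point c d (Suc n) (2 * i + 1)) (dyadic_point c d n (Suc i)))"
proof -
  have double: "(\<Sum>i<2 * m. f i) = (\<Sum>i<m. f (2 * i) + f (2 * i + 1))" for f :: "nat \<Rightarrow> real" and m
    by (induction m) auto
  have "dyadic_point c d (Suc n) (2 * i) = dyadic_point c d n i" for i
    unfolding dyadic_point_def by (simp add: field_simps)
  from this this[of "Suc _"] show ?thesis unfolding dyadic_sum_def power_Suc double by simp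
qed

text \<open>Young's estimate: passing from level \<open>n\<close> to \<open>n + 1\<close> changes the sum by at most a constant times
  \<open>2 powr (n * (1 - (\<alpha> + \<beta>)))\<close>.\<close>

lemma young_dyadic_sum:
  assumes cd: "c < d" and \<alpha>: "0 \<le> \<alpha>" and \<beta>: "0 \<le> \<beta>" and \<alpha>\<beta>: "1 < \<alpha> + \<beta>" and H: "0 \<le> H" and P: "0 \<le> P"
    and h: "\<And>s t. s \<in> {c..d} \<Longrightarrow> t \<in> {c..d} \<Longrightarrow> \<bar>h s - h t\<bar> \<le> H * \<bar>s - t\<bar> powr \<alpha>"
    and p: "\<And>s t. s \<in> {c..d} \<Longrightarrow> t \<in> {c..d} \<Longrightarrow> \<bar>p s - p t\<bar> \<le> P * \<bar>s - t\<bar> powr \<beta>"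
  defines "S \<equiv> dyadic_sum c d (\<lambda>s t. h s * (p t - p s))"
  shows "convergent S"
    and "\<bar>lim S\<bar> \<le> (\<bar>h c\<bar> * (d - c) powr \<beta> + H * (d - c) powr (\<alpha> + \<beta>) / (1 - 2 powr (1 - (\<alpha> + \<beta>)))) * P"
proof -
  define \<rho> :: real where "\<rho> = 2 powr (1 - (\<alpha> + \<beta>))"
  have \<rho>: "0 \<le> \<rho>" "\<rho> < 1" unfolding \<rho>_def using \<alpha>\<beta> by (auto simp: powr_less_one)
  define C where "C = H * P * (d - c) powr (\<alpha> + \<beta>)"
  have step: "\<bar>S (Suc n) - S n\<bar> \<le> C * \<rho> ^ n" for n
  proof -
    define m where "m i = dyadic_point c d (Suc n) (2 * i + 1)" for i
    define l where "l i = dyadic_point c d n i" for i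
    define z where "z = (d - c) / 2 ^ Suc n"
    have ml: "m i - l i = z" "l (Suc i) - m i = z" for i
      unfolding m_def l_def z_def dyadic_point_def by (simp_all add: field_simps)
    have z: "0 < z" using cd unfolding z_def by simp
    \<comment> \<open>Inserting the midpoint changes \<open>h\<close> only on the right half of each
      cell. The defect is a product of two increments, so the Hoelder exponents add up.\<close>
    have "S (Suc n) - S n = (\<Sum>i<2 ^ n. (h (m i) - h (l i)) * (p (l (Suc i)) - p (m i)))"
      unfolding S_def dyadic_sum_Suc unfolding dyadic_sum_def m_def[symmetric] l_def[symmetric] sum_subtractf[symmetric]
      by (intro sum.cong) (auto simp: algebra_simps)
    also have "norm \<dots> \<le> (\<Sum>i<(2::nat) ^ n. H * P * z powr (\<alpha> + \<beta>))"
    proof (rule sum_norm_le)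
      fix i :: nat assume "i \<in> {..<2 ^ n}"
      then have i: "i < 2 ^ n" by simp
      have mem: "m i \<in> {c..d}" "l i \<in> {c..d}" "l (Suc i) \<in> {c..d}"
        unfolding m_def l_def using i by (intro dyadic_point_in cd; simp)+
      have "\<bar>h (m i) - h (l i)\<bar> \<le> H * z powr \<alpha>" using h[OF mem(1,2)] ml z by simp
      moreover have "\<bar>p (l (Suc i)) - p (m i)\<bar> \<le> P * z powr \<beta>" using p[OF mem(3,1)] ml z by simp
      ultimately have "\<bar>h (m i) - h (l i)\<bar> * \<bar>p (l (Suc i)) - p (m i)\<bar> \<le> (H * z powr \<alpha>) * (P * z powr \<beta>)"
        using H by (intro mult_mono) auto
      then show "norm ((h (m i) - h (l i)) * (p (l (Suc i)) - p (m i))) \<le> H * P * z powr (\<alpha> + \<beta>)"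
        by (simp add: abs_mult powr_add mult_ac)
    qed
    also have "\<dots> = H * P * (2 ^ n * z powr (\<alpha> + \<beta>))" by simp
    also have "\<dots> \<le> H * P * ((d - c) powr (\<alpha> + \<beta>) * \<rho> ^ n)"
    proof -
      have "z powr (\<alpha> + \<beta>) = (d - c) powr (\<alpha> + \<beta>) * (1 / 2 ^ Suc n) powr (\<alpha> + \<beta>)"
        unfolding z_def using cd by (simp add: powr_divide)
      \<comment> \<open>The half-cell length is enlarged to the full cell, so that the 2^n terms
        produce exactly \<rho>^n.\<close>
      also have "\<dots> \<le> (d - c) powr (\<alpha> + \<beta>) * (1 / 2 ^ n) powr (\<alpha> + \<beta>)"
        using \<alpha>\<beta> by (intro mult_left_mono powr_mono2) (auto simp: field_simps)
      also have "(1 / 2 ^ n :: real) powr (\<alpha> + \<beta>) = 2 powr (- real n * (\<alpha> + \<beta>))"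
        by (simp add: powr_powr powr_minus_divide powr_realpow[symmetric] powr_divide)
      finally have "2 ^ n * z powr (\<alpha> + \<beta>) \<le> 2 powr (real n) * ((d - c) powr (\<alpha> + \<beta>) * 2 powr (- real n * (\<alpha> + \<beta>)))"
        by (simp add: powr_realpow)
      also have "\<dots> = (d - c) powr (\<alpha> + \<beta>) * 2 powr (real n + (- real n * (\<alpha> + \<beta>)))"
        by (simp only: powr_add mult.left_commute)
      also have "real n + (- real n * (\<alpha> + \<beta>)) = (1 - (\<alpha> + \<beta>)) * real n" by (simp add: algebra_simps)
      also have "2 powr ((1 - (\<alpha> + \<beta>)) * real n) = \<rho> ^ n"
        unfolding \<rho>_def by (simp add: powr_powr[symmetric] powr_realpow)
      finally show ?thesis using H P by (intro mult_left_mono) auto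
    qed
    finally show ?thesis unfolding C_def by (simp add: mult_ac)
  qed
  show "convergent S" using geometric_steps(1)[OF step \<rho>] .
  have "\<bar>lim S - S 0\<bar> \<le> C / (1 - \<rho>)" using geometric_steps(2)[OF step \<rho>] .
  moreover have "\<bar>S 0\<bar> \<le> \<bar>h c\<bar> * (P * (d - c) powr \<beta>)"
  proof -
    have "S 0 = h c * (p d - p c)" unfolding S_def dyadic_sum_def dyadic_point_def by simp
    then show ?thesis using p[of d c] cd by (simp add: abs_mult mult_left_mono)
  qed
  ultimately have "\<bar>lim S\<bar> \<le> \<bar>h c\<bar> * (P * (d - c) powr \<beta>) + C / (1 - \<rho>)" by linarith
  \<comment> \<open>Factoring out \<open>P\<close> exhibits the continuity of the limit in
    \<open>p\<close>, on which the passage from C1 approximations rests.\<close>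
  also have "\<dots> = (\<bar>h c\<bar> * (d - c) powr \<beta> + H * (d - c) powr (\<alpha> + \<beta>) / (1 - \<rho>)) * P"
    unfolding C_def by (simp add: algebra_simps)
  finally show "\<bar>lim S\<bar> \<le> (\<bar>h c\<bar> * (d - c) powr \<beta> + H * (d - c) powr (\<alpha> + \<beta>) / (1 - 2 powr (1 - (\<alpha> + \<beta>)))) * P"
    unfolding \<rho>_def .
qed

section \<open>Hoelder functions on bounded sets and C1 functions on intervals\<close>

lemma holder_onE:
  assumes "holder_on \<alpha> S f"
  obtains C where "0 \<le> C" "\<And>x y. x \<in> S \<Longrightarrow> y \<in> S \<Longrightarrow> norm (f x - f y) \<le> C * dist x y powr \<alpha>"
proof -
  obtain C where C: "\<forall>x\<in>S. \<forall>y\<in>S. norm (f x - f y) \<le> C * dist x y powr \<alpha>"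
    using assms unfolding holder_on_def by (rule exE)
  show ?thesis
  proof (rule that[of "max C 0"])
    fix x y assume "x \<in> S" "y \<in> S"
    then have "norm (f x - f y) \<le> C * dist x y powr \<alpha>" using C by simp
    also have "\<dots> \<le> max C 0 * dist x y powr \<alpha>" by (intro mult_right_mono) auto
    finally show "norm (f x - f y) \<le> max C 0 * dist x y powr \<alpha>" .
  qed simp
qed

lemma holder_onI:
  "(\<And>x y. x \<in> S \<Longrightarrow> y \<in> S \<Longrightarrow> norm (f x - f y) \<le> C * dist x y powr \<alpha>) \<Longrightarrow> holder_on \<alpha> S f"
  unfolding holder_on_def by (rule exI[of _ C]) simp

lemma holder_on_bounded:
  assumes "holder_on \<alpha> S f" "0 \<le> \<alpha>" "bounded S"
  obtains B where "0 \<le> B" "\<And>x. x \<in> S \<Longrightarrow> norm (f x) \<le> B"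
proof (cases "S = {}")
  case False
  then obtain x0 where x0: "x0 \<in> S" by blast
  obtain C where C: "0 \<le> C" "\<And>x y. x \<in> S \<Longrightarrow> y \<in> S \<Longrightarrow> norm (f x - f y) \<le> C * dist x y powr \<alpha>"
    using holder_onE[OF assms(1)] by blast
  obtain R where R: "\<And>x. x \<in> S \<Longrightarrow> dist x x0 \<le> R"
    using bounded_any_center[of S x0, THEN iffD1, OF assms(3)] by (metis dist_commute)
  show ?thesis
  proof (rule that[of "norm (f x0) + C * R powr \<alpha>"])
    fix x assume x: "x \<in> S"
    have "norm (f x) \<le> norm (f x0) + norm (f x - f x0)" using norm_triangle_sub[of "f x" "f x0"] .
    also have "norm (f x - f x0) \<le> C * dist x x0 powr \<alpha>" using C x x0 by blast
    also have "\<dots> \<le> C * R powr \<alpha>" using C R[OF x] assms(2) by (intro mult_left_mono powr_mono2) auto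
    finally show "norm (f x) \<le> norm (f x0) + C * R powr \<alpha>" by simp
  qed (use C in auto)
qed (use that[of 0] in auto)

lemma holder_on_imp_continuous_on:
  assumes f: "holder_on \<alpha> S f" and \<alpha>: "0 < \<alpha>"
  shows "continuous_on S f"
  unfolding continuous_on_def
proof
  fix x assume x: "x \<in> S"
  obtain C where C: "0 \<le> C" "\<And>x y. x \<in> S \<Longrightarrow> y \<in> S \<Longrightarrow> norm (f x - f y) \<le> C * dist x y powr \<alpha>"
    using holder_onE[OF f] by blast
  have "((\<lambda>y. C * dist y x powr \<alpha>) \<longlongrightarrow> C * dist x x powr \<alpha>) (at x within S)"
    using \<alpha> by (intro tendsto_intros) auto
  then have "((\<lambda>y. C * dist y x powr \<alpha>) \<longlongrightarrow> 0) (at x within S)" by simp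
  moreover have "\<forall>\<^sub>F y in at x within S. norm (f y - f x) \<le> C * dist y x powr \<alpha>"
    unfolding eventually_at_filter using C(2)[OF _ x] by (intro always_eventually) simp
  ultimately have "((\<lambda>y. f y - f x) \<longlongrightarrow> 0) (at x within S)" by (rule Lim_null_comparison[rotated])
  then show "(f \<longlongrightarrow> f x) (at x within S)" by (simp add: LIM_zero_iff)
qed

lemma holder_on_add:
  assumes "holder_on \<alpha> S f" "holder_on \<alpha> S g"
  shows "holder_on \<alpha> S (\<lambda>x. f x + g x)"
proof -
  obtain C where C: "0 \<le> C" "\<And>x y. x \<in> S \<Longrightarrow> y \<in> S \<Longrightarrow> norm (f x - f y) \<le> C * dist x y powr \<alpha>"
    using holder_onE[OF assms(1)] by blast
  obtain D where D: "0 \<le> D" "\<And>x y. x \<in> S \<Longrightarrow> y \<in> S \<Longrightarrow> norm (g x - g y) \<le> D * dist x y powr \<alpha>"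
    using holder_onE[OF assms(2)] by blast
  show ?thesis
  proof (rule holder_onI)
    fix x y assume xy: "x \<in> S" "y \<in> S"
    have "norm ((f x + g x) - (f y + g y)) \<le> norm (f x - f y) + norm (g x - g y)"
      by (rule norm_diff_triangle_ineq)
    then show "norm ((f x + g x) - (f y + g y)) \<le> (C + D) * dist x y powr \<alpha>"
      using C(2)[OF xy] D(2)[OF xy] by (simp add: distrib_right)
  qed
qed

lemma holder_on_sum:
  assumes "finite F" "\<And>i. i \<in> F \<Longrightarrow> holder_on \<alpha> S (f i)"
  shows "holder_on \<alpha> S (\<lambda>x. \<Sum>i\<in>F. f i x)"
  using assms
proof (induction F rule: finite_induct)
  case empty
  show ?case by (rule holder_onI[of _ _ 0]) simp
next
  case (insert i F)
  then show ?case by (simp add: holder_on_add)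
qed

lemma holder_on_scaleR:
  assumes f: "holder_on \<alpha> S f" and g: "holder_on \<alpha> S g" and "0 \<le> \<alpha>" "bounded S"
  shows "holder_on \<alpha> S (\<lambda>x. f x *\<^sub>R g x)"
proof -
  obtain C where C: "0 \<le> C" "\<And>x y. x \<in> S \<Longrightarrow> y \<in> S \<Longrightarrow> norm (f x - f y) \<le> C * dist x y powr \<alpha>"
    using holder_onE[OF f] by blast
  obtain D where D: "0 \<le> D" "\<And>x y. x \<in> S \<Longrightarrow> y \<in> S \<Longrightarrow> norm (g x - g y) \<le> D * dist x y powr \<alpha>"
    using holder_onE[OF g] by blast
  obtain B where B: "0 \<le> B" "\<And>x. x \<in> S \<Longrightarrow> norm (f x) \<le> B" using holder_on_bounded[OF f assms(3,4)] by blast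
  obtain E where E: "0 \<le> E" "\<And>x. x \<in> S \<Longrightarrow> norm (g x) \<le> E" using holder_on_bounded[OF g assms(3,4)] by blast
  show ?thesis
  proof (rule holder_onI)
    fix x y assume xy: "x \<in> S" "y \<in> S"
    have "f x *\<^sub>R g x - f y *\<^sub>R g y = (f x - f y) *\<^sub>R g x + f y *\<^sub>R (g x - g y)" by (simp add: algebra_simps)
    then have "norm (f x *\<^sub>R g x - f y *\<^sub>R g y) \<le> norm (f x - f y) * norm (g x) + norm (f y) * norm (g x - g y)"
      using norm_triangle_ineq[of "(f x - f y) *\<^sub>R g x" "f y *\<^sub>R (g x - g y)"] by simp
    also have "\<dots> \<le> (C * dist x y powr \<alpha>) * E + B * (D * dist x y powr \<alpha>)"
      using C D B E xy by (intro add_mono mult_mono) auto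
    finally show "norm (f x *\<^sub>R g x - f y *\<^sub>R g y) \<le> (C * E + B * D) * dist x y powr \<alpha>"
      by (simp add: algebra_simps)
  qed
qed

lemma powr_interpolate:
  fixes x R :: real
  assumes "0 \<le> x" "x \<le> R" "\<beta> \<le> \<alpha>"
  shows "x powr \<alpha> \<le> R powr (\<alpha> - \<beta>) * x powr \<beta>"
proof -
  have "x powr \<alpha> = x powr (\<alpha> - \<beta>) * x powr \<beta>" by (simp add: powr_add[symmetric])
  also have "\<dots> \<le> R powr (\<alpha> - \<beta>) * x powr \<beta>" using assms by (intro mult_right_mono powr_mono2) auto
  finally show ?thesis .
qed

lemma holder_on_exponent_mono:
  assumes "holder_on \<alpha> S f" "\<beta> \<le> \<alpha>" "bounded S"
  shows "holder_on \<beta> S f"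
proof -
  obtain C where C: "0 \<le> C" "\<And>x y. x \<in> S \<Longrightarrow> y \<in> S \<Longrightarrow> norm (f x - f y) \<le> C * dist x y powr \<alpha>"
    using holder_onE[OF assms(1)] by blast
  obtain R where R: "\<And>x y. x \<in> S \<Longrightarrow> y \<in> S \<Longrightarrow> dist x y \<le> R"
    using bounded_two_points[THEN iffD1, OF assms(3)] by blast
  show ?thesis
  proof (rule holder_onI)
    fix x y assume xy: "x \<in> S" "y \<in> S"
    have "norm (f x - f y) \<le> C * dist x y powr \<alpha>" using C xy by blast
    also have "\<dots> \<le> C * (R powr (\<alpha> - \<beta>) * dist x y powr \<beta>)"
      using C R[OF xy] assms(2) by (intro mult_left_mono powr_interpolate) auto
    finally show "norm (f x - f y) \<le> (C * R powr (\<alpha> - \<beta>)) * dist x y powr \<beta>" by (simp add: mult.assoc)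
  qed
qed

lemma holder_on_C1:
  fixes f :: "real \<Rightarrow> real"
  assumes der: "\<And>t. t \<in> {c..d} \<Longrightarrow> (f has_real_derivative f' t) (at t within {c..d})"
    and cont: "continuous_on {c..d} f'" and \<alpha>: "\<alpha> \<le> 1"
  shows "holder_on \<alpha> {c..d} f"
proof -
  have "bounded (f' ` {c..d})" by (intro compact_imp_bounded compact_continuous_image cont) simp
  then obtain B where "\<forall>x\<in>f' ` {c..d}. norm x \<le> B" unfolding bounded_iff by blast
  then have B: "norm (f' t) \<le> B" if "t \<in> {c..d}" for t using that by blast
  have "holder_on 1 {c..d} f"
  proof (rule holder_onI)
    fix x y assume "x \<in> {c..d}" "y \<in> {c..d}"
    then have "norm (f x - f y) \<le> B * norm (x - y)"
      by (intro field_differentiable_bound[OF convex_real_interval(5) der B])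
    then show "norm (f x - f y) \<le> B * dist x y powr 1" by (simp add: dist_norm)
  qed
  then show ?thesis by (rule holder_on_exponent_mono) (use \<alpha> in auto)
qed

lemma deriv_in_eqI:
  fixes f :: "real \<Rightarrow> 'b::euclidean_space"
  assumes "c < d" "t \<in> {c..d}" "(f has_vector_derivative f') (at t within {c..d})"
  shows "deriv_in {c..d} f t = f'"
  unfolding deriv_in_def using assms by (rule vector_derivative_within_closed_interval)

lemma C1_path_on_has_vector_derivative:
  assumes "C1_path_on T f" "t \<in> T"
  shows "(f has_vector_derivative deriv_in T f t) (at t within T)"
  using assms unfolding C1_path_on_def deriv_in_def differentiable_on_def by (simp add: vector_derivative_works[symmetric])

lemma C1_path_on_has_real_derivative:
  assumes "C1_path_on T f" "t \<in> T"
  shows "(f has_real_derivative deriv_in T f t) (at t within T)"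
  using C1_path_on_has_vector_derivative[OF assms] unfolding has_real_derivative_iff_has_vector_derivative .

lemma C1_path_onI:
  fixes f :: "real \<Rightarrow> real"
  assumes cd: "c < d" and der: "\<And>t. t \<in> {c..d} \<Longrightarrow> (f has_real_derivative f' t) (at t within {c..d})"
    and cont: "continuous_on {c..d} f'"
  shows "C1_path_on {c..d} f"
proof -
  have "deriv_in {c..d} f t = f' t" if "t \<in> {c..d}" for t
    using der[OF that] by (intro deriv_in_eqI cd that) (simp add: has_real_derivative_iff_has_vector_derivative)
  then have "continuous_on {c..d} (deriv_in {c..d} f)" using cont continuous_on_cong by (metis (no_types, lifting))
  moreover have "f differentiable (at t within {c..d})" if "t \<in> {c..d}" for t
    using der[OF that, unfolded has_real_derivative_iff_has_vector_derivative] by (rule differentiableI_vector)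
  ultimately show ?thesis unfolding C1_path_on_def differentiable_on_def by blast
qed

text \<open>A real supremum bounds its members only if the set is bounded above; Hoelder continuity
  on the compact interval provides this for both parts of the norm. The sup part is nonnegative, so
  the full norm bounds the seminorm.\<close>

lemma holder_norm_bounds:
  fixes f :: "real \<Rightarrow> real"
  assumes cd: "c < d" and \<beta>: "0 \<le> \<beta>" and f: "holder_on \<beta> {c..d} f"
  shows "0 \<le> holder_norm \<beta> {c..d} f"
    and "s \<in> {c..d} \<Longrightarrow> t \<in> {c..d} \<Longrightarrow> \<bar>f s - f t\<bar> \<le> holder_norm \<beta> {c..d} f * \<bar>s - t\<bar> powr \<beta>"
proof -
  let ?P = "{(s, t). s \<in> {c..d} \<and> t \<in> {c..d} \<and> s \<noteq> t}"
  let ?g = "\<lambda>(s, t). \<bar>f s - f t\<bar> / \<bar>s - t\<bar> powr \<beta>"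
  obtain B where B: "\<And>x. x \<in> {c..d} \<Longrightarrow> norm (f x) \<le> B" using holder_on_bounded[OF f \<beta>] by auto
  obtain C where C: "0 \<le> C" "\<And>x y. x \<in> {c..d} \<Longrightarrow> y \<in> {c..d} \<Longrightarrow> norm (f x - f y) \<le> C * dist x y powr \<beta>"
    using holder_onE[OF f] by blast
  have bdd1: "bdd_above ((\<lambda>t. \<bar>f t\<bar>) ` {c..d})" using B by (intro bdd_aboveI2[of _ _ B]) auto
  have bdd2: "bdd_above (?g ` ?P)"
  proof (rule bdd_aboveI2[of _ _ C])
    fix st assume "st \<in> ?P"
    then obtain s t where st: "st = (s, t)" "s \<in> {c..d}" "t \<in> {c..d}" "s \<noteq> t" by auto
    then show "?g st \<le> C" using C(2)[OF st(2,3)] by (simp add: divide_le_eq dist_real_def)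
  qed
  have 1: "0 \<le> (SUP t\<in>{c..d}. \<bar>f t\<bar>)" using cd by (intro cSUP_upper2[OF bdd1, of c]) auto
  have le: "\<bar>f s - f t\<bar> / \<bar>s - t\<bar> powr \<beta> \<le> (SUP st\<in>?P. ?g st)" if "s \<in> {c..d}" "t \<in> {c..d}" "s \<noteq> t" for s t
    using cSUP_upper[OF _ bdd2, of "(s, t)"] that by auto
  have 2: "0 \<le> (SUP st\<in>?P. ?g st)" by (rule order_trans[OF _ le[of c d]]) (use cd in auto)
  show "0 \<le> holder_norm \<beta> {c..d} f" unfolding holder_norm_def using 1 2 by simp
  show "\<bar>f s - f t\<bar> \<le> holder_norm \<beta> {c..d} f * \<bar>s - t\<bar> powr \<beta>" if st: "s \<in> {c..d}" "t \<in> {c..d}"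
  proof (cases "s = t")
    case False
    have "\<bar>f s - f t\<bar> / \<bar>s - t\<bar> powr \<beta> \<le> holder_norm \<beta> {c..d} f"
      unfolding holder_norm_def using le[OF st False] 1 by simp
    then show ?thesis using False by (simp add: divide_le_eq)
  qed simp
qed

lemma holder_norm_le:
  assumes cd: "c < d" and B: "\<And>t. t \<in> {c..d} \<Longrightarrow> \<bar>f t\<bar> \<le> B"
    and C: "\<And>s t. s \<in> {c..d} \<Longrightarrow> t \<in> {c..d} \<Longrightarrow> \<bar>f s - f t\<bar> \<le> C * \<bar>s - t\<bar> powr \<beta>"
  shows "holder_norm \<beta> {c..d} f \<le> B + C"
  unfolding holder_norm_def
proof (intro add_mono cSUP_least)
  have "(c, d) \<in> {(s, t). s \<in> {c..d} \<and> t \<in> {c..d} \<and> s \<noteq> t}" using cd by simp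
  then show "{(s, t). s \<in> {c..d} \<and> t \<in> {c..d} \<and> s \<noteq> t} \<noteq> {}" by blast
  fix st assume "st \<in> {(s, t). s \<in> {c..d} \<and> t \<in> {c..d} \<and> s \<noteq> t}"
  then show "(case st of (s, t) \<Rightarrow> \<bar>f s - f t\<bar> / \<bar>s - t\<bar> powr \<beta>) \<le> C"
    using C by (auto simp: divide_le_eq)
qed (use cd B in auto)

text \<open>Steklov averages \<open>1/\<epsilon> \<integral>\<^sub>t\<^sup>t\<^sup>+\<^sup>\<epsilon> p\<close> of the extension of \<open>p\<close> that is constant outside the interval.\<close>

lemma holder_C1_approximation:
  fixes p :: "real \<Rightarrow> real"
  assumes cd: "c < d" and \<beta>: "0 \<le> \<beta>" "\<beta> < \<alpha>" and p: "holder_on \<alpha> {c..d} p"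
  obtains q where "\<And>k. C1_path_on {c..d} (q k)" "holder_converges \<beta> {c..d} q p"
proof -
  obtain K where K: "0 \<le> K" "\<And>x y. x \<in> {c..d} \<Longrightarrow> y \<in> {c..d} \<Longrightarrow> norm (p x - p y) \<le> K * dist x y powr \<alpha>"
    using holder_onE[OF p] by blast
  \<comment> \<open>Clamping to the interval is 1-Lipschitz, so the extension keeps the Hoelder
    constant \<open>K\<close>.\<close>
  define cl where "cl t = min d (max c t)" for t
  define P where "P t = p (cl t)" for t
  have cl: "cl t \<in> {c..d}" "\<bar>cl s - cl t\<bar> \<le> \<bar>s - t\<bar>" for s t using cd unfolding cl_def by auto
  have PK: "\<bar>P s - P t\<bar> \<le> K * \<bar>s - t\<bar> powr \<alpha>" for s t
  proof -
    have "\<bar>P s - P t\<bar> \<le> K * \<bar>cl s - cl t\<bar> powr \<alpha>" using K(2)[OF cl(1)[of s] cl(1)[of t]] unfolding P_def by (simp add: dist_real_def)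
    also have "\<dots> \<le> K * \<bar>s - t\<bar> powr \<alpha>" using cl K \<beta> by (intro mult_left_mono powr_mono2) auto
    finally show ?thesis .
  qed
  have Pp: "P t = p t" if "t \<in> {c..d}" for t using that unfolding P_def cl_def by simp
  have "holder_on \<alpha> UNIV P" using PK by (intro holder_onI[where C = K]) (simp add: dist_real_def)
  then have Pcont: "continuous_on UNIV P" using \<beta> by (intro holder_on_imp_continuous_on[of \<alpha>]) auto
  \<comment> \<open>Starting left of \<open>c\<close> makes every point of [c, d + 1] interior to
    the domain of integration, so derivatives are two-sided; \<epsilon> k \<le> 1 keeps t +
    \<epsilon> k in that range.\<close>
  define \<Phi> where "\<Phi> x = integral {c - 1..x} P" for x
  have \<Phi>: "(\<Phi> has_real_derivative P x) (at x)" if "c \<le> x" "x \<le> d + 1" for x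
  proof -
    have "(\<Phi> has_real_derivative P x) (at x within {c - 1..d + 2})"
      unfolding \<Phi>_def using that by (intro integral_has_real_derivative continuous_on_subset[OF Pcont]) auto
    then show ?thesis using that by (simp add: at_within_Icc_at)
  qed
  define \<epsilon> where "\<epsilon> k = 1 / real (Suc k)" for k
  have \<epsilon>: "0 < \<epsilon> k" "\<epsilon> k \<le> 1" for k unfolding \<epsilon>_def by auto
  define q where "q k t = (\<Phi> (t + \<epsilon> k) - \<Phi> t) / \<epsilon> k" for k t
  have q_mult: "q k t * \<epsilon> k = \<Phi> (t + \<epsilon> k) - \<Phi> t" for k t unfolding q_def using \<epsilon>(1)[of k] by simp
  have d\<Phi>: "((\<lambda>\<tau>. \<Phi> (s + \<tau>)) has_real_derivative P (s + \<tau>)) (at \<tau> within A)" if "c \<le> s + \<tau>" "s + \<tau> \<le> d + 1" for s \<tau> A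
  proof -
    have "((\<lambda>\<tau>. s + \<tau>) has_real_derivative 1) (at \<tau> within A)" by (auto intro!: derivative_eq_intros)
    from DERIV_chain2[where f = \<Phi> and g = "\<lambda>\<tau>. s + \<tau>", OF \<Phi>[OF that] this] show ?thesis by simp
  qed
  have C1: "C1_path_on {c..d} (q k)" for k
  proof (rule C1_path_onI[OF cd])
    fix t assume t: "t \<in> {c..d}"
    show "(q k has_real_derivative (P (t + \<epsilon> k) - P t) / \<epsilon> k) (at t within {c..d})"
      unfolding q_def using d\<Phi>[of "\<epsilon> k" t] d\<Phi>[of 0 t] t \<epsilon>[of k]
      by (auto intro!: derivative_eq_intros simp: add.commute)
  next
    show "continuous_on {c..d} (\<lambda>t. (P (t + \<epsilon> k) - P t) / \<epsilon> k)"
      using \<epsilon>(1)[of k] by (intro continuous_intros continuous_on_compose2[OF Pcont]) auto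
  qed
  have near: "\<bar>q k t - p t\<bar> \<le> K * \<epsilon> k powr \<alpha>" if t: "t \<in> {c..d}" for k t
  proof -
    have "norm ((\<Phi> (t + \<epsilon> k) - P t * \<epsilon> k) - (\<Phi> (t + 0) - P t * 0)) \<le> K * \<epsilon> k powr \<alpha> * norm (\<epsilon> k - 0)"
    proof (rule field_differentiable_bound[where S = "{0..\<epsilon> k}" and f = "\<lambda>\<tau>. \<Phi> (t + \<tau>) - P t * \<tau>"])
      fix \<tau> assume \<tau>: "\<tau> \<in> {0..\<epsilon> k}"
      show "((\<lambda>\<tau>. \<Phi> (t + \<tau>) - P t * \<tau>) has_field_derivative P (t + \<tau>) - P t) (at \<tau> within {0..\<epsilon> k})"
        using t \<tau> \<epsilon>[of k] by (auto intro!: derivative_eq_intros d\<Phi>)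
      have "\<bar>P (t + \<tau>) - P t\<bar> \<le> K * \<tau> powr \<alpha>" using PK[of "t + \<tau>" t] \<tau> by simp
      also have "\<dots> \<le> K * \<epsilon> k powr \<alpha>" using \<tau> K \<beta> by (intro mult_left_mono powr_mono2) auto
      finally show "norm (P (t + \<tau>) - P t) \<le> K * \<epsilon> k powr \<alpha>" by simp
    qed (use \<epsilon>[of k] in auto)
    moreover have "(q k t - p t) * \<epsilon> k = \<Phi> (t + \<epsilon> k) - \<Phi> t - P t * \<epsilon> k"
      by (simp only: left_diff_distrib q_mult Pp[OF t])
    moreover have "\<bar>q k t - p t\<bar> * \<epsilon> k = \<bar>(q k t - p t) * \<epsilon> k\<bar>" using \<epsilon>(1)[of k] by (simp add: abs_mult)
    ultimately have "\<bar>q k t - p t\<bar> * \<epsilon> k \<le> (K * \<epsilon> k powr \<alpha>) * \<epsilon> k" using \<epsilon>(1)[of k] by simp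
    then show ?thesis using \<epsilon>(1)[of k] by (rule mult_right_le_imp_le)
  qed
  \<comment> \<open>An average of translates inherits the Hoelder constant, uniformly in k.\<close>
  have qK: "\<bar>q k s - q k t\<bar> \<le> K * \<bar>s - t\<bar> powr \<alpha>" if s: "s \<in> {c..d}" and t: "t \<in> {c..d}" for k s t
  proof -
    have "norm ((\<Phi> (s + \<epsilon> k) - \<Phi> (t + \<epsilon> k)) - (\<Phi> (s + 0) - \<Phi> (t + 0))) \<le> K * \<bar>s - t\<bar> powr \<alpha> * norm (\<epsilon> k - 0)"
    proof (rule field_differentiable_bound[where S = "{0..\<epsilon> k}" and f = "\<lambda>\<tau>. \<Phi> (s + \<tau>) - \<Phi> (t + \<tau>)"])
      fix \<tau> assume \<tau>: "\<tau> \<in> {0..\<epsilon> k}"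
      show "((\<lambda>\<tau>. \<Phi> (s + \<tau>) - \<Phi> (t + \<tau>)) has_field_derivative P (s + \<tau>) - P (t + \<tau>)) (at \<tau> within {0..\<epsilon> k})"
        using s t \<tau> \<epsilon>[of k] by (auto intro!: derivative_eq_intros d\<Phi>)
      show "norm (P (s + \<tau>) - P (t + \<tau>)) \<le> K * \<bar>s - t\<bar> powr \<alpha>" using PK[of "s + \<tau>" "t + \<tau>"] by simp
    qed (use \<epsilon>[of k] in auto)
    moreover have "(q k s - q k t) * \<epsilon> k = (\<Phi> (s + \<epsilon> k) - \<Phi> (t + \<epsilon> k)) - (\<Phi> (s + 0) - \<Phi> (t + 0))"
      by (simp add: left_diff_distrib q_mult)
    moreover have "\<bar>q k s - q k t\<bar> * \<epsilon> k = \<bar>(q k s - q k t) * \<epsilon> k\<bar>" using \<epsilon>(1)[of k] by (simp add: abs_mult)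
    ultimately have "\<bar>q k s - q k t\<bar> * \<epsilon> k \<le> (K * \<bar>s - t\<bar> powr \<alpha>) * \<epsilon> k" using \<epsilon>(1)[of k] by simp
    then show ?thesis using \<epsilon>(1)[of k] by (rule mult_right_le_imp_le)
  qed
  \<comment> \<open>Below the averaging scale the Hoelder bounds of \<open>q k\<close> and
    \<open>p\<close> are used, above it their uniform closeness. Both give the small factor with
    exponent \<alpha> - \<beta>, which is why convergence is claimed only in a weaker Hoelder
    space.\<close>
  have diff: "\<bar>(q k s - p s) - (q k t - p t)\<bar> \<le> (2 * K * \<epsilon> k powr (\<alpha> - \<beta>)) * \<bar>s - t\<bar> powr \<beta>"
    if s: "s \<in> {c..d}" and t: "t \<in> {c..d}" for k s t
  proof (cases "\<bar>s - t\<bar> \<le> \<epsilon> k")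
    case True
    have "\<bar>(q k s - p s) - (q k t - p t)\<bar> \<le> 2 * K * \<bar>s - t\<bar> powr \<alpha>"
      using qK[OF s t, of k] K(2)[OF s t] by (simp add: dist_real_def abs_le_iff)
    also have "\<dots> \<le> 2 * K * (\<epsilon> k powr (\<alpha> - \<beta>) * \<bar>s - t\<bar> powr \<beta>)"
      using K True \<beta> by (intro mult_left_mono powr_interpolate) auto
    finally show ?thesis by (simp add: mult.assoc)
  next
    case False
    have "\<bar>(q k s - p s) - (q k t - p t)\<bar> \<le> 2 * K * \<epsilon> k powr \<alpha>"
      using near[OF s, of k] near[OF t, of k] by (simp add: abs_le_iff)
    also have "\<dots> = 2 * K * (\<epsilon> k powr (\<alpha> - \<beta>) * \<epsilon> k powr \<beta>)" by (simp add: powr_add[symmetric])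
    also have "\<dots> \<le> 2 * K * (\<epsilon> k powr (\<alpha> - \<beta>) * \<bar>s - t\<bar> powr \<beta>)"
      using K False \<beta> \<epsilon>(1)[of k] by (intro mult_left_mono powr_mono2) auto
    finally show ?thesis by (simp add: mult.assoc)
  qed
  have hold: "holder_on \<beta> {c..d} (\<lambda>t. q k t - p t)" for k
    using diff[of _ _ k] by (intro holder_onI[where C = "2 * K * \<epsilon> k powr (\<alpha> - \<beta>)"]) (simp add: dist_real_def)
  have "(\<lambda>k. holder_norm \<beta> {c..d} (\<lambda>t. q k t - p t)) \<longlonglongrightarrow> 0"
  proof (rule tendsto_sandwich[of "\<lambda>_. 0" _ _ "\<lambda>k. K * \<epsilon> k powr \<alpha> + 2 * K * \<epsilon> k powr (\<alpha> - \<beta>)"])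
    have "\<epsilon> \<longlonglongrightarrow> 0" unfolding \<epsilon>_def using LIMSEQ_inverse_real_of_nat by (simp add: inverse_eq_divide)
    then have "(\<lambda>k. K * \<epsilon> k powr \<alpha> + 2 * K * \<epsilon> k powr (\<alpha> - \<beta>)) \<longlonglongrightarrow> K * 0 + 2 * K * 0"
      using \<beta> \<epsilon>(1) by (intro tendsto_intros tendsto_zero_powrI[where b = \<alpha>] tendsto_zero_powrI[where b = "\<alpha> - \<beta>"])
        (auto simp: less_imp_le)
    then show "(\<lambda>k. K * \<epsilon> k powr \<alpha> + 2 * K * \<epsilon> k powr (\<alpha> - \<beta>)) \<longlonglongrightarrow> 0" by simp
  qed (use holder_norm_bounds(1)[OF cd \<beta>(1) hold] holder_norm_le[OF cd near diff] in auto)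
  with C1 hold show ?thesis by (intro that[of q]) (auto simp: holder_converges_def)
qed

text \<open>For a C1 function \<open>q k\<close> the dyadic sums tend to the integral. The error
  made by replacing \<open>q k\<close> with \<open>p\<close> is bounded by Young's estimate,
  linearly in the C^\<beta> norm of the difference; it applies as \<alpha> and \<beta> exceed 1/2.
  Hence all admissible sequences share the limit of the dyadic sums of \<open>p\<close>.\<close>

lemma holder_product_eq_lim:
  assumes cd: "c < d" and \<alpha>: "1 / 2 < \<alpha>" "\<alpha> < 1"
    and f: "holder_on \<alpha> {c..d} f" and p: "holder_on \<alpha> {c..d} p" and \<phi>: "C1_path_on {c..d} \<phi>"
  defines "S \<equiv> dyadic_sum c d (\<lambda>s t. f s * \<phi> s * (p t - p s))"
  shows "S \<longlonglongrightarrow> holder_product \<alpha> {c..d} f p \<phi>"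
proof -
  define h where "h t = f t * \<phi> t" for t
  have \<phi>h: "holder_on \<alpha> {c..d} \<phi>"
    using \<phi> \<alpha> by (intro holder_on_C1[where f' = "deriv_in {c..d} \<phi>"] C1_path_on_has_real_derivative) (auto simp: C1_path_on_def)
  have hh: "holder_on \<alpha> {c..d} h" unfolding h_def
    using holder_on_scaleR[OF f \<phi>h] \<alpha> by simp
  then obtain H where H: "0 \<le> H" "\<And>s t. s \<in> {c..d} \<Longrightarrow> t \<in> {c..d} \<Longrightarrow> \<bar>h s - h t\<bar> \<le> H * \<bar>s - t\<bar> powr \<alpha>"
    by (elim holder_onE) (auto simp: dist_real_def)
  have hcont: "continuous_on {c..d} h" using hh \<alpha> by (intro holder_on_imp_continuous_on) auto
  obtain B where B: "0 \<le> B" "\<And>t. t \<in> {c..d} \<Longrightarrow> norm (h t) \<le> B" using holder_on_bounded[OF hh] \<alpha> by auto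
  have S: "S = dyadic_sum c d (\<lambda>s t. h s * (p t - p s))" unfolding S_def h_def ..
  obtain K where K: "0 \<le> K" "\<And>s t. s \<in> {c..d} \<Longrightarrow> t \<in> {c..d} \<Longrightarrow> \<bar>p s - p t\<bar> \<le> K * \<bar>s - t\<bar> powr \<alpha>"
    using p by (elim holder_onE) (auto simp: dist_real_def)
  have conv: "convergent S" unfolding S using \<alpha> by (intro young_dyadic_sum(1)[OF cd _ _ _ H(1) K(1) H(2) K(2)]) auto
  have limit: "(\<lambda>k. integral {c..d} (\<lambda>t. f t * deriv_in {c..d} (q k) t * \<phi> t)) \<longlonglongrightarrow> lim S"
    if \<beta>: "1 / 2 < \<beta>" "\<beta> < \<alpha>" and q: "\<And>k. C1_path_on {c..d} (q k)" and qp: "holder_converges \<beta> {c..d} q p" for \<beta> q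
  proof -
    define C where "C = \<bar>h c\<bar> * (d - c) powr \<beta> + H * (d - c) powr (\<alpha> + \<beta>) / (1 - 2 powr (1 - (\<alpha> + \<beta>)))"
    let ?N = "\<lambda>k. holder_norm \<beta> {c..d} (\<lambda>t. q k t - p t)"
    have hold: "holder_on \<beta> {c..d} (\<lambda>t. q k t - p t)" and N0: "?N \<longlonglongrightarrow> 0" for k
      using qp unfolding holder_converges_def by auto
    have bound: "norm (integral {c..d} (\<lambda>t. f t * deriv_in {c..d} (q k) t * \<phi> t) - lim S) \<le> C * ?N k" for k
    proof -
      let ?D = "dyadic_sum c d (\<lambda>s t. h s * ((q k t - p t) - (q k s - p s)))"
      have dq: "continuous_on {c..d} (deriv_in {c..d} (q k))" using q unfolding C1_path_on_def by blast
      have "dyadic_sum c d (\<lambda>s t. h s * (q k t - q k s)) \<longlonglongrightarrow> integral {c..d} (\<lambda>s. h s * deriv_in {c..d} (q k) s)"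
        using B by (intro dyadic_sum_tendsto_integral cd first_order_scale[where B = B] first_order_derivative
            C1_path_on_has_real_derivative q dq continuous_on_mult hcont) auto
      moreover have "S \<longlonglongrightarrow> lim S" using conv by (simp add: convergent_LIMSEQ_iff)
      ultimately have "(\<lambda>n. dyadic_sum c d (\<lambda>s t. h s * (q k t - q k s)) n - S n) \<longlonglongrightarrow>
          integral {c..d} (\<lambda>s. h s * deriv_in {c..d} (q k) s) - lim S" by (rule tendsto_diff)
      moreover have "(\<lambda>n. dyadic_sum c d (\<lambda>s t. h s * (q k t - q k s)) n - S n) = ?D"
        unfolding S dyadic_sum_def sum_subtractf[symmetric] by (intro ext sum.cong) (auto simp: algebra_simps)
      ultimately have "lim ?D = integral {c..d} (\<lambda>s. h s * deriv_in {c..d} (q k) s) - lim S" by (simp add: limI)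
      moreover have "\<bar>lim ?D\<bar> \<le> C * ?N k"
        unfolding C_def using \<alpha> \<beta> hold
        by (intro young_dyadic_sum(2)[OF cd _ _ _ H(1) _ H(2)] holder_norm_bounds[OF cd]) auto
      ultimately show ?thesis unfolding h_def by (simp add: mult_ac)
    qed
    have "(\<lambda>k. C * ?N k) \<longlonglongrightarrow> 0" by (rule tendsto_mult_right_zero[OF N0])
    then have "(\<lambda>k. integral {c..d} (\<lambda>t. f t * deriv_in {c..d} (q k) t * \<phi> t) - lim S) \<longlonglongrightarrow> 0"
      by (rule Lim_null_comparison[rotated]) (intro always_eventually allI bound)
    then show ?thesis by (simp add: LIM_zero_iff)
  qed
  have "holder_product \<alpha> {c..d} f p \<phi> = lim S"
    unfolding holder_product_def
  proof (rule the_equality)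
    fix L assume L: "\<forall>\<beta> q. 1 / 2 < \<beta> \<and> \<beta> < \<alpha> \<and> (\<forall>k. C1_path_on {c..d} (q k)) \<and> holder_converges \<beta> {c..d} q p \<longrightarrow>
      (\<lambda>k. integral {c..d} (\<lambda>t. f t * deriv_in {c..d} (q k) t * \<phi> t)) \<longlonglongrightarrow> L"
    \<comment> \<open>The description after \<open>THE\<close> is universally quantified over
      sequences, so uniqueness of \<open>L\<close> requires that an admissible one exists: some
      exponent strictly between 1/2 and \<alpha>, and the averages for it.\<close>
    define \<beta> where "\<beta> = (1 / 2 + \<alpha>) / 2"
    have \<beta>: "1 / 2 < \<beta>" "\<beta> < \<alpha>" "0 \<le> \<beta>" using \<alpha> unfolding \<beta>_def by auto
    obtain q where q: "\<And>k. C1_path_on {c..d} (q k)" "holder_converges \<beta> {c..d} q p"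
      using holder_C1_approximation[OF cd \<beta>(3) \<beta>(2) p] by blast
    have "(\<lambda>k. integral {c..d} (\<lambda>t. f t * deriv_in {c..d} (q k) t * \<phi> t)) \<longlonglongrightarrow> L"
      using L[rule_format, of \<beta> q] \<beta> q by simp
    then show "L = lim S" using limit[OF \<beta>(1,2) q] by (rule LIMSEQ_unique)
  qed (use limit in blast)
  then show ?thesis using conv by (simp add: convergent_LIMSEQ_iff)
qed

section \<open>The identity along a curve\<close>

text \<open>Lebesgue number of the cover by open sets on which \<open>Q\<close> holds for all
  pairs.\<close>

lemma compact_local_to_uniform:
  fixes S :: "'a::metric_space set"
  assumes S: "compact S"
    and loc: "\<And>x. x \<in> S \<Longrightarrow> \<exists>\<delta>>0. \<forall>s\<in>S. \<forall>t\<in>S. dist s x < \<delta> \<longrightarrow> dist t x < \<delta> \<longrightarrow> Q s t"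
  shows "\<exists>\<delta>>0. \<forall>s\<in>S. \<forall>t\<in>S. dist s t < \<delta> \<longrightarrow> Q s t"
proof -
  define \<G> where "\<G> = {G. open G \<and> (\<forall>s\<in>S \<inter> G. \<forall>t\<in>S \<inter> G. Q s t)}"
  have "S \<subseteq> \<Union>\<G>"
  proof
    fix x assume x: "x \<in> S"
    from loc[OF x] obtain \<delta> where \<delta>: "0 < \<delta>" "\<forall>s\<in>S. \<forall>t\<in>S. dist s x < \<delta> \<longrightarrow> dist t x < \<delta> \<longrightarrow> Q s t" by blast
    then have "ball x \<delta> \<in> \<G>" unfolding \<G>_def by (simp add: dist_commute)
    then show "x \<in> \<Union>\<G>" using \<delta>(1) by (meson UnionI centre_in_ball)
  qed
  moreover have "open G" if "G \<in> \<G>" for G using that unfolding \<G>_def by simp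
  ultimately obtain \<epsilon> where \<epsilon>: "0 < \<epsilon>" "\<And>x. x \<in> S \<Longrightarrow> \<exists>G\<in>\<G>. ball x \<epsilon> \<subseteq> G"
    using Heine_Borel_lemma[OF S] by metis
  show ?thesis
  proof (intro exI[of _ \<epsilon>] conjI ballI impI \<epsilon>(1))
    fix s t assume st: "s \<in> S" "t \<in> S" "dist s t < \<epsilon>"
    obtain G where G: "G \<in> \<G>" "ball s \<epsilon> \<subseteq> G" using \<epsilon>(2)[OF st(1)] by blast
    have "s \<in> ball s \<epsilon>" "t \<in> ball s \<epsilon>" using st \<epsilon>(1) by auto
    then show "Q s t" using G st unfolding \<G>_def by blast
  qed
qed

text \<open>Close pairs lie in a common neighbourhood and obey the sum of finitely many local
  constants. Pairs at distance at least \<delta> are handled by boundedness, at the price of the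
  constant 2 |B| / \<delta>^\<alpha>.\<close>

lemma holder_on_compact_local:
  fixes S :: "'a::metric_space set"
  assumes S: "compact S" and \<alpha>: "0 < \<alpha>" and cont: "continuous_on S f"
    and loc: "\<And>x. x \<in> S \<Longrightarrow> \<exists>N. open N \<and> x \<in> N \<and> holder_on \<alpha> (S \<inter> N) f"
  shows "holder_on \<alpha> S f"
proof -
  define \<G> where "\<G> = {N. open N \<and> holder_on \<alpha> (S \<inter> N) f}"
  have "S \<subseteq> \<Union>\<G>" using loc unfolding \<G>_def by blast
  moreover have "open G" if "G \<in> \<G>" for G using that unfolding \<G>_def by simp
  ultimately obtain \<F> where \<F>: "\<F> \<subseteq> \<G>" "finite \<F>" "S \<subseteq> \<Union>\<F>" by (rule compactE[OF S])
  define C where "C G = (SOME C. \<forall>x\<in>S \<inter> G. \<forall>y\<in>S \<inter> G. norm (f x - f y) \<le> C * dist x y powr \<alpha>)" for G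
  have C: "\<forall>x\<in>S \<inter> G. \<forall>y\<in>S \<inter> G. norm (f x - f y) \<le> C G * dist x y powr \<alpha>" if "G \<in> \<F>" for G
  proof -
    have "holder_on \<alpha> (S \<inter> G) f" using that \<F>(1) unfolding \<G>_def by blast
    then show ?thesis unfolding C_def holder_on_def by (rule someI_ex)
  qed
  define K where "K = (\<Sum>G\<in>\<F>. \<bar>C G\<bar>)"
  have K0: "0 \<le> K" unfolding K_def by (simp add: sum_nonneg)
  have K: "C G \<le> K" if "G \<in> \<F>" for G
    unfolding K_def using member_le_sum[of G \<F> "\<lambda>G. \<bar>C G\<bar>"] that \<F>(2) by simp
  have "\<exists>\<delta>>0. \<forall>s\<in>S. \<forall>t\<in>S. dist s t < \<delta> \<longrightarrow> norm (f s - f t) \<le> K * dist s t powr \<alpha>"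
  proof (rule compact_local_to_uniform[OF S])
    fix x assume "x \<in> S"
    then obtain G where G: "G \<in> \<F>" "x \<in> G" using \<F>(3) by blast
    then have "open G" using \<F>(1) unfolding \<G>_def by blast
    then obtain \<delta> where \<delta>: "0 < \<delta>" "ball x \<delta> \<subseteq> G" using G(2) by (rule openE)
    show "\<exists>\<delta>>0. \<forall>s\<in>S. \<forall>t\<in>S. dist s x < \<delta> \<longrightarrow> dist t x < \<delta> \<longrightarrow> norm (f s - f t) \<le> K * dist s t powr \<alpha>"
    proof (intro exI[of _ \<delta>] conjI ballI impI \<delta>(1))
      fix s t assume st: "s \<in> S" "t \<in> S" "dist s x < \<delta>" "dist t x < \<delta>"
      then have "s \<in> S \<inter> G" "t \<in> S \<inter> G" using \<delta>(2) by (auto simp: subset_iff dist_commute)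
      then have "norm (f s - f t) \<le> C G * dist s t powr \<alpha>" using C[OF G(1)] by simp
      also have "\<dots> \<le> K * dist s t powr \<alpha>" by (intro mult_right_mono K G) simp
      finally show "norm (f s - f t) \<le> K * dist s t powr \<alpha>" .
    qed
  qed
  then obtain \<delta> where \<delta>: "0 < \<delta>" "\<forall>s\<in>S. \<forall>t\<in>S. dist s t < \<delta> \<longrightarrow> norm (f s - f t) \<le> K * dist s t powr \<alpha>"
    by blast
  have "bounded (f ` S)" by (intro compact_imp_bounded compact_continuous_image cont S)
  then obtain B where "\<forall>y\<in>f ` S. norm y \<le> B" unfolding bounded_iff by blast
  then have B: "norm (f x) \<le> B" if "x \<in> S" for x using that by blast
  define D where "D = 2 * \<bar>B\<bar> / \<delta> powr \<alpha>"
  have D: "0 \<le> D" unfolding D_def by simp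
  show ?thesis
  proof (rule holder_onI)
    fix x y assume xy: "x \<in> S" "y \<in> S"
    have "norm (f x - f y) \<le> max K D * dist x y powr \<alpha>"
    proof (cases "dist x y < \<delta>")
      case True
      then have "norm (f x - f y) \<le> K * dist x y powr \<alpha>" using \<delta>(2) xy by blast
      also have "\<dots> \<le> max K D * dist x y powr \<alpha>" by (intro mult_right_mono) auto
      finally show ?thesis .
    next
      case False
      have "norm (f x - f y) \<le> 2 * \<bar>B\<bar>"
        using norm_triangle_ineq4[of "f x" "f y"] B[OF xy(1)] B[OF xy(2)] by linarith
      also have "\<dots> = D * \<delta> powr \<alpha>" unfolding D_def using \<delta>(1) by simp
      also have "\<dots> \<le> max K D * dist x y powr \<alpha>"
        using False \<delta>(1) \<alpha> D by (intro mult_mono powr_mono2) auto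
      finally show ?thesis .
    qed
    then show "norm (f x - f y) \<le> max K D * dist x y powr \<alpha>" .
  qed
qed

lemma lipschitz_path:
  fixes x :: "real \<Rightarrow> 'b::real_normed_vector"
  assumes der: "\<And>t. t \<in> {c..d} \<Longrightarrow> (x has_vector_derivative x' t) (at t within {c..d})"
    and cont: "continuous_on {c..d} x'"
  obtains L where "0 < L" "\<And>s t. s \<in> {c..d} \<Longrightarrow> t \<in> {c..d} \<Longrightarrow> norm (x s - x t) \<le> L * \<bar>s - t\<bar>"
proof -
  have "bounded (x' ` {c..d})" by (intro compact_imp_bounded compact_continuous_image cont) simp
  then obtain B where "\<forall>y\<in>x' ` {c..d}. norm y \<le> B" unfolding bounded_iff by blast
  then have B: "norm (x' t) \<le> \<bar>B\<bar> + 1" if "t \<in> {c..d}" for t using that by force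
  show ?thesis
  proof (rule that[of "\<bar>B\<bar> + 1"])
    fix s t assume "s \<in> {c..d}" "t \<in> {c..d}"
    then have "norm (x s - x t) \<le> (\<bar>B\<bar> + 1) * norm (s - t)"
    proof (intro differentiable_bound[OF convex_real_interval(5)])
      fix \<tau> assume \<tau>: "\<tau> \<in> {c..d}"
      show "(x has_derivative (\<lambda>h. h *\<^sub>R x' \<tau>)) (at \<tau> within {c..d})"
        using der[OF \<tau>] unfolding has_vector_derivative_def .
      show "onorm (\<lambda>h. h *\<^sub>R x' \<tau>) \<le> \<bar>B\<bar> + 1"
      proof (rule onorm_le)
        fix h :: real
        show "norm (h *\<^sub>R x' \<tau>) \<le> (\<bar>B\<bar> + 1) * norm h"
          using mult_right_mono[OF B[OF \<tau>], of "\<bar>h\<bar>"] by (simp add: mult.commute)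
      qed
    qed
    then show "norm (x s - x t) \<le> (\<bar>B\<bar> + 1) * \<bar>s - t\<bar>" by simp
  qed simp
qed

lemma has_real_derivative_component:
  fixes x :: "real \<Rightarrow> real^'n"
  assumes "(x has_vector_derivative x') F"
  shows "((\<lambda>t. x t $ i) has_real_derivative x' $ i) F"
  unfolding has_real_derivative_iff_has_vector_derivative
  by (rule bounded_linear.has_vector_derivative[OF bounded_linear_vec_nth assms])

text \<open>The whole situation in one chart: \<open>v\<close> is the immersion, \<open>G\<close>
  the metric, \<open>x\<close> the curve and \<open>w\<close> the components of the field, with
  their derivatives within [c, d] as parameters.\<close>

locale isometric_coordinates =
  fixes V :: "(real^'n) set" and v :: "real^'n \<Rightarrow> real^'m" and G :: "'n \<Rightarrow> 'n \<Rightarrow> real^'n \<Rightarrow> real"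
    and \<alpha> c d :: real and x x' w w' :: "real \<Rightarrow> real^'n"
  assumes V: "C2_domain V" and v: "C1_on V v" and \<alpha>: "1 / 2 < \<alpha>" "\<alpha> < 1"
    and holder: "\<And>i p. p \<in> V \<Longrightarrow> \<exists>N. open N \<and> p \<in> N \<and> holder_on \<alpha> (V \<inter> N) (partial_deriv V v i)"
    and G: "\<And>i j. C1_on V (G i j)"
    and iso: "\<And>i j y. y \<in> V \<Longrightarrow> partial_deriv V v i y \<bullet> partial_deriv V v j y = G i j y"
    and cd: "c < d" and xV: "\<And>t. t \<in> {c..d} \<Longrightarrow> x t \<in> V"
    and dx: "\<And>t. t \<in> {c..d} \<Longrightarrow> (x has_vector_derivative x' t) (at t within {c..d})"
    and cx': "continuous_on {c..d} x'"
    and dw: "\<And>t. t \<in> {c..d} \<Longrightarrow> (w has_vector_derivative w' t) (at t within {c..d})"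
    and cw': "continuous_on {c..d} w'"
begin

definition du :: "'n \<Rightarrow> real \<Rightarrow> real^'m" where "du i t = partial_deriv V v i (x t)"

lemma cont_x: "continuous_on {c..d} x"
  using dx has_vector_derivative_continuous continuous_on_eq_continuous_within by blast

lemma cont_comp: "continuous_on V f \<Longrightarrow> continuous_on {c..d} (\<lambda>t. f (x t))"
  using continuous_on_compose2[OF _ cont_x] xV by blast

lemma cont_du: "continuous_on {c..d} (du i)"
  unfolding du_def using v unfolding C1_on_def by (intro cont_comp) blast

lemma cont_christoffel: "continuous_on {c..d} (\<lambda>t. christoffel_lowered V G k i l (x t))"
  using G unfolding C1_on_def christoffel_lowered_def
  by (intro continuous_intros cont_comp) auto

lemma bounded_on: "continuous_on {c..d} f \<Longrightarrow> \<exists>B. \<forall>t\<in>{c..d}. \<bar>f t :: real\<bar> \<le> B"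
  using compact_imp_bounded[OF compact_continuous_image, of "{c..d}" f] unfolding bounded_iff by force

text \<open>The curve is Lipschitz, so composition keeps the exponent. Local Hoelder neighbourhoods
  in the chart are pulled back to the parameter interval, where compactness makes the bound
  global.\<close>

lemma holder_du: "holder_on \<alpha> {c..d} (du i)"
proof (rule holder_on_compact_local[OF _ _ cont_du])
  obtain L where L: "0 < L" "\<And>s t. s \<in> {c..d} \<Longrightarrow> t \<in> {c..d} \<Longrightarrow> norm (x s - x t) \<le> L * \<bar>s - t\<bar>"
    using lipschitz_path[OF dx cx'] by blast
  fix t assume t: "t \<in> {c..d}"
  obtain N where N: "open N" "x t \<in> N" "holder_on \<alpha> (V \<inter> N) (partial_deriv V v i)"
    using holder[OF xV[OF t], of i] by (elim exE conjE)
  obtain C where C: "0 \<le> C" "\<And>y z. y \<in> V \<inter> N \<Longrightarrow> z \<in> V \<inter> N \<Longrightarrow>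
      norm (partial_deriv V v i y - partial_deriv V v i z) \<le> C * dist y z powr \<alpha>"
    using holder_onE[OF N(3)] by blast
  obtain T where T: "open T" "T \<inter> {c..d} = x -` N \<inter> {c..d}"
    using cont_x N(1) unfolding continuous_on_open_invariant by blast
  have "holder_on \<alpha> ({c..d} \<inter> T) (du i)"
  proof (rule holder_onI)
    fix s r assume "s \<in> {c..d} \<inter> T" "r \<in> {c..d} \<inter> T"
    then have "s \<in> x -` N \<inter> {c..d}" "r \<in> x -` N \<inter> {c..d}" unfolding T(2)[symmetric] by auto
    then have sr: "s \<in> {c..d}" "r \<in> {c..d}" "x s \<in> V \<inter> N" "x r \<in> V \<inter> N" using xV by auto
    have "norm (du i s - du i r) \<le> C * dist (x s) (x r) powr \<alpha>" unfolding du_def using C(2) sr by blast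
    also have "\<dots> \<le> C * (L * \<bar>s - r\<bar>) powr \<alpha>"
      using L(2)[OF sr(1,2)] C \<alpha> by (intro mult_left_mono powr_mono2) (auto simp: dist_norm)
    also have "\<dots> = (C * L powr \<alpha>) * dist s r powr \<alpha>" using L(1) by (simp add: powr_mult dist_real_def)
    finally show "norm (du i s - du i r) \<le> (C * L powr \<alpha>) * dist s r powr \<alpha>" .
  qed
  moreover have "t \<in> T" using T(2) N(2) t by blast
  ultimately show "\<exists>T. open T \<and> t \<in> T \<and> holder_on \<alpha> ({c..d} \<inter> T) (du i)" using T(1) by blast
qed (use \<alpha> in auto)

lemma holder_pushforward: "holder_on \<alpha> {c..d} (\<lambda>t. \<Sum>i\<in>UNIV. (w t $ i) *\<^sub>R du i t)"
proof (intro holder_on_sum holder_on_scaleR holder_du)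
  fix i
  show "holder_on \<alpha> {c..d} (\<lambda>t. w t $ i)"
    using \<alpha> by (intro holder_on_C1[where f' = "\<lambda>t. w' t $ i"] has_real_derivative_component dw continuous_intros cw') auto
qed (use \<alpha> in auto)

text \<open>\<open>partial_deriv_increment\<close> at the points x s and x t, made uniform on [c, d]
  by compactness; its accuracy is \<eta> / L because distances on the curve are at most
  \<open>L\<close> times parameter distances. The chord x t - x s is then replaced by its linear
  part, as the Christoffel factor is taken at s.\<close>

lemma first_order_du:
  "first_order {c..d} (\<lambda>s t. (du i t - du i s) \<bullet> du l s) (\<lambda>s. \<Sum>k\<in>UNIV. x' s $ k * christoffel_lowered V G k i l (x s))"
proof -
  let ?\<Gamma> = "\<lambda>k s. christoffel_lowered V G k i l (x s)"
  obtain L where L: "0 < L" "\<And>s t. s \<in> {c..d} \<Longrightarrow> t \<in> {c..d} \<Longrightarrow> norm (x s - x t) \<le> L * \<bar>s - t\<bar>"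
    using lipschitz_path[OF dx cx'] by blast
  have "first_order {c..d} (\<lambda>s t. (du i t - du i s) \<bullet> du l s - (\<Sum>k\<in>UNIV. (x t - x s) $ k * ?\<Gamma> k s)) (\<lambda>_. 0)"
    unfolding first_order_def
  proof (intro allI impI)
    fix \<eta> :: real assume \<eta>: "0 < \<eta>"
    let ?Q = "\<lambda>s t. \<bar>(du i t - du i s) \<bullet> du l s - (\<Sum>k\<in>UNIV. (x t - x s) $ k * ?\<Gamma> k s)\<bar> \<le> \<eta> / L * norm (x t - x s)"
    have \<eta>L: "0 < \<eta> / L" using \<eta> L(1) by simp
    have "\<exists>\<delta>>0. \<forall>s\<in>{c..d}. \<forall>t\<in>{c..d}. dist s t < \<delta> \<longrightarrow> ?Q s t"
    proof (rule compact_local_to_uniform)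
      fix r assume r: "r \<in> {c..d}"
      have h: "\<forall>i. \<exists>N. open N \<and> x r \<in> N \<and> holder_on \<alpha> (V \<inter> N) (partial_deriv V v i)" using holder[OF xV[OF r]] by blast
      obtain \<delta>0 where \<delta>0: "0 < \<delta>0"
        "\<And>p q i l. p \<in> V \<Longrightarrow> q \<in> V \<Longrightarrow> dist p (x r) < \<delta>0 \<Longrightarrow> dist q (x r) < \<delta>0 \<Longrightarrow>
          \<bar>(partial_deriv V v i q - partial_deriv V v i p) \<bullet> partial_deriv V v l p
            - (\<Sum>k\<in>UNIV. (q - p) $ k * christoffel_lowered V G k i l p)\<bar> \<le> \<eta> / L * norm (q - p)"
        using partial_deriv_increment[OF V v \<alpha>(1) h G iso xV[OF r] \<eta>L] by blast
      show "\<exists>\<delta>>0. \<forall>s\<in>{c..d}. \<forall>t\<in>{c..d}. dist s r < \<delta> \<longrightarrow> dist t r < \<delta> \<longrightarrow> ?Q s t"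
      proof (intro exI[of _ "\<delta>0 / L"] conjI ballI impI)
        have near: "dist (x s) (x r) < \<delta>0" if "s \<in> {c..d}" "dist s r < \<delta>0 / L" for s
        proof -
          have "L * \<bar>s - r\<bar> < \<delta>0" using that(2) L(1) by (simp add: dist_real_def field_simps)
          then show ?thesis using L(2)[OF that(1) r] by (simp add: dist_norm)
        qed
        fix s t assume "s \<in> {c..d}" "t \<in> {c..d}" "dist s r < \<delta>0 / L" "dist t r < \<delta>0 / L"
        then show "?Q s t" unfolding du_def by (intro \<delta>0(2) xV near)
      qed (use \<delta>0 L in auto)
    qed auto
    then obtain \<delta> where \<delta>: "0 < \<delta>" "\<forall>s\<in>{c..d}. \<forall>t\<in>{c..d}. dist s t < \<delta> \<longrightarrow> ?Q s t" by blast
    show "\<exists>\<delta>>0. \<forall>s\<in>{c..d}. \<forall>t\<in>{c..d}. \<bar>t - s\<bar> < \<delta> \<longrightarrow>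
       \<bar>(du i t - du i s) \<bullet> du l s - (\<Sum>k\<in>UNIV. (x t - x s) $ k * ?\<Gamma> k s) - 0 * (t - s)\<bar> \<le> \<eta> * \<bar>t - s\<bar>"
    proof (intro exI[of _ \<delta>] conjI ballI impI \<delta>(1))
      fix s t assume st: "s \<in> {c..d}" "t \<in> {c..d}" "\<bar>t - s\<bar> < \<delta>"
      have "?Q s t" using st by (intro \<delta>(2)[rule_format]) (auto simp: dist_real_def)
      also have "\<eta> / L * norm (x t - x s) \<le> \<eta> / L * (L * \<bar>t - s\<bar>)"
        using L(2)[OF st(2,1)] \<eta>L by (intro mult_left_mono) auto
      finally show "\<bar>(du i t - du i s) \<bullet> du l s - (\<Sum>k\<in>UNIV. (x t - x s) $ k * ?\<Gamma> k s) - 0 * (t - s)\<bar> \<le> \<eta> * \<bar>t - s\<bar>"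
        using L(1) by simp
    qed
  qed
  moreover have "first_order {c..d} (\<lambda>s t. \<Sum>k\<in>UNIV. ?\<Gamma> k s * (x t $ k - x s $ k)) (\<lambda>s. \<Sum>k\<in>UNIV. ?\<Gamma> k s * x' s $ k)"
  proof (rule first_order_sum)
    fix k
    obtain B where B: "\<forall>t\<in>{c..d}. \<bar>?\<Gamma> k t\<bar> \<le> B" using bounded_on[OF cont_christoffel[of k i l]] by blast
    show "first_order {c..d} (\<lambda>s t. ?\<Gamma> k s * (x t $ k - x s $ k)) (\<lambda>s. ?\<Gamma> k s * x' s $ k)"
      using B by (intro first_order_scale[where B = B] first_order_derivative has_real_derivative_component dx
          continuous_intros cx') auto
  qed simp
  ultimately have "first_order {c..d}
      (\<lambda>s t. ((du i t - du i s) \<bullet> du l s - (\<Sum>k\<in>UNIV. (x t - x s) $ k * ?\<Gamma> k s)) + (\<Sum>k\<in>UNIV. ?\<Gamma> k s * (x t $ k - x s $ k)))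
      (\<lambda>s. 0 + (\<Sum>k\<in>UNIV. ?\<Gamma> k s * x' s $ k))"
    by (rule first_order_add)
  then show ?thesis by (simp add: mult.commute)
qed

text \<open>The right-hand side of the identity after the metric has lowered the index of the
  Christoffel symbols.\<close>

definition \<rho> :: "'n \<Rightarrow> real \<Rightarrow> real" where
  "\<rho> l s = (\<Sum>i\<in>UNIV. w' s $ i * G i l (x s)
     + w s $ i * (\<Sum>k\<in>UNIV. x' s $ k * christoffel_lowered V G k i l (x s)))"

lemma cont_w: "continuous_on {c..d} w"
  using dw has_vector_derivative_continuous continuous_on_eq_continuous_within by blast

lemma first_order_pushforward:
  "first_order {c..d} (\<lambda>s t. du l s \<bullet> ((\<Sum>i\<in>UNIV. (w t $ i) *\<^sub>R du i t) - (\<Sum>i\<in>UNIV. (w s $ i) *\<^sub>R du i s))) (\<lambda>s. \<Sum>i\<in>UNIV. w' s $ i * (du l s \<bullet> du i s)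
     + w s $ i * (\<Sum>k\<in>UNIV. x' s $ k * christoffel_lowered V G k i l (x s)))"
proof -
  have bA: "\<exists>B. \<forall>t\<in>{c..d}. norm (du i t) \<le> B" for i
    using bounded_on[OF continuous_on_norm[OF cont_du[of i]]] by simp
  have "first_order {c..d} (\<lambda>s t. (w t $ i - w s $ i) * (du l s \<bullet> du i t) + w s $ i * ((du i t - du i s) \<bullet> du l s))
     (\<lambda>s. w' s $ i * (du l s \<bullet> du i s) + w s $ i * (\<Sum>k\<in>UNIV. x' s $ k * christoffel_lowered V G k i l (x s)))" for i
  proof (rule first_order_add)
    obtain Bw where Bw: "\<forall>t\<in>{c..d}. \<bar>w t $ i\<bar> \<le> Bw" using bounded_on[of "\<lambda>t. w t $ i"] cont_w by (auto intro: continuous_intros)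
    then show "first_order {c..d} (\<lambda>s t. w s $ i * ((du i t - du i s) \<bullet> du l s))
       (\<lambda>s. w s $ i * (\<Sum>k\<in>UNIV. x' s $ k * christoffel_lowered V G k i l (x s)))"
      by (intro first_order_scale[OF first_order_du, where B = Bw]) auto
    obtain Bw' where Bw': "\<forall>t\<in>{c..d}. \<bar>w' t $ i\<bar> \<le> Bw'" using bounded_on[of "\<lambda>t. w' t $ i"] cw' by (auto intro: continuous_intros)
    obtain Bi where Bi: "\<forall>t\<in>{c..d}. norm (du i t) \<le> Bi" using bA[of i] by (elim exE)
    obtain Bl where Bl: "\<forall>t\<in>{c..d}. norm (du l t) \<le> Bl" using bA[of l] by (elim exE)
    have Bl0: "0 \<le> Bl" using Bl cd order_trans[OF norm_ge_zero] by (meson atLeastAtMost_iff less_imp_le order_refl)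
    show "first_order {c..d} (\<lambda>s t. (w t $ i - w s $ i) * (du l s \<bullet> du i t)) (\<lambda>s. w' s $ i * (du l s \<bullet> du i s))"
    proof (rule first_order_mult[where R = Bw' and B = "Bl * Bi"])
      show "first_order {c..d} (\<lambda>s t. w t $ i - w s $ i) (\<lambda>s. w' s $ i)"
        by (intro first_order_derivative has_real_derivative_component dw continuous_intros cw')
      show "\<bar>w' s $ i\<bar> \<le> Bw'" if "s \<in> {c..d}" for s using Bw' that by blast
      show "\<bar>du l s \<bullet> du i t\<bar> \<le> Bl * Bi" if "s \<in> {c..d}" "t \<in> {c..d}" for s t
        using Cauchy_Schwarz_ineq2[of "du l s" "du i t"] mult_mono[of "norm (du l s)" Bl "norm (du i t)" Bi] Bl Bi Bl0 that
        by force
      fix \<eta> :: real assume \<eta>: "0 < \<eta>"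
      have "uniformly_continuous_on {c..d} (du i)" by (intro compact_uniformly_continuous cont_du) simp
      moreover have "0 < \<eta> / (Bl + 1)" using \<eta> Bl0 by simp
      ultimately obtain \<delta> where \<delta>: "0 < \<delta>" "\<forall>s\<in>{c..d}. \<forall>t\<in>{c..d}. dist t s < \<delta> \<longrightarrow> dist (du i t) (du i s) < \<eta> / (Bl + 1)"
        unfolding uniformly_continuous_on_def by meson
      show "\<exists>\<delta>>0. \<forall>s\<in>{c..d}. \<forall>t\<in>{c..d}. \<bar>t - s\<bar> < \<delta> \<longrightarrow> \<bar>du l s \<bullet> du i t - du l s \<bullet> du i s\<bar> \<le> \<eta>"
      proof (intro exI[of _ \<delta>] conjI ballI impI \<delta>(1))
        fix s t assume st: "s \<in> {c..d}" "t \<in> {c..d}" "\<bar>t - s\<bar> < \<delta>"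
        have "\<bar>du l s \<bullet> du i t - du l s \<bullet> du i s\<bar> \<le> norm (du l s) * norm (du i t - du i s)"
          unfolding inner_diff_right[symmetric] by (rule Cauchy_Schwarz_ineq2)
        also have "\<dots> \<le> (Bl + 1) * (\<eta> / (Bl + 1))"
        proof (rule mult_mono)
          show "norm (du l s) \<le> Bl + 1" using Bl st(1) by force
          show "norm (du i t - du i s) \<le> \<eta> / (Bl + 1)" using \<delta>(2) st by (simp add: dist_norm less_imp_le)
        qed (use Bl0 in auto)
        also have "\<dots> = \<eta>" using Bl0 by simp
        finally show "\<bar>du l s \<bullet> du i t - du l s \<bullet> du i s\<bar> \<le> \<eta>" .
      qed
    qed
  qed
  then have "first_order {c..d} (\<lambda>s t. \<Sum>i\<in>UNIV. (w t $ i - w s $ i) * (du l s \<bullet> du i t) + w s $ i * ((du i t - du i s) \<bullet> du l s))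
     (\<lambda>s. \<Sum>i\<in>UNIV. w' s $ i * (du l s \<bullet> du i s) + w s $ i * (\<Sum>k\<in>UNIV. x' s $ k * christoffel_lowered V G k i l (x s)))"
    by (intro first_order_sum) auto
  moreover have "(\<Sum>i\<in>UNIV. (w t $ i - w s $ i) * (du l s \<bullet> du i t) + w s $ i * ((du i t - du i s) \<bullet> du l s)) =
      du l s \<bullet> ((\<Sum>i\<in>UNIV. (w t $ i) *\<^sub>R du i t) - (\<Sum>i\<in>UNIV. (w s $ i) *\<^sub>R du i s))" for s t
    unfolding sum_subtractf[symmetric] inner_sum_right
    by (intro sum.cong) (auto simp: inner_diff_right inner_diff_left inner_commute algebra_simps)
  ultimately show ?thesis by simp
qed

theorem inner_deriv_product_eq:
  assumes \<phi>: "C1_path_on {c..d} \<phi>"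
  shows "inner_deriv_product \<alpha> {c..d} (\<lambda>t. \<Sum>i\<in>UNIV. (w t $ i) *\<^sub>R du i t) (du l) \<phi> = integral {c..d} (\<lambda>t. \<rho> l t * \<phi> t)"
proof -
  define P where "P t = (\<Sum>i\<in>UNIV. (w t $ i) *\<^sub>R du i t)" for t
  have comp: "holder_on \<alpha> {c..d} (\<lambda>t. f t $ s)" if f: "holder_on \<alpha> {c..d} f" for f :: "real \<Rightarrow> real^'m" and s
  proof -
    obtain C where C: "0 \<le> C" "\<And>x y. x \<in> {c..d} \<Longrightarrow> y \<in> {c..d} \<Longrightarrow> norm (f x - f y) \<le> C * dist x y powr \<alpha>"
      using holder_onE[OF f] by blast
    show ?thesis
    proof (rule holder_onI)
      fix x y assume "x \<in> {c..d}" "y \<in> {c..d}"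
      then show "norm (f x $ s - f y $ s) \<le> C * dist x y powr \<alpha>"
        using component_le_norm_cart[of "f x - f y" s] C(2)[of x y] by simp
    qed
  qed
  have "(\<lambda>n. \<Sum>s\<in>UNIV. dyadic_sum c d (\<lambda>\<sigma> \<tau>. du l \<sigma> $ s * \<phi> \<sigma> * (P \<tau> $ s - P \<sigma> $ s)) n) \<longlonglongrightarrow>
      inner_deriv_product \<alpha> {c..d} P (du l) \<phi>"
    unfolding inner_deriv_product_def using holder_pushforward unfolding P_def[symmetric]
    by (intro tendsto_sum holder_product_eq_lim cd \<alpha> \<phi> comp holder_du)
  \<comment> \<open>A single component has no first-order expansion in general. Only after summation
    over \<open>s\<close>, at fixed level n, does the inner product appear to which
    \<open>first_order_pushforward\<close> applies.\<close>
  moreover have "(\<Sum>s\<in>UNIV. dyadic_sum c d (\<lambda>\<sigma> \<tau>. du l \<sigma> $ s * \<phi> \<sigma> * (P \<tau> $ s - P \<sigma> $ s)) n) =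
      dyadic_sum c d (\<lambda>\<sigma> \<tau>. \<phi> \<sigma> * (du l \<sigma> \<bullet> (P \<tau> - P \<sigma>))) n" for n
    unfolding dyadic_sum_def
    by (subst sum.swap) (simp add: inner_vec_def sum_distrib_left mult_ac)
  ultimately have lim: "dyadic_sum c d (\<lambda>\<sigma> \<tau>. \<phi> \<sigma> * (du l \<sigma> \<bullet> (P \<tau> - P \<sigma>))) \<longlonglongrightarrow>
      inner_deriv_product \<alpha> {c..d} P (du l) \<phi>" by simp
  let ?\<rho> = "\<lambda>s. \<Sum>i\<in>UNIV. w' s $ i * (du l s \<bullet> du i s) + w s $ i * (\<Sum>k\<in>UNIV. x' s $ k * christoffel_lowered V G k i l (x s))"
  have \<phi>c: "continuous_on {c..d} \<phi>"
    using \<phi> differentiable_imp_continuous_on unfolding C1_path_on_def by blast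
  obtain B where B: "\<forall>t\<in>{c..d}. \<bar>\<phi> t\<bar> \<le> B" using bounded_on[OF \<phi>c] by (elim exE)
  have "dyadic_sum c d (\<lambda>\<sigma> \<tau>. \<phi> \<sigma> * (du l \<sigma> \<bullet> (P \<tau> - P \<sigma>))) \<longlonglongrightarrow> integral {c..d} (\<lambda>s. \<phi> s * ?\<rho> s)"
  proof (rule dyadic_sum_tendsto_integral[OF cd])
    show "first_order {c..d} (\<lambda>\<sigma> \<tau>. \<phi> \<sigma> * (du l \<sigma> \<bullet> (P \<tau> - P \<sigma>))) (\<lambda>s. \<phi> s * ?\<rho> s)"
      unfolding P_def using B by (intro first_order_scale[OF first_order_pushforward, where B = B]) auto
    show "continuous_on {c..d} (\<lambda>s. \<phi> s * ?\<rho> s)"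
      by (intro continuous_intros \<phi>c cw' cont_w cx' cont_du cont_christoffel)
  qed
  with lim have "inner_deriv_product \<alpha> {c..d} P (du l) \<phi> = integral {c..d} (\<lambda>s. \<phi> s * ?\<rho> s)" by (rule LIMSEQ_unique)
  also have "\<dots> = integral {c..d} (\<lambda>t. \<rho> l t * \<phi> t)"
  proof (rule integral_cong)
    fix s assume "s \<in> {c..d}"
    then have "du l s \<bullet> du i s = G i l (x s)" for i
      unfolding du_def using iso[OF xV] by (subst inner_commute) simp
    then show "\<phi> s * ?\<rho> s = \<rho> l s * \<phi> s" unfolding \<rho>_def by simp
  qed
  finally show ?thesis unfolding P_def .
qed

end

text \<open>A vector in the kernel of the Gram matrix has image of length zero under the
  differential, which is injective.\<close>

lemma invertible_gram:
  fixes v :: "real^'n \<Rightarrow> 'b::real_inner"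
  assumes v: "C1_on V v" and y: "y \<in> V" and inj: "inj (frechet_derivative v (at y within V))"
    and iso: "\<And>i j. partial_deriv V v i y \<bullet> partial_deriv V v j y = G i j"
  shows "invertible (\<chi> p q. G p q)"
proof -
  let ?D = "frechet_derivative v (at y within V)"
  have l: "linear ?D" using C1_on_has_frechet_derivative[OF v y] by (rule has_derivative_linear)
  have "z = 0" if z: "(\<chi> p q. G p q) *v z = 0" for z :: "real^'n"
  proof -
    have "?D z \<bullet> ?D z = (\<Sum>p\<in>UNIV. z $ p * (\<Sum>q\<in>UNIV. G p q * z $ q))"
      unfolding frechet_derivative_eq_sum[OF v y] inner_sum_left inner_sum_right
      by (subst sum.swap) (simp add: iso sum_distrib_left mult_ac)
    also have "\<dots> = (\<Sum>p\<in>UNIV. z $ p * ((\<chi> p q. G p q) *v z) $ p)"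
      by (simp add: matrix_vector_mult_def)
    also have "\<dots> = 0" unfolding z by simp
    finally have "?D z = ?D 0" by (simp add: linear_0[OF l])
    then show "z = 0" using inj by (simp add: inj_def)
  qed
  then show ?thesis using matrix_left_invertible_ker invertible_left_inverse by blast
qed

text \<open>The symbols of the second kind arise by raising an index with the inverse metric;
  contracting with the metric undoes this.\<close>

lemma christoffel_contract_metric:
  fixes A :: "('a, 'n::finite) chart set" and g :: "('a, 'n) metric_tensor" and \<kappa> :: "('a, 'n) chart"
  defines "G \<equiv> metric_coeff A g \<kappa>"
  assumes y: "y \<in> chart_image \<kappa>" and inv: "invertible (\<chi> p q. G p q y)"
    and sym: "\<And>i j z. z \<in> chart_image \<kappa> \<Longrightarrow> G i j z = G j i z"
  shows "(\<Sum>i\<in>UNIV. christoffel A g \<kappa> i j k y * G i l y) = christoffel_lowered (chart_image \<kappa>) G j k l y"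
proof -
  let ?V = "chart_image \<kappa>"
  define M where "M = (\<chi> p q. G p q y)"
  define Q where "Q m = partial_deriv ?V (G m k) j y + partial_deriv ?V (G j m) k y - partial_deriv ?V (G j k) m y" for m
  \<comment> \<open>\<open>matrix_inv\<close> is a choice and is an inverse only for an invertible
    matrix; hence \<open>inv\<close>.\<close>
  have "M ** matrix_inv M = mat 1" using inv unfolding M_def invertible_def matrix_inv_def by (rule someI2_ex) blast
  then have inv': "(\<Sum>i\<in>UNIV. M $ l $ i * matrix_inv M $ i $ m) = (if l = m then 1 else 0)" for m
    by (simp add: matrix_matrix_mult_def mat_def vec_eq_iff)
  have "(\<Sum>i\<in>UNIV. christoffel A g \<kappa> i j k y * G i l y) =
      (\<Sum>i\<in>UNIV. \<Sum>m\<in>UNIV. 1 / 2 * Q m * (M $ l $ i * matrix_inv M $ i $ m))"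
    unfolding christoffel_def Q_def M_def G_def[symmetric]
    by (intro sum.cong refl) (simp add: sum_distrib_left sum_distrib_right sym[OF y, of l] mult_ac)
  also have "\<dots> = (\<Sum>m\<in>UNIV. 1 / 2 * Q m * (\<Sum>i\<in>UNIV. M $ l $ i * matrix_inv M $ i $ m))"
    by (subst sum.swap) (simp add: sum_distrib_left)
  also have "\<dots> = (\<Sum>m\<in>UNIV. if l = m then 1 / 2 * Q m else 0)" unfolding inv' by (intro sum.cong) auto
  also have "\<dots> = 1 / 2 * Q l" by simp
  also have "\<dots> = christoffel_lowered ?V G j k l y"
    unfolding Q_def christoffel_lowered_def using partial_deriv_cong[OF sym[of _ l k] y, where i = j] by simp
  finally show ?thesis .
qed

lemma contraction_swap:
  fixes X W :: "'n::finite \<Rightarrow> real"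
  assumes "\<And>j k. (\<Sum>i\<in>UNIV. a i j k * g i) = C j k"
  shows "(\<Sum>i\<in>UNIV. (W' i + (\<Sum>j\<in>UNIV. \<Sum>k\<in>UNIV. a i j k * X j * W k)) * g i) =
    (\<Sum>i\<in>UNIV. W' i * g i + W i * (\<Sum>j\<in>UNIV. X j * C j i))"
proof -
  have "(\<Sum>i\<in>UNIV. (\<Sum>j\<in>UNIV. \<Sum>k\<in>UNIV. a i j k * X j * W k) * g i) =
      (\<Sum>i\<in>UNIV. \<Sum>j\<in>UNIV. \<Sum>k\<in>UNIV. W k * (X j * (a i j k * g i)))"
    unfolding sum_distrib_right by (intro sum.cong refl) (simp add: mult_ac)
  also have "\<dots> = (\<Sum>j\<in>UNIV. \<Sum>i\<in>UNIV. \<Sum>k\<in>UNIV. W k * (X j * (a i j k * g i)))" by (rule sum.swap)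
  also have "\<dots> = (\<Sum>j\<in>UNIV. \<Sum>k\<in>UNIV. \<Sum>i\<in>UNIV. W k * (X j * (a i j k * g i)))"
    by (rule sum.cong[OF refl]) (rule sum.swap)
  also have "\<dots> = (\<Sum>k\<in>UNIV. \<Sum>j\<in>UNIV. \<Sum>i\<in>UNIV. W k * (X j * (a i j k * g i)))" by (rule sum.swap)
  also have "\<dots> = (\<Sum>k\<in>UNIV. W k * (\<Sum>j\<in>UNIV. X j * C j k))"
    unfolding assms[symmetric] by (simp add: sum_distrib_left)
  finally show ?thesis by (simp add: distrib_right sum.distrib)
qed

lemma C1_path_on_subinterval:
  fixes f :: "real \<Rightarrow> 'b::real_normed_vector"
  assumes "C1_path_on T f" "{c..d} \<subseteq> T"
  shows "\<And>t. t \<in> {c..d} \<Longrightarrow> (f has_vector_derivative deriv_in T f t) (at t within {c..d})"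
    and "continuous_on {c..d} (deriv_in T f)"
proof -
  show "(f has_vector_derivative deriv_in T f t) (at t within {c..d})" if "t \<in> {c..d}" for t
    using assms that
    by (intro has_vector_derivative_within_subset[OF C1_path_on_has_vector_derivative[OF assms(1)] assms(2)]) auto
  show "continuous_on {c..d} (deriv_in T f)"
    using assms continuous_on_subset unfolding C1_path_on_def by blast
qed

theorem proposition2p2:
  fixes X :: "'a topology"
    and A :: "('a, 'n::finite) chart set"
    and g :: "('a, 'n) metric_tensor"
    and \<gamma> :: "real \<Rightarrow> 'a"
    and W :: "real \<Rightarrow> ('a, 'n) tvec"
    and u :: "'a \<Rightarrow> real^'m::finite"
    and \<kappa> :: "('a, 'n) chart"
    and a b c d \<alpha> :: real
    and l :: 'n
  assumes "riemannian_manifold X A g"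
    and "a < b" and "C2_curve X A a b \<gamma>"
    and "C1_field_along A a b \<gamma> W"
    and "1 / 2 < \<alpha>" and "\<alpha> < 1" and "isometric_immersion A g \<alpha> u"
    and "\<kappa> \<in> A"
    and "c < d" and "{c..d} \<subseteq> {a..b}" and "\<gamma> ` {c..d} \<subseteq> fst \<kappa>"
  shows "holder_on \<alpha> {c..d} (\<lambda>t. pushforward \<kappa> u (\<gamma> t) (W t)) \<and>
    holder_on \<alpha> {c..d} (\<lambda>t. coord_deriv \<kappa> u l (snd \<kappa> (\<gamma> t))) \<and>
    (\<forall>\<phi>\<in>C1_holder0 \<alpha> {c..d}.
      inner_deriv_product \<alpha> {c..d}
        (\<lambda>t. pushforward \<kappa> u (\<gamma> t) (W t))
        (\<lambda>t. coord_deriv \<kappa> u l (snd \<kappa> (\<gamma> t))) \<phi> =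
      integral {c..d} (\<lambda>t.
        (\<Sum>i\<in>UNIV.
          (deriv_in {c..d} (\<lambda>s. W s \<kappa> $ i) t +
           (\<Sum>j\<in>UNIV. \<Sum>k\<in>UNIV.
              christoffel A g \<kappa> i j k (snd \<kappa> (\<gamma> t)) *
              deriv_in {c..d} (\<lambda>s. snd \<kappa> (\<gamma> s) $ j) t * (W t \<kappa> $ k))) *
          metric_coeff A g \<kappa> i l (snd \<kappa> (\<gamma> t))) * \<phi> t))"
proof -
  define V where "V = chart_image \<kappa>"
  define v where "v = u \<circ> chart_inv \<kappa>"
  define G where "G = metric_coeff A g \<kappa>"
  \<comment> \<open>The hypotheses give derivatives within \<open>T\<close>, the conclusion uses
    derivatives within [c, d]. They agree by uniqueness on a nondegenerate interval, which
    \<open>deriv_in_eqI\<close> supplies componentwise in \<open>R\<close>.\<close>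
  define T where "T = {t\<in>{a..b}. \<gamma> t \<in> fst \<kappa>}"
  define x where "x = snd \<kappa> \<circ> \<gamma>"
  define w where "w = (\<lambda>t. W t \<kappa>)"
  define x' where "x' = deriv_in T x"
  define w' where "w' = deriv_in T w"
  have cdT: "{c..d} \<subseteq> T" using assms(10,11) unfolding T_def by auto
  have x: "C1_path_on T x" using assms(3,8) unfolding C2_curve_def C2_path_on_def T_def x_def by blast
  have w: "C1_path_on T w" using assms(4,8) unfolding C1_field_along_def T_def w_def by blast
  have iso: "partial_deriv V v i y \<bullet> partial_deriv V v j y = G i j y"
    and inj: "inj (frechet_derivative v (at y within V))" if "y \<in> V" for i j y
    using assms(7,8) that unfolding isometric_immersion_def coord_deriv_def V_def v_def G_def by blast+
  have v: "C1_on V v"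
    using assms(7,8) unfolding isometric_immersion_def C1_holder_map_def V_def v_def by blast
  interpret isometric_coordinates V v G \<alpha> c d x x' w w'
  proof
    show "C2_domain V"
      using assms(1,8) unfolding riemannian_manifold_def manifold_with_boundary_def is_chart_def V_def by blast
    show "\<exists>N. open N \<and> p \<in> N \<and> holder_on \<alpha> (V \<inter> N) (partial_deriv V v i)" if "p \<in> V" for i p
      using assms(7,8) that unfolding isometric_immersion_def C1_holder_map_def coord_deriv_def V_def v_def by blast
    show "C1_on V (G i j)" for i j
      using assms(1,8) unfolding riemannian_manifold_def C2_on_def V_def G_def by blast
    show "x t \<in> V" if "t \<in> {c..d}" for t
      using that assms(11) unfolding x_def V_def chart_image_def by (auto simp: image_subset_iff)
    show "(x has_vector_derivative x' t) (at t within {c..d})" if "t \<in> {c..d}" for t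
      unfolding x'_def using C1_path_on_subinterval(1)[OF x cdT that] .
    show "continuous_on {c..d} x'" unfolding x'_def using C1_path_on_subinterval(2)[OF x cdT] .
    show "(w has_vector_derivative w' t) (at t within {c..d})" if "t \<in> {c..d}" for t
      unfolding w'_def using C1_path_on_subinterval(1)[OF w cdT that] .
    show "continuous_on {c..d} w'" unfolding w'_def using C1_path_on_subinterval(2)[OF w cdT] .
  qed (use v iso assms in auto)
  have F: "(\<lambda>t. coord_deriv \<kappa> u l (snd \<kappa> (\<gamma> t))) = du l" for l
    unfolding fun_eq_iff du_def unfolding coord_deriv_def V_def v_def x_def by simp
  have P: "(\<lambda>t. pushforward \<kappa> u (\<gamma> t) (W t)) = (\<lambda>t. \<Sum>i\<in>UNIV. (w t $ i) *\<^sub>R du i t)"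
    unfolding pushforward_def w_def F[symmetric] ..
  have R: "(\<Sum>i\<in>UNIV.
          (deriv_in {c..d} (\<lambda>s. W s \<kappa> $ i) t +
           (\<Sum>j\<in>UNIV. \<Sum>k\<in>UNIV.
              christoffel A g \<kappa> i j k (snd \<kappa> (\<gamma> t)) *
              deriv_in {c..d} (\<lambda>s. snd \<kappa> (\<gamma> s) $ j) t * (W t \<kappa> $ k))) *
          metric_coeff A g \<kappa> i l (snd \<kappa> (\<gamma> t))) = \<rho> l t" if t: "t \<in> {c..d}" for t
  proof -
    have "deriv_in {c..d} (\<lambda>s. W s \<kappa> $ i) t = w' t $ i" for i
      using has_real_derivative_component[OF dw[OF t], of i] unfolding w_def
      by (intro deriv_in_eqI cd t) (simp add: has_real_derivative_iff_has_vector_derivative)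
    moreover have "deriv_in {c..d} (\<lambda>s. snd \<kappa> (\<gamma> s) $ j) t = x' t $ j" for j
      using has_real_derivative_component[OF dx[OF t], of j] unfolding x_def
      by (intro deriv_in_eqI cd t) (simp add: has_real_derivative_iff_has_vector_derivative)
    moreover have "(\<Sum>i\<in>UNIV. christoffel A g \<kappa> i j k (x t) * metric_coeff A g \<kappa> i l (x t)) =
        christoffel_lowered V G j k l (x t)" for j k
      unfolding V_def G_def
    proof (rule christoffel_contract_metric)
      show "x t \<in> chart_image \<kappa>" using xV[OF t] unfolding V_def .
      show "invertible (\<chi> p q. metric_coeff A g \<kappa> p q (x t))"
        using invertible_gram[OF v xV[OF t] inj[OF xV[OF t]] iso[OF xV[OF t]]] unfolding G_def .
      \<comment> \<open>Symmetry of the coefficients is read off from the isometry, through the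
        Euclidean inner product.\<close>
      show "metric_coeff A g \<kappa> i j z = metric_coeff A g \<kappa> j i z" if "z \<in> chart_image \<kappa>" for i j z
        using that iso[of z i j] iso[of z j i] unfolding V_def G_def by (simp add: inner_commute)
    qed
    then have "(\<Sum>i\<in>UNIV. (w' t $ i + (\<Sum>j\<in>UNIV. \<Sum>k\<in>UNIV. christoffel A g \<kappa> i j k (x t) * x' t $ j * w t $ k)) *
        metric_coeff A g \<kappa> i l (x t)) = \<rho> l t"
      unfolding \<rho>_def unfolding G_def by (rule contraction_swap)
    ultimately show ?thesis unfolding x_def w_def by simp
  qed
  show ?thesis
    unfolding F P
  proof (intro conjI ballI holder_du holder_pushforward)
    fix \<phi> assume "\<phi> \<in> C1_holder0 \<alpha> {c..d}"
    then have \<phi>: "C1_path_on {c..d} \<phi>" unfolding C1_holder0_def C1_holder_def by blast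
    show "inner_deriv_product \<alpha> {c..d} (\<lambda>t. \<Sum>i\<in>UNIV. (w t $ i) *\<^sub>R du i t) (du l) \<phi> =
      integral {c..d} (\<lambda>t.
        (\<Sum>i\<in>UNIV.
          (deriv_in {c..d} (\<lambda>s. W s \<kappa> $ i) t +
           (\<Sum>j\<in>UNIV. \<Sum>k\<in>UNIV.
              christoffel A g \<kappa> i j k (snd \<kappa> (\<gamma> t)) *
              deriv_in {c..d} (\<lambda>s. snd \<kappa> (\<gamma> s) $ j) t * (W t \<kappa> $ k))) *
          metric_coeff A g \<kappa> i l (snd \<kappa> (\<gamma> t))) * \<phi> t)"
      unfolding inner_deriv_product_eq[OF \<phi>] by (intro integral_cong) (simp only: R)
  qed
qed

end
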